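(* Let $d,n_1,\dots,n_d$ be positive integers. If there exists a balanced neighborly simplicial sphere of type $(n_1,\dots,n_d)$, then for every field $K$ there exists a balanced neighborly polynomial of type $(n_1,\dots,n_d)$ over $K$.
   Context: Balanced neighborly polynomials. Let $R=K[x_{ij}\mid 1\le i\le d,\ 1\le j\le n_i]$, $\mathbb{Z}^d$-graded by $\deg(x_{ij})=\mathfrak{e}_i$, the $i$-th unit vector of $\mathbb{Z}^d$. A polynomial $f\in R$ is balanced if it is homogeneous for this grading of degree $(1,1,\dots,1)$. For $S\subseteq[d]=\{1,\dots,d\}$ put $\mathfrak{e}_S=\sum_{i\in S}\mathfrak{e}_i$, let $R_{\mathfrak{e}_S}$ be the component of $R$ of degree $\mathfrak{e}_S$, and for balanced $f$ set $H(f,S)=\dim_K\{g(\partial_{ij})f\mid g(x_{ij})\in R_{\mathfrak{e}_S}\}$, where $\partial_{ij}=\partial/\partial x_{ij}$. A balanced polynomial $f\in R$ is a balanced neighborly polynomial of type $(n_1,\dots,n_d)$ over $K$ if $H(f,S)=\prod_{k\in S}n_k$ for every $S\subseteq[d]$ with $|S|\le d/2$. Balanced neighborly simplicial spheres. A simplicial sphere is a finite simplicial complex homeomorphic to a sphere. A $(d-1)$-dimensional simplicial complex $\Delta$ with vertex set $V$ is balanced if it has a proper $d$-coloring map, i.e. a map $\kappa:V\to[d]$ with $\kappa(u)\ne\kappa(v)$ for every edge $\{u,v\}\in\Delta$; put $V_k=\{v\in V\mid\kappa(v)=k\}$. For a field $K$, the Stanley--Reisner ring is $K[\Delta]=K[x_v\mid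 v\in V]/I_\Delta$ with $I_\Delta=(\prod_{v\in F}x_v\mid F\subseteq V,\ F\notin\Delta)$; it is $\mathbb{Z}^d$-graded by $\deg(x_v)=\mathfrak{e}_{\kappa(v)}$. Let $\Theta=\theta_1,\dots,\theta_d$ with $\theta_k=\sum_{v\in V_k}x_v$; this is a linear system of parameters of $K[\Delta]$, homogeneous for the $\mathbb{Z}^d$-grading. A balanced simplicial sphere $\Delta$ of dimension $d-1$ (with such a coloring $\kappa$) is neighborly of type $(n_1,\dots,n_d)$ if $\dim_K\bigl(K[\Delta]/(\Theta)\bigr)_{\mathfrak{e}_S}=\prod_{k\in S}n_k$ for all $S\subseteq[d]$ with $|S|\le d/2$. For a simplicial sphere these dimensions do not depend on the field $K$. *)

theory Defs
  imports
    "HOL-Analysis.Analysis"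
    "HOL-Library.Poly_Mapping"
    "HOL-Algebra.QuotRing"
    "HOL-Algebra.Embedded_Algebras"
begin

section \<open>Multigraded polynomial rings\<close>

text \<open>
  A polynomial is a finitely supported map from monomials to coefficients, a monomial being a
  finitely supported exponent function; the ring operations are those of Poly_Mapping.
\<close>

type_synonym ('x, 'k) mpoly = "('x \<Rightarrow>\<^sub>0 nat) \<Rightarrow>\<^sub>0 'k"

definition mvar :: "'x \<Rightarrow> ('x, 'k::field) mpoly"
  where "mvar x = Poly_Mapping.single (Poly_Mapping.single x 1) 1"

definition mpoly_ring :: "'x set \<Rightarrow> ('x, 'k::field) mpoly ring"
  where "mpoly_ring X =
    \<lparr>carrier = {p. \<forall>m\<in>Poly_Mapping.keys p. Poly_Mapping.keys m \<subseteq> X},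
     monoid.mult = (*), one = 1, ring.zero = 0, add = (+)\<rparr>"

text \<open>The copy of the coefficient field inside the polynomial ring.\<close>

definition scalars :: "('x, 'k::field) mpoly set"
  where "scalars = {Poly_Mapping.single 0 a | a. True}"

lemma mpoly_ring_cring: "cring (mpoly_ring X :: ('x, 'k::field) mpoly ring)"
proof -
  have mult: "Poly_Mapping.keys m \<subseteq> X"
    if "m \<in> Poly_Mapping.keys (p * q)" "p \<in> carrier (mpoly_ring X)" "q \<in> carrier (mpoly_ring X)"
    for m and p q :: "('x, 'k) mpoly"
  proof -
    obtain a b where "m = a + b" "a \<in> Poly_Mapping.keys p" "b \<in> Poly_Mapping.keys q"
      using keys_mult[of p q] \<open>m \<in> _\<close> by blast
    then show ?thesis
      using that keys_add[of a b] unfolding mpoly_ring_def by (simp, blast)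
  qed
  have neg: "\<exists>q\<in>carrier (mpoly_ring X). q + p = 0"
    if "p \<in> carrier (mpoly_ring X)" for p :: "('x, 'k) mpoly"
    using that by (intro bexI[of _ "- p"]) (auto simp: mpoly_ring_def)
  show ?thesis
  proof (rule cringI)
    show "abelian_group (mpoly_ring X :: ('x, 'k) mpoly ring)"
      using neg keys_add
      by (intro abelian_groupI) (fastforce simp: mpoly_ring_def ac_simps)+
    show "comm_monoid (mpoly_ring X :: ('x, 'k) mpoly ring)"
      using mult by (intro comm_monoidI) (auto simp: mpoly_ring_def ac_simps)
  qed (auto simp: mpoly_ring_def algebra_simps)
qed

lemma scalars_subfield:
  "subfield (scalars :: ('x, 'k::field) mpoly set) (mpoly_ring X)"
proof -
  interpret cring "mpoly_ring X :: ('x, 'k) mpoly ring" by (rule mpoly_ring_cring)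
  have neg: "\<ominus>\<^bsub>mpoly_ring X\<^esub> Poly_Mapping.single 0 a = Poly_Mapping.single 0 (- a)" for a :: 'k
    by (rule minus_equality) (auto simp: mpoly_ring_def simp flip: single_add)
  have sub: "subcring (scalars :: ('x, 'k) mpoly set) (mpoly_ring X)"
  proof (rule subcringI'[OF subringI])
    show "scalars \<subseteq> carrier (mpoly_ring X :: ('x, 'k) mpoly ring)"
      by (auto simp: scalars_def mpoly_ring_def split: if_splits)
    show "\<one>\<^bsub>mpoly_ring X\<^esub> \<in> (scalars :: ('x, 'k) mpoly set)"
      by (auto simp: scalars_def mpoly_ring_def simp flip: single_one)
    fix h :: "('x, 'k) mpoly" assume "h \<in> scalars"
    then show "\<ominus>\<^bsub>mpoly_ring X\<^esub> h \<in> scalars" by (auto simp: scalars_def neg)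
  qed (auto simp: scalars_def mpoly_ring_def mult_single simp flip: single_add)
  show ?thesis
  proof (rule subfieldI[OF sub])
    show "Units (mpoly_ring X\<lparr>carrier := scalars :: ('x, 'k) mpoly set\<rparr>)
        = scalars - {\<zero>\<^bsub>mpoly_ring X\<^esub>}"
    proof (intro equalityI subsetI)
      fix p :: "('x, 'k) mpoly" assume "p \<in> scalars - {\<zero>\<^bsub>mpoly_ring X\<^esub>}"
      then obtain a where a: "p = Poly_Mapping.single 0 a" "a \<noteq> 0"
        unfolding scalars_def mpoly_ring_def by (auto, metis single_zero)
      then have "p * Poly_Mapping.single 0 (inverse a) = 1"
        by (simp add: mult_single)
      with a show "p \<in> Units (mpoly_ring X\<lparr>carrier := scalars\<rparr>)"
        unfolding Units_def scalars_def mpoly_ring_def by (auto simp: mult.commute)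
    qed (auto simp: Units_def mpoly_ring_def)
  qed
qed

text \<open>
  The grading group is the group of functions \<open>nat \<Rightarrow> int\<close>, in which an element of
  \<open>\<int>\<^sup>d\<close> is extended by zero outside \<open>{1..d}\<close>. If the
  variable \<open>x\<close> has colour \<open>c x\<close>, its degree is the unit vector at \<open>c x\<close>; the vector
  \<open>\<ee>\<^sub>S\<close> is \<open>indicator S\<close>.
\<close>

definition multidegree :: "('x \<Rightarrow> nat) \<Rightarrow> ('x \<Rightarrow>\<^sub>0 nat) \<Rightarrow> nat \<Rightarrow> int"
  where "multidegree c m i =
    (\<Sum>x\<in>Poly_Mapping.keys m. int (Poly_Mapping.lookup m x) * indicator {c x} i)"

definition graded_component ::
    "'x set \<Rightarrow> ('x \<Rightarrow> nat) \<Rightarrow> (nat \<Rightarrow> int) \<Rightarrow> ('x, 'k::field) mpoly set"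
  where "graded_component X c a =
    {p \<in> carrier (mpoly_ring X). \<forall>m\<in>Poly_Mapping.keys p. multidegree c m = a}"


section \<open>Constant coefficient differential operators\<close>

definition partial_diff :: "'x \<Rightarrow> ('x, 'k::field) mpoly \<Rightarrow> ('x, 'k) mpoly"
  where "partial_diff x p =
    (\<Sum>m\<in>Poly_Mapping.keys p. Poly_Mapping.single (m - Poly_Mapping.single x 1)
       (of_nat (Poly_Mapping.lookup m x) * Poly_Mapping.lookup p m))"

lemma lookup_partial_diff:
  "Poly_Mapping.lookup (partial_diff x p) m =
    of_nat (Suc (Poly_Mapping.lookup m x)) * Poly_Mapping.lookup p (m + Poly_Mapping.single x 1)"
proof -
  let ?e = "Poly_Mapping.single x (1::nat)"
  have iff: "k - ?e = m \<longleftrightarrow> k = m + ?e" if "Poly_Mapping.lookup k x \<noteq> 0" for k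
  proof
    assume "k - ?e = m"
    moreover have "k = k - ?e + ?e"
      using that by (intro poly_mapping_eqI)
        (auto simp: lookup_add lookup_minus lookup_single when_def)
    ultimately show "k = m + ?e" by simp
  qed simp
  have "Poly_Mapping.lookup (partial_diff x p) m =
      (\<Sum>k\<in>Poly_Mapping.keys p. if k = m + ?e
         then of_nat (Poly_Mapping.lookup k x) * Poly_Mapping.lookup p k else 0)"
    unfolding partial_diff_def lookup_sum
  proof (rule sum.cong[OF refl])
    fix k
    show "Poly_Mapping.lookup (Poly_Mapping.single (k - ?e)
        (of_nat (Poly_Mapping.lookup k x) * Poly_Mapping.lookup p k)) m =
      (if k = m + ?e then of_nat (Poly_Mapping.lookup k x) * Poly_Mapping.lookup p k else 0)"
      using iff[of k]
      by (cases "Poly_Mapping.lookup k x = 0") (auto simp: lookup_single when_def)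
  qed
  also have "\<dots> = of_nat (Suc (Poly_Mapping.lookup m x)) * Poly_Mapping.lookup p (m + ?e)"
    by (auto simp: sum.delta lookup_add not_in_keys_iff_lookup_eq_zero)
  finally show ?thesis .
qed

lemma partial_diff_commute:
  "partial_diff x (partial_diff y p) = partial_diff y (partial_diff x p)"
  by (cases "x = y")
     (auto intro!: poly_mapping_eqI
       simp: lookup_partial_diff lookup_add lookup_single when_def ac_simps)

text \<open>
  \<open>g(\<partial>)f\<close>: every monomial of \<open>g\<close> acts by the composition of the
  powers of the partial derivatives prescribed by its exponents. The partial derivatives commute
  by the lemma \<open>partial_diff_commute\<close>, so the fold does not depend on an order of the
  variables.
\<close>

definition monomial_diff :: "('x \<Rightarrow>\<^sub>0 nat) \<Rightarrow> ('x, 'k::field) mpoly \<Rightarrow> ('x, 'k) mpoly"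
  where "monomial_diff m f =
    Finite_Set.fold (\<lambda>x. partial_diff x ^^ Poly_Mapping.lookup m x) f (Poly_Mapping.keys m)"

lemma comp_fun_commute_partial_diff:
  "comp_fun_commute (\<lambda>x. partial_diff x ^^ Poly_Mapping.lookup m x)"
proof -
  interpret comp_fun_commute "partial_diff :: 'x \<Rightarrow> ('x, 'k::field) mpoly \<Rightarrow> _"
    by standard (simp add: fun_eq_iff partial_diff_commute)
  show ?thesis by (rule comp_fun_commute_funpow)
qed

definition apply_diff :: "('x, 'k::field) mpoly \<Rightarrow> ('x, 'k) mpoly \<Rightarrow> ('x, 'k) mpoly"
  where "apply_diff g f =
    (\<Sum>m\<in>Poly_Mapping.keys g.
       Poly_Mapping.single 0 (Poly_Mapping.lookup g m) * monomial_diff m f)"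


section \<open>Balanced neighborly polynomials\<close>

text \<open>The variable \<open>x\<^sub>i\<^sub>j\<close> is the pair \<open>(i, j)\<close>, and its colour is \<open>i\<close>.\<close>

definition variables :: "nat \<Rightarrow> (nat \<Rightarrow> nat) \<Rightarrow> (nat \<times> nat) set"
  where "variables d n = (SIGMA i:{1..d}. {1..n i})"

definition balanced_polynomial ::
    "nat \<Rightarrow> (nat \<Rightarrow> nat) \<Rightarrow> (nat \<times> nat, 'k::field) mpoly \<Rightarrow> bool"
  where "balanced_polynomial d n f \<longleftrightarrow>
    f \<in> graded_component (variables d n) fst (indicator {1..d})"

definition hilbert ::
    "nat \<Rightarrow> (nat \<Rightarrow> nat) \<Rightarrow> (nat \<times> nat, 'k::field) mpoly \<Rightarrow> nat set \<Rightarrow> nat"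
  where "hilbert d n f S =
    ring.dim (mpoly_ring (variables d n)) scalars
      {apply_diff g f | g. g \<in> graded_component (variables d n) fst (indicator S)}"

definition balanced_neighborly_polynomial ::
    "nat \<Rightarrow> (nat \<Rightarrow> nat) \<Rightarrow> (nat \<times> nat, 'k::field) mpoly \<Rightarrow> bool"
  where "balanced_neighborly_polynomial d n f \<longleftrightarrow>
    balanced_polynomial d n f \<and>
    (\<forall>S\<subseteq>{1..d}. real (card S) \<le> real d / 2 \<longrightarrow> hilbert d n f S = (\<Prod>k\<in>S. n k))"


section \<open>Balanced simplicial spheres\<close>

text \<open>
  A complex is given by its set of faces, including the empty face; its vertex set is the union
  of the faces.
\<close>

definition simplicial_complex :: "'v set set \<Rightarrow> bool"
  where "simplicial_complex \<Delta> \<longleftrightarrow>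
    finite \<Delta> \<and> {} \<in> \<Delta> \<and> (\<forall>F\<in>\<Delta>. finite F \<and> (\<forall>G\<subseteq>F. G \<in> \<Delta>))"

definition complex_dim :: "'v set set \<Rightarrow> int"
  where "complex_dim \<Delta> = int (Max (card ` \<Delta>)) - 1"

text \<open>Points of the realization are barycentric coordinates, supported on a face.\<close>

definition realization :: "'v set set \<Rightarrow> ('v \<Rightarrow> real) topology"
  where "realization \<Delta> = subtopology (powertop_real UNIV)
    {t. (\<forall>v. 0 \<le> t v) \<and> {v. t v \<noteq> 0} \<in> \<Delta> \<and> (\<Sum>v\<in>\<Union>\<Delta>. t v) = 1}"

definition simplicial_sphere :: "'v set set \<Rightarrow> bool"
  where "simplicial_sphere \<Delta> \<longleftrightarrow>
    simplicial_complex \<Delta> \<and> (\<exists>m. realization \<Delta> homeomorphic_space nsphere m)"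

definition proper_coloring :: "nat \<Rightarrow> 'v set set \<Rightarrow> ('v \<Rightarrow> nat) \<Rightarrow> bool"
  where "proper_coloring d \<Delta> \<kappa> \<longleftrightarrow>
    \<kappa> ` \<Union>\<Delta> \<subseteq> {1..d} \<and> (\<forall>u v. u \<noteq> v \<and> {u, v} \<in> \<Delta> \<longrightarrow> \<kappa> u \<noteq> \<kappa> v)"


section \<open>Stanley--Reisner rings and neighborliness\<close>

abbreviation vertex_ring :: "'v set set \<Rightarrow> ('v, 'k::field) mpoly ring"
  where "vertex_ring \<Delta> \<equiv> mpoly_ring (\<Union>\<Delta>)"

definition SR_ideal :: "'v set set \<Rightarrow> ('v, 'k::field) mpoly set"
  where "SR_ideal \<Delta> =
    Idl\<^bsub>vertex_ring \<Delta>\<^esub> {\<Prod>v\<in>F. mvar v | F. F \<subseteq> \<Union>\<Delta> \<and> F \<notin> \<Delta>}"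

definition SR_ring :: "'v set set \<Rightarrow> ('v, 'k::field) mpoly set ring"
  where "SR_ring \<Delta> = vertex_ring \<Delta> Quot SR_ideal \<Delta>"

definition SR_class :: "'v set set \<Rightarrow> ('v, 'k::field) mpoly \<Rightarrow> ('v, 'k) mpoly set"
  where "SR_class \<Delta> p = SR_ideal \<Delta> +>\<^bsub>vertex_ring \<Delta>\<^esub> p"

definition theta :: "'v set set \<Rightarrow> ('v \<Rightarrow> nat) \<Rightarrow> nat \<Rightarrow> ('v, 'k::field) mpoly"
  where "theta \<Delta> \<kappa> k = (\<Sum>v\<in>{v \<in> \<Union>\<Delta>. \<kappa> v = k}. mvar v)"

definition theta_ideal ::
    "nat \<Rightarrow> 'v set set \<Rightarrow> ('v \<Rightarrow> nat) \<Rightarrow> ('v, 'k::field) mpoly set set"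
  where "theta_ideal d \<Delta> \<kappa> =
    Idl\<^bsub>SR_ring \<Delta>\<^esub> {SR_class \<Delta> (theta \<Delta> \<kappa> k) | k. k \<in> {1..d}}"

definition SR_reduction ::
    "nat \<Rightarrow> 'v set set \<Rightarrow> ('v \<Rightarrow> nat) \<Rightarrow> ('v, 'k::field) mpoly set set ring"
  where "SR_reduction d \<Delta> \<kappa> = SR_ring \<Delta> Quot theta_ideal d \<Delta> \<kappa>"

definition reduction_class ::
    "nat \<Rightarrow> 'v set set \<Rightarrow> ('v \<Rightarrow> nat) \<Rightarrow> ('v, 'k::field) mpoly \<Rightarrow> ('v, 'k) mpoly set set"
  where "reduction_class d \<Delta> \<kappa> p = theta_ideal d \<Delta> \<kappa> +>\<^bsub>SR_ring \<Delta>\<^esub> SR_class \<Delta> p"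

text \<open>
  The quotient grading: a component of the quotient is the image of the corresponding component
  of the polynomial ring. The dimension is over the image of the coefficient field. The type
  argument names the coefficient field.
\<close>

definition reduction_dim ::
    "'k::field itself \<Rightarrow> nat \<Rightarrow> 'v set set \<Rightarrow> ('v \<Rightarrow> nat) \<Rightarrow> nat set \<Rightarrow> nat"
  where "reduction_dim K d \<Delta> \<kappa> S =
    ring.dim (SR_reduction d \<Delta> \<kappa>)
      (reduction_class d \<Delta> \<kappa> ` (scalars :: ('v, 'k) mpoly set))
      (reduction_class d \<Delta> \<kappa> ` graded_component (\<Union>\<Delta>) \<kappa> (indicator S))"

definition balanced_neighborly_sphere ::
    "'k::field itself \<Rightarrow> nat \<Rightarrow> (nat \<Rightarrow> nat) \<Rightarrow> 'v set set \<Rightarrow> ('v \<Rightarrow> nat) \<Rightarrow> bool"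
  where "balanced_neighborly_sphere K d n \<Delta> \<kappa> \<longleftrightarrow>
    simplicial_sphere \<Delta> \<and> complex_dim \<Delta> = int d - 1 \<and> proper_coloring d \<Delta> \<kappa> \<and>
    (\<forall>S\<subseteq>{1..d}. real (card S) \<le> real d / 2 \<longrightarrow>
       reduction_dim K d \<Delta> \<kappa> S = (\<Prod>k\<in>S. n k))"

end

theory Submission
  imports Defs "HOL-Homology.Homology"
begin

text \<open>Let \<open>\<Delta>\<close> be the sphere and choose a vertex \<open>\<beta>\<^sub>i\<close> of each colour. In squarefree degrees the reduced
  Stanley--Reisner ring is spanned by the monomials of rainbow faces avoiding these vertices.
  Neighborliness therefore forces the colour class of \<open>i\<close> to have \<open>n\<^sub>i + 1\<close> vertices, and every rainbow
  set of at most \<open>d/2\<close> vertices to be a face; neither condition involves a field. Let \<open>\<phi>\<close> be a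
  fundamental cycle of \<open>\<Delta>\<close> over \<open>K\<close>, with signs removed by means of the colouring. The required
  polynomial is the sum of \<open>\<phi>(F) x\<^sub>F\<close> over the rainbow sets \<open>F\<close> of size \<open>d\<close> that avoid the \<open>\<beta>\<^sub>i\<close>.

  Its Hilbert function is maximal because the cycles supported in a set \<open>S\<close> of colours are all obtained
  from \<open>\<phi>\<close> by contracting with rainbow sets of the complementary colours. For this one extends
  cycles colour by colour, in \<open>\<Delta>\<close> and in the deletions of its vertices; the homology groups that
  obstruct the extension vanish by the Cohen--Macaulay property. That property follows from the
  acyclicity of the deletion of a nonempty face, whose realization is a retract of a punctured
  sphere. When \<open>\<Delta>\<close> contains all rainbow \<open>S\<close>-sets, a cross-polytope cycle with one vertex \<open>\<beta>\<^sub>i\<close> in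
  each pair separates any given monomial from the others.\<close>

section \<open>Simplicial chains\<close>

text \<open>The fields of the hypothesis and of the conclusion are unrelated, so all information has
  to pass through combinatorics and topology: neighborliness gives class sizes and faces, the sphere
  gives acyclicity. A null-homotopy acts on integral singular chains; an integral contracting
  homotopy then transfers acyclicity to every coefficient ring. The polynomial is multilinear, so
  the coefficient at the monomial of \<open>A'\<close> of its derivative by the monomial of
  \<open>A\<close> is its coefficient at \<open>A \<union> A'\<close>, with factor 1 in every
  characteristic. Maximality at \<open>S\<close> therefore says that the matrix with entries
  \<phi>(A \<union> A') has independent rows, where \<open>A\<close> has colours \<open>S\<close>,
  \<open>A'\<close> has the remaining colours, and both avoid the \<beta>. The equations of \<phi>
  at each colour let the columns through some \<beta> be added again. That contractions of \<phi>
  exhaust the \<open>S\<close>-cycles is then used dually: coefficients orthogonal to all columns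
  are orthogonal to every \<open>S\<close>-cycle, and a suitable cycle reads off one
  coefficient.\<close>

text \<open>A chain is a coefficient function on vertex sets. Simplices are oriented by the vertex
  order \<open>e\<close>, and the empty set is a simplex, so that homology is reduced.\<close>

locale vertex_order =
  fixes e :: "'v \<Rightarrow> nat" and V :: "'v set"
  assumes finite_V: "finite V" and inj_e: "inj_on e V"
begin

definition vsign :: "'v \<Rightarrow> 'v set \<Rightarrow> 'k::comm_ring_1"
  where "vsign v G = (- 1) ^ card {u \<in> G. e u < e v}"

text \<open>The boundary in terms of coefficients: the value at a face is collected from its
  cofaces. Only supersets of \<open>G\<close> enter, so on the simplices above a fixed face it can
  be evaluated without leaving them.\<close>

definition bd :: "('v set \<Rightarrow> 'k::comm_ring_1) \<Rightarrow> 'v set \<Rightarrow> 'k"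
  where "bd c G = (if G \<subseteq> V then \<Sum>v\<in>V - G. vsign v G * c (insert v G) else 0)"

text \<open>The join with \<open>v\<close>, put in its place by the sign. Terms of \<open>c\<close>
  that already contain \<open>v\<close> are lost, because \<open>G - {v}\<close> never contains it;
  degenerate simplices thus become zero.\<close>

definition cone :: "'v \<Rightarrow> ('v set \<Rightarrow> 'k::comm_ring_1) \<Rightarrow> 'v set \<Rightarrow> 'k"
  where "cone v c G = (if v \<in> G then vsign v (G - {v}) * c (G - {v}) else 0)"

lemma vsign_square [simp]: "vsign v G * vsign v G = (1 :: 'k::comm_ring_1)"
  by (simp add: vsign_def flip: power_add mult_2)

lemma vsign_square' [simp]: "vsign v G * (vsign v G * x) = (x :: 'k::comm_ring_1)"
  by (simp flip: mult.assoc)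

lemma vsign_insert:
  assumes "finite G" "u \<notin> G"
  shows "vsign v (insert u G) = (if e u < e v then - vsign v G else vsign v G :: 'k::comm_ring_1)"
proof (cases "e u < e v")
  case True
  then have "{w \<in> insert u G. e w < e v} = insert u {w \<in> G. e w < e v}" by auto
  then show ?thesis using True assms by (simp add: vsign_def)
next
  case False
  then have "{w \<in> insert u G. e w < e v} = {w \<in> G. e w < e v}" by auto
  then show ?thesis using False by (simp add: vsign_def)
qed

lemma of_int_vsign [simp]: "of_int (vsign v G) = (vsign v G :: 'k::comm_ring_1)"
  by (simp add: vsign_def)

lemma vsign_swap:
  assumes "G \<subseteq> V" "u \<in> V" "v \<in> V" "u \<notin> G" "v \<notin> G" "u \<noteq> v"
  shows "vsign v G * vsign u (insert v G) = - (vsign u G * vsign v (insert u G) :: 'k::comm_ring_1)"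
proof -
  have "finite G" using assms(1) finite_V finite_subset by blast
  moreover have "e u \<noteq> e v" using assms inj_e by (auto dest: inj_onD)
  ultimately show ?thesis using assms by (auto simp: vsign_insert mult.commute)
qed

lemma bd_add: "bd (\<lambda>G. c G + c' G) H = bd c H + bd c' H"
  by (simp add: bd_def algebra_simps sum.distrib)

lemma bd_diff: "bd (\<lambda>G. c G - c' G) H = bd c H - bd c' H"
  by (simp add: bd_def algebra_simps sum_subtractf)

lemma bd_mult: "bd (\<lambda>G. a * c G) H = a * bd c H"
  by (simp add: bd_def algebra_simps sum_distrib_left)

lemma bd_sum: "bd (\<lambda>G. \<Sum>i\<in>I. c i G) H = (\<Sum>i\<in>I. bd (c i) H)"
  by (induction I rule: infinite_finite_induct) (simp_all add: bd_add, auto simp: bd_def)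

lemma bd_0 [simp]: "bd (\<lambda>G. 0) H = 0"
  by (simp add: bd_def)

lemma bd_of_int: "bd (\<lambda>G. of_int (c G)) H = of_int (bd c H)"
  by (simp add: bd_def)

lemma bd_supp:
  assumes "bd c G \<noteq> 0"
  obtains v where "v \<in> V - G" "c (insert v G) \<noteq> 0" "G \<subseteq> V"
proof -
  have G: "G \<subseteq> V" using assms by (auto simp: bd_def split: if_splits)
  then have "(\<Sum>v\<in>V - G. vsign v G * c (insert v G)) \<noteq> 0" using assms by (simp add: bd_def)
  then obtain v where "v \<in> V - G" "vsign v G * c (insert v G) \<noteq> 0"
    by (rule sum.not_neutral_contains_not_neutral)
  then show ?thesis using that G by fastforce
qed

text \<open>The pairs are cancelled against each other along the order \<open>e\<close>. Comparing
  the sum with its own negative would only show that twice the sum is 0, which says nothing in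
  characteristic 2.\<close>

lemma antisymmetric_sum:
  fixes a :: "'v \<Rightarrow> 'v \<Rightarrow> 'k::comm_ring_1"
  assumes "W \<subseteq> V" "\<And>u v. u \<in> W \<Longrightarrow> v \<in> W \<Longrightarrow> u \<noteq> v \<Longrightarrow> a u v = - a v u"
  shows "(\<Sum>u\<in>W. \<Sum>v\<in>W - {u}. a u v) = 0"
proof -
  have fin: "finite W" using assms(1) finite_V finite_subset by blast
  have split: "W - {u} = {v \<in> W. e u < e v} \<union> {v \<in> W. e v < e u}" if "u \<in> W" for u
    using that assms(1) inj_e by (auto simp: inj_on_def) (metis linorder_neqE_nat subsetD)
  have "(\<Sum>u\<in>W. \<Sum>v\<in>W - {u}. a u v)
      = (\<Sum>u\<in>W. (\<Sum>v\<in>{v \<in> W. e u < e v}. a u v) + (\<Sum>v\<in>{v \<in> W. e v < e u}. a u v))"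
    by (intro sum.cong refl, subst split, assumption, rule sum.union_disjoint) (auto simp: fin)
  also have "\<dots> = (\<Sum>u\<in>W. \<Sum>v\<in>{v \<in> W. e u < e v}. a u v) + (\<Sum>u\<in>W. \<Sum>v\<in>{v \<in> W. e v < e u}. a u v)"
    by (rule sum.distrib)
  also have "(\<Sum>u\<in>W. \<Sum>v\<in>{v \<in> W. e v < e u}. a u v) = (\<Sum>v\<in>W. \<Sum>u\<in>{u \<in> W. e v < e u}. a u v)"
    by (rule sum.swap_restrict) (auto simp: fin)
  also have "\<dots> = (\<Sum>v\<in>W. \<Sum>u\<in>{u \<in> W. e v < e u}. - a v u)"
    by (intro sum.cong refl assms(2)) auto
  finally show ?thesis by (simp add: sum_negf)
qed

lemma bd_bd: "bd (bd c) G = (0 :: 'k::comm_ring_1)"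
proof (cases "G \<subseteq> V")
  case True
  have "bd (bd c) G = (\<Sum>v\<in>V - G. \<Sum>u\<in>(V - G) - {v}. vsign v G * vsign u (insert v G) * c (insert u (insert v G)))"
    using True
    by (auto simp: bd_def sum_distrib_left mult.assoc intro!: sum.cong)
  also have "\<dots> = 0"
  proof (rule antisymmetric_sum)
    fix u v assume uv: "u \<in> V - G" "v \<in> V - G" "u \<noteq> v"
    then have "vsign u G * vsign v (insert u G) = - (vsign v G * vsign u (insert v G) :: 'k)"
      by (intro vsign_swap) (use True in auto)
    then show "vsign u G * vsign v (insert u G) * c (insert v (insert u G)) =
        - (vsign v G * vsign u (insert v G) * c (insert u (insert v G)))"
      by (simp add: insert_commute)
  qed auto
  finally show ?thesis .
qed (simp add: bd_def)

lemma cone_mult: "cone v (\<lambda>G. a * c G) = (\<lambda>G. a * cone v c G)"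
  by (auto simp: cone_def algebra_simps)

lemma cone_sum: "cone v (\<lambda>G. \<Sum>i\<in>I. c i G) = (\<lambda>G. \<Sum>i\<in>I. cone v (c i) G)"
  by (auto simp: cone_def sum_distrib_left)

text \<open>Coning is a homotopy from the identity to zero. At sets avoiding \<open>v\<close> the
  only coface in the cone is \<open>insert v G\<close>; at sets containing \<open>v\<close> the term
  \<open>u = v\<close> of the inner boundary is \<open>c G\<close> and the others cancel by the sign
  rule. The support condition matters because \<open>bd\<close> is cut off outside
  \<open>V\<close>.\<close>

lemma bd_cone:
  assumes v: "v \<in> V" and supp: "\<And>G. c G \<noteq> 0 \<Longrightarrow> G \<subseteq> V"
  shows "bd (cone v c) G = c G - cone v (bd c) (G :: 'v set)"
proof (cases "G \<subseteq> V")
  case True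
  have fin: "finite (V - G)" "finite G" using True finite_V finite_subset by auto
  show ?thesis
  proof (cases "v \<in> G")
    case False
    then have "bd (cone v c) G = (\<Sum>u\<in>V - G. if u = v then vsign v G * (vsign v G * c G) else 0)"
      using True by (auto simp: bd_def cone_def intro!: sum.cong)
    also have "\<dots> = c G" using False v fin by (subst sum.delta) auto
    finally show ?thesis using False by (simp add: cone_def)
  next
    case vG: True
    define H where "H = G - {v}"
    have H: "G = insert v H" "v \<notin> H" "H \<subseteq> V" using vG True by (auto simp: H_def)
    have VH: "V - H = insert v (V - G)" using H v by auto
    have 1: "bd (cone v c) G = (\<Sum>u\<in>V - G. vsign u G * (vsign v (insert u H) * c (insert u H)))"
      using True H
      by (auto simp: bd_def cone_def insert_Diff_if intro!: sum.cong)
    have "cone v (bd c) G = vsign v H * (\<Sum>u\<in>V - H. vsign u H * c (insert u H))"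
      using H by (simp add: cone_def bd_def)
    also have "\<dots> = c G + (\<Sum>u\<in>V - G. vsign v H * (vsign u H * c (insert u H)))"
      unfolding VH using H fin by (simp add: sum_distrib_left distrib_left)
    also have "(\<Sum>u\<in>V - G. vsign v H * (vsign u H * c (insert u H)))
       = (\<Sum>u\<in>V - G. - (vsign u G * (vsign v (insert u H) * c (insert u H))))"
    proof (rule sum.cong[OF refl])
      fix u assume u: "u \<in> V - G"
      have "finite H" using H fin by auto
      moreover have "e u \<noteq> e v" using u v vG inj_e by (auto dest: inj_onD)
      ultimately show "vsign v H * (vsign u H * c (insert u H)) = - (vsign u G * (vsign v (insert u H) * c (insert u H)))"
        using u H by (auto simp: vsign_insert mult.left_commute)
    qed
    finally show ?thesis using 1 by (simp add: sum_negf)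
  qed
next
  case False
  then have "cone v (bd c) G = 0" using v by (auto simp: cone_def bd_def)
  then show ?thesis using False supp[of G] by (auto simp: bd_def)
qed

subsection \<open>The chain of a list of vertices\<close>

text \<open>The oriented simplex of a vertex list as an iterated cone; a list with a repeated vertex
  gives the zero chain.\<close>

primrec list_chain :: "'v list \<Rightarrow> 'v set \<Rightarrow> 'k::comm_ring_1" where
  "list_chain [] = (\<lambda>G. if G = {} then 1 else 0)"
| "list_chain (v # l) = cone v (list_chain l)"

lemma list_chain_supp:
  "list_chain l G \<noteq> (0 :: 'k::comm_ring_1) \<Longrightarrow> G = set l \<and> card G = length l"
proof (induction l arbitrary: G)
  case (Cons v l)
  have "v \<in> G" using Cons.prems by (simp add: cone_def split: if_splits)
  moreover have "list_chain l (G - {v}) \<noteq> (0::'k)" using Cons.prems by (auto simp: cone_def split: if_splits)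
  ultimately show ?case using Cons.IH[of "G - {v}"]
    by (metis List.finite_set card_Suc_Diff1 finite_Diff2 finite.emptyI finite.insertI insert_Diff length_Cons list.simps(15))
qed (auto split: if_splits)

text \<open>Induction through \<open>bd_cone\<close>: removing the head gives the term
  \<open>k = 0\<close>, and coning the boundary of the tail shifts the remaining indices by one and
  changes their sign.\<close>

lemma list_chain_sum:
  assumes "set l \<subseteq> V"
  shows "bd (list_chain l) G =
    (\<Sum>k<length l. (- 1) ^ k * list_chain (take k l @ drop (Suc k) l) G :: 'k::comm_ring_1)"
  using assms
proof (induction l arbitrary: G)
  case Nil
  then show ?case by (auto simp: bd_def intro!: sum.neutral)
next
  case (Cons v l)
  have IH: "bd (list_chain l) = (\<lambda>G. \<Sum>k<length l. (- 1) ^ k * list_chain (take k l @ drop (Suc k) l) G :: 'k)"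
    using Cons by (intro ext) auto
  have "bd (list_chain (v # l)) G = list_chain l G - (cone v (bd (list_chain l)) G :: 'k)"
    using Cons.prems list_chain_supp by (simp, subst bd_cone) (simp_all, blast)
  also have "cone v (bd (list_chain l)) G
     = (\<Sum>k<length l. (- 1) ^ k * cone v (list_chain (take k l @ drop (Suc k) l)) G :: 'k)"
    unfolding IH by (simp only: cone_sum cone_mult)
  finally show ?case
    by (simp add: sum.lessThan_Suc_shift sum_negf del: sum.lessThan_Suc)
qed

subsection \<open>Acyclic families\<close>

text \<open>Degrees count vertices, so they exceed dimensions by one, and degree 0 belongs to the
  empty simplex.\<close>

definition chains :: "'v set set \<Rightarrow> nat \<Rightarrow> ('v set \<Rightarrow> 'k::comm_ring_1) set"
  where "chains K p = {c. \<forall>G. c G \<noteq> 0 \<longrightarrow> G \<in> K \<and> card G = p}"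

definition acyclic_over :: "'k::comm_ring_1 itself \<Rightarrow> 'v set set \<Rightarrow> bool"
  where "acyclic_over _ K \<longleftrightarrow>
    (\<forall>p. \<forall>z\<in>chains K p. (\<forall>G. bd z G = (0::'k)) \<longrightarrow> (\<exists>u\<in>chains K (Suc p). \<forall>G. bd u G = z G))"

lemma chainsI: "(\<And>G. c G \<noteq> 0 \<Longrightarrow> G \<in> K \<and> card G = p) \<Longrightarrow> c \<in> chains K p"
  by (auto simp: chains_def)

lemma chainsD: "c \<in> chains K p \<Longrightarrow> c G \<noteq> 0 \<Longrightarrow> G \<in> K \<and> card G = p"
  by (auto simp: chains_def)

lemma chainsD0: "c \<in> chains K p \<Longrightarrow> \<not> (G \<in> K \<and> card G = p) \<Longrightarrow> c G = 0"
  by (auto simp: chains_def)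

lemma acyclic_overD:
  fixes z :: "'v set \<Rightarrow> 'k::comm_ring_1"
  assumes "acyclic_over TYPE('k) K" "z \<in> chains K p" "\<And>G. bd z G = 0"
  obtains u where "u \<in> chains K (Suc p)" "\<And>G. bd u G = z G"
  using assms unfolding acyclic_over_def by blast

lemma chains_add: "c \<in> chains K p \<Longrightarrow> c' \<in> chains K p \<Longrightarrow> (\<lambda>G. c G + c' G) \<in> chains K p"
  unfolding chains_def by (auto, metis add.right_neutral, metis add.right_neutral)

lemma chains_diff: "c \<in> chains K p \<Longrightarrow> c' \<in> chains K p \<Longrightarrow> (\<lambda>G. c G - c' G) \<in> chains K p"
  unfolding chains_def by (auto, metis diff_0_right, metis diff_0_right)

lemma chains_mult: "c \<in> chains K p \<Longrightarrow> (\<lambda>G. a * c G) \<in> chains K p"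
  unfolding chains_def by (auto, (metis mult_zero_right)+)

lemma chains_sum: "(\<And>i. i \<in> I \<Longrightarrow> c i \<in> chains K p) \<Longrightarrow> (\<lambda>G. \<Sum>i\<in>I. c i G) \<in> chains K p"
  unfolding chains_def by (auto elim!: sum.not_neutral_contains_not_neutral)

lemma chains_mono: "c \<in> chains K p \<Longrightarrow> K \<subseteq> L \<Longrightarrow> c \<in> chains L p"
  unfolding chains_def by auto

lemma bd_chains:
  assumes c: "c \<in> chains K (Suc p)" and K: "\<And>G H. G \<in> K \<Longrightarrow> H \<subseteq> G \<Longrightarrow> H \<in> K"
  shows "bd c \<in> chains K p"
proof (rule chainsI)
  fix G assume "bd c G \<noteq> 0"
  then obtain v where v: "v \<in> V - G" "c (insert v G) \<noteq> 0" "G \<subseteq> V" by (rule bd_supp)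
  then have "insert v G \<in> K" "card (insert v G) = Suc p" using chainsD[OF c] by blast+
  moreover have "finite G" using v finite_V finite_subset by blast
  ultimately show "G \<in> K \<and> card G = p" using v K[of "insert v G" G] by auto
qed

definition point :: "'v set \<Rightarrow> 'v set \<Rightarrow> 'k::comm_ring_1"
  where "point F G = (if G = F then 1 else 0)"

lemma bd_point:
  assumes "F \<subseteq> V"
  shows "bd (point F) G = (\<Sum>v\<in>F. vsign v (F - {v}) * point (F - {v}) G :: 'k::comm_ring_1)"
proof (cases "\<exists>v\<in>F. G = F - {v}")
  case True
  then obtain v where v: "v \<in> F" "G = F - {v}" by blast
  have fin: "finite F" "finite (V - G)" using assms finite_V finite_subset by auto
  have "(\<Sum>u\<in>F. vsign u (F - {u}) * point (F - {u}) G :: 'k)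
      = (\<Sum>u\<in>F. if u = v then vsign v G else 0)"
    using v by (intro sum.cong refl) (auto simp: point_def)
  moreover have "bd (point F) G = (\<Sum>u\<in>V - G. if u = v then vsign v G else 0 :: 'k)"
  proof -
    have "vsign u G * point F (insert u G) = (if u = v then vsign v G else 0 :: 'k)" if "u \<in> V - G" for u
    proof (cases "u = v")
      case True
      then have "insert u G = F" using v by auto
      then show ?thesis using True by (simp add: point_def)
    next
      case False
      then have "insert u G \<noteq> F" using v that by auto
      then show ?thesis using False by (simp add: point_def)
    qed
    then show ?thesis using v assms by (simp add: bd_def Diff_subset[THEN subset_trans])
  qed
  ultimately show ?thesis using v fin assms by (auto simp: sum.delta)
next
  case False
  have "bd (point F) G = (0::'k)"
  proof (rule ccontr)
    assume "bd (point F) G \<noteq> (0::'k)"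
    then obtain v where "v \<in> V - G" "point F (insert v G) \<noteq> (0::'k)"
      by (rule bd_supp[where c = "point F"])
    then show False using False by (auto simp: point_def split: if_splits)
  qed
  then show ?thesis using False by (auto simp: point_def intro!: sum.neutral[symmetric])
qed

text \<open>An acyclic complex of free abelian groups has a contracting homotopy, which is defined by
  integers and therefore contracts the complex over every coefficient ring.\<close>

lemma contracting_homotopy:
  assumes K: "K \<subseteq> Pow V" "\<And>G H. G \<in> K \<Longrightarrow> H \<subseteq> G \<Longrightarrow> H \<in> K"
    and ac: "acyclic_over TYPE(int) K"
  shows "\<exists>s. \<forall>G\<in>K. card G < n \<longrightarrow> s G \<in> chains K (Suc (card G)) \<and>
    (\<forall>H. bd (s G) H = point G H - (\<Sum>v\<in>G. vsign v (G - {v}) * s (G - {v}) H :: int))"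
proof (induction n)
  case (Suc n)
  then obtain s :: "'v set \<Rightarrow> 'v set \<Rightarrow> int" where s: "\<And>G. G \<in> K \<Longrightarrow> card G < n \<Longrightarrow> s G \<in> chains K (Suc (card G))"
    "\<And>G H. G \<in> K \<Longrightarrow> card G < n \<Longrightarrow> bd (s G) H = point G H - (\<Sum>v\<in>G. vsign v (G - {v}) * s (G - {v}) H)"
    by blast
  have ex: "\<exists>u\<in>chains K (Suc (card G)).
      \<forall>H. bd u H = point G H - (\<Sum>v\<in>G. vsign v (G - {v}) * s (G - {v}) H)"
    if G: "G \<in> K" "card G = n" for G
  proof -
    \<comment> \<open>The homotopy must satisfy bd (s G) = G - s (bd G). The right-hand side is
      known from lower degrees; once it is seen to be a cycle, acyclicity provides
      \<open>s G\<close>.\<close>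
    let ?z = "\<lambda>H. point G H - (\<Sum>v\<in>G. vsign v (G - {v}) * s (G - {v}) H)"
    have fin: "G \<subseteq> V" "finite G" using G K(1) finite_subset[OF _ finite_V] by blast+
    have lower: "G - {v} \<in> K" "card (G - {v}) < n" "Suc (card (G - {v})) = n" if "v \<in> G" for v
      using G(2) K(2)[OF G(1), of "G - {v}"] card_Suc_Diff1[OF fin(2) that] by auto
    have "?z \<in> chains K n"
    proof (intro chains_diff chains_sum chains_mult)
      show "point G \<in> chains K n" using G by (auto simp: chains_def point_def)
      show "s (G - {v}) \<in> chains K n" if "v \<in> G" for v
        using s(1) lower[OF that] by metis
    qed
    moreover have "bd ?z H = 0" for H
    proof -
      have "bd ?z H = bd (point G) H - (\<Sum>v\<in>G. vsign v (G - {v}) * bd (s (G - {v})) H)"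
        by (simp only: bd_diff bd_sum bd_mult)
      also have "\<dots> = bd (point G) H - (\<Sum>v\<in>G. vsign v (G - {v}) *
          (point (G - {v}) H - (\<Sum>u\<in>G - {v}. vsign u (G - {v} - {u}) * s (G - {v} - {u}) H)))"
        using s(2) lower by simp
      \<comment> \<open>The \<open>point\<close> terms cancel the boundary of
        \<open>point G\<close>; what remains is s (bd (bd G)), an antisymmetric double sum.\<close>
      also have "\<dots> = (\<Sum>v\<in>G. \<Sum>u\<in>G - {v}. vsign v (G - {v}) * vsign u (G - {v} - {u}) * s (G - {v} - {u}) H)"
        by (simp add: bd_point fin right_diff_distrib sum_subtractf sum_distrib_left mult.assoc)
      also have "\<dots> = 0"
      proof (rule antisymmetric_sum)
        fix u v assume uv: "u \<in> G" "v \<in> G" "u \<noteq> v"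
        define A where "A = G - {u, v}"
        have A: "G - {u} - {v} = A" "G - {v} - {u} = A" by (auto simp: A_def)
        have B: "G - {u} = insert v A" "G - {v} = insert u A" using uv by (auto simp: A_def)
        have "vsign v A * vsign u (insert v A) = - (vsign u A * vsign v (insert u A) :: int)"
          by (rule vsign_swap) (use uv fin in \<open>auto simp: A_def\<close>)
        then have "vsign u (insert v A) * vsign v A = - (vsign v (insert u A) * vsign u A :: int)"
          by (simp only: mult.commute)
        then show "vsign u (G - {u}) * vsign v (G - {u} - {v}) * s (G - {u} - {v}) H =
            - (vsign v (G - {v}) * vsign u (G - {v} - {u}) * s (G - {v} - {u}) H)"
          unfolding A unfolding B by simp
      qed (use fin in auto)
      finally show ?thesis .
    qed
    ultimately show ?thesis using ac G(2) unfolding acyclic_over_def by blast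
  qed
  obtain r where r: "\<And>G. G \<in> K \<Longrightarrow> card G = n \<Longrightarrow> r G \<in> chains K (Suc (card G))"
    "\<And>G H. G \<in> K \<Longrightarrow> card G = n \<Longrightarrow> bd (r G) H = point G H - (\<Sum>v\<in>G. vsign v (G - {v}) * s (G - {v}) H)"
  proof -
    have "\<forall>G\<in>{G \<in> K. card G = n}. \<exists>u. u \<in> chains K (Suc (card G)) \<and>
        (\<forall>H. bd u H = point G H - (\<Sum>v\<in>G. vsign v (G - {v}) * s (G - {v}) H))"
      using ex by blast
    from bchoice[OF this] show ?thesis using that by blast
  qed
  define t where "t G = (if card G = n then r G else s G)" for G
  have t: "t G \<in> chains K (Suc (card G)) \<and>
      (\<forall>H. bd (t G) H = point G H - (\<Sum>v\<in>G. vsign v (G - {v}) * s (G - {v}) H))"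
    if "G \<in> K" "card G \<le> n" for G
  proof (cases "card G = n")
    case True
    then have "t G = r G" by (simp add: t_def)
    then show ?thesis using r[OF that(1) True] by simp
  next
    case False
    then have "t G = s G" "card G < n" using that by (auto simp: t_def)
    then show ?thesis using s(1)[OF that(1)] s(2)[OF that(1)] by simp
  qed
  have st: "s (G - {v}) = t (G - {v})" if "G \<in> K" "card G \<le> n" "v \<in> G" for G v
  proof -
    have "finite G" using that(1) K(1) finite_subset[OF _ finite_V] by blast
    then have "card (G - {v}) < card G" using that by (intro card_Diff1_less)
    then have "card (G - {v}) \<noteq> n" using that by linarith
    then show ?thesis unfolding t_def by (simp only: if_False)
  qed
  show ?case
  proof (intro exI[of _ t] ballI impI)
    fix G assume G: "G \<in> K" "card G < Suc n"
    have "(\<Sum>v\<in>G. vsign v (G - {v}) * s (G - {v}) H) = (\<Sum>v\<in>G. vsign v (G - {v}) * t (G - {v}) H)" for H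
    proof (rule sum.cong[OF refl])
      fix v assume "v \<in> G"
      then have "s (G - {v}) = t (G - {v})" using st G by simp
      then show "vsign v (G - {v}) * s (G - {v}) H = vsign v (G - {v}) * t (G - {v}) H" by (simp only:)
    qed
    with t[of G] G show "t G \<in> chains K (Suc (card G)) \<and>
      (\<forall>H. bd (t G) H = point G H - (\<Sum>v\<in>G. vsign v (G - {v}) * t (G - {v}) H))" by simp
  qed
qed auto

lemma acyclic_over_any:
  assumes K: "K \<subseteq> Pow V" "\<And>G H. G \<in> K \<Longrightarrow> H \<subseteq> G \<Longrightarrow> H \<in> K"
    and ac: "acyclic_over TYPE(int) K"
  shows "acyclic_over TYPE('k::comm_ring_1) K"
  unfolding acyclic_over_def
proof (intro allI ballI impI)
  fix p and z :: "'v set \<Rightarrow> 'k" assume z: "z \<in> chains K p" and bz: "\<forall>G. bd z G = 0"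
  \<comment> \<open>Faces lie in \<open>V\<close>, so the bound \<open>Suc (card V)\<close> covers
    all degrees at once.\<close>
  obtain s :: "'v set \<Rightarrow> 'v set \<Rightarrow> int" where s0: "\<forall>G\<in>K. card G < Suc (card V) \<longrightarrow> s G \<in> chains K (Suc (card G)) \<and>
    (\<forall>H. bd (s G) H = point G H - (\<Sum>v\<in>G. vsign v (G - {v}) * s (G - {v}) H))"
    using contracting_homotopy[where n = "Suc (card V)", OF K(1) _ ac] K(2) by blast
  have fin: "finite K" using K finite_V finite_subset by blast
  have s: "s G \<in> chains K (Suc (card G))"
    "bd (s G) H = point G H - (\<Sum>v\<in>G. vsign v (G - {v}) * s (G - {v}) H)" if "G \<in> K" for G H
    using s0 that K card_mono[OF finite_V, of G] by (auto simp: less_Suc_eq_le)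
  \<comment> \<open>The homotopy extended linearly: bd u = z - s (bd z), and the last term vanishes
    for a cycle.\<close>
  define u where "u H = (\<Sum>G\<in>K. z G * of_int (s G H))" for H
  have "u \<in> chains K (Suc p)"
    unfolding u_def
  proof (rule chains_sum)
    fix G assume "G \<in> K"
    then show "(\<lambda>H. z G * of_int (s G H)) \<in> chains K (Suc p)"
      using s(1)[of G] z unfolding chains_def by (cases "z G = 0") (auto, (metis mult_zero_right of_int_0)+)
  qed
  moreover have "bd u H = z H" for H
  proof -
    have "bd u H = (\<Sum>G\<in>K. z G * (point G H - (\<Sum>v\<in>G. vsign v (G - {v}) * of_int (s (G - {v}) H))))"
      unfolding u_def bd_sum bd_mult bd_of_int
      by (intro sum.cong refl arg_cong2[where f = "(*)"]) (simp add: s point_def)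
    also have "\<dots> = (\<Sum>G\<in>K. z G * point G H)
        - (\<Sum>G\<in>K. \<Sum>v\<in>G. z G * (vsign v (G - {v}) * of_int (s (G - {v}) H)))"
      by (simp add: right_diff_distrib sum_subtractf sum_distrib_left)
    \<comment> \<open>Passing from the pair of \<open>G\<close> and \<open>v\<close> to the pair of
      \<open>G - {v}\<close> and \<open>v\<close> groups the sum by the smaller face, where the
      coefficients add up to \<open>bd z\<close>.\<close>
    also have "(\<Sum>G\<in>K. \<Sum>v\<in>G. z G * (vsign v (G - {v}) * of_int (s (G - {v}) H)))
      = (\<Sum>G\<in>K. \<Sum>v\<in>V - G. z (insert v G) * (vsign v G * of_int (s G H)))"
    proof -
      have "(\<Sum>G\<in>K. \<Sum>v\<in>G. z G * (vsign v (G - {v}) * of_int (s (G - {v}) H)))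
        = (\<Sum>(G, v)\<in>(SIGMA G:K. G). z G * (vsign v (G - {v}) * of_int (s (G - {v}) H)))"
        using fin K(1) finite_subset[OF _ finite_V] by (intro sum.Sigma) auto
      also have "\<dots> = (\<Sum>(G, v)\<in>(SIGMA G:K. {v \<in> V - G. insert v G \<in> K}).
          z (insert v G) * (vsign v G * of_int (s G H)))"
        by (rule sum.reindex_bij_witness[of _ "\<lambda>(G, v). (insert v G, v)" "\<lambda>(G, v). (G - {v}, v)"])
          (use K in \<open>auto simp: insert_absorb\<close>)
      also have "\<dots> = (\<Sum>G\<in>K. \<Sum>v\<in>{v \<in> V - G. insert v G \<in> K}. z (insert v G) * (vsign v G * of_int (s G H)))"
        by (rule sum.Sigma[symmetric]) (use fin finite_V in auto)
      also have "\<dots> = (\<Sum>G\<in>K. \<Sum>v\<in>V - G. z (insert v G) * (vsign v G * of_int (s G H)))"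
      proof (rule sum.cong[OF refl])
        fix G
        have "z (insert v G) = 0" if "insert v G \<notin> K" for v using chainsD0[OF z] that by blast
        then show "(\<Sum>v\<in>{v \<in> V - G. insert v G \<in> K}. z (insert v G) * (vsign v G * of_int (s G H)))
            = (\<Sum>v\<in>V - G. z (insert v G) * (vsign v G * of_int (s G H)))"
          by (intro sum.mono_neutral_left) (use finite_V in \<open>auto, metis mult_zero_left\<close>)
      qed
      finally show ?thesis .
    qed
    also have "\<dots> = (\<Sum>G\<in>K. bd z G * of_int (s G H))"
    proof (rule sum.cong[OF refl])
      fix G assume "G \<in> K"
      then have "G \<subseteq> V" using K(1) by blast
      then show "(\<Sum>v\<in>V - G. z (insert v G) * (vsign v G * of_int (s G H))) = bd z G * of_int (s G H)"
        by (simp add: bd_def sum_distrib_right) (simp add: ac_simps)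
    qed
    also have "\<dots> = 0" using bz by simp
    finally have 1: "bd u H = (\<Sum>G\<in>K. z G * point G H)" by simp
    have "(\<Sum>G\<in>K. z G * point G H) = (\<Sum>G\<in>K. if G = H then z H else 0)"
      by (intro sum.cong) (auto simp: point_def)
    also have "\<dots> = z H" using fin chainsD0[OF z] by (auto simp: sum.delta)
    finally show ?thesis using 1 by simp
  qed
  ultimately show "\<exists>u\<in>chains K (Suc p). \<forall>G. bd u G = z G" by blast
qed

end

section \<open>From singular to simplicial homology\<close>

context vertex_order
begin

definition lin_ext :: "('a \<Rightarrow> 'v set \<Rightarrow> int) \<Rightarrow> ('a \<Rightarrow>\<^sub>0 int) \<Rightarrow> 'v set \<Rightarrow> int"
  where "lin_ext \<phi> c G = (\<Sum>f\<in>Poly_Mapping.keys c. Poly_Mapping.lookup c f * \<phi> f G)"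

lemma lin_ext_superset:
  assumes "finite A" "Poly_Mapping.keys c \<subseteq> A"
  shows "lin_ext \<phi> c G = (\<Sum>f\<in>A. Poly_Mapping.lookup c f * \<phi> f G)"
  unfolding lin_ext_def using assms
  by (intro sum.mono_neutral_left) (auto simp: not_in_keys_iff_lookup_eq_zero)

lemma lin_ext_0 [simp]: "lin_ext \<phi> 0 = (\<lambda>G. 0)"
  by (simp add: lin_ext_def[abs_def])

lemma lin_ext_of [simp]: "lin_ext \<phi> (frag_of f) = \<phi> f"
  by (simp add: lin_ext_def[abs_def] keys_frag_of)

lemma lin_ext_diff: "lin_ext \<phi> (a - b) G = lin_ext \<phi> a G - lin_ext \<phi> b G"
proof -
  let ?A = "Poly_Mapping.keys a \<union> Poly_Mapping.keys b"
  have "finite ?A" "Poly_Mapping.keys (a - b) \<subseteq> ?A" using keys_diff[of a b] by auto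
  then show ?thesis
    by (simp add: lin_ext_superset[of ?A] lookup_minus left_diff_distrib sum_subtractf)
qed

lemma lin_ext_cmul: "lin_ext \<phi> (frag_cmul k a) G = k * lin_ext \<phi> a G"
  using keys_cmul[of k a]
  by (simp add: lin_ext_superset[of "Poly_Mapping.keys a"] sum_distrib_left mult.assoc)

lemma lin_ext_add: "lin_ext \<phi> (a + b) G = lin_ext \<phi> a G + lin_ext \<phi> b G"
  using lin_ext_diff[of \<phi> a "- b" G] lin_ext_diff[of \<phi> 0 b G] by simp

lemma lin_ext_sum: "lin_ext \<phi> (\<Sum>i\<in>I. a i) G = (\<Sum>i\<in>I. lin_ext \<phi> (a i) G)"
  by (induction I rule: infinite_finite_induct) (auto simp: lin_ext_add)

lemma lin_ext_supp:
  assumes "lin_ext \<phi> c G \<noteq> 0"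
  obtains f where "f \<in> Poly_Mapping.keys c" "\<phi> f G \<noteq> 0"
proof -
  obtain f where "f \<in> Poly_Mapping.keys c" "Poly_Mapping.lookup c f * \<phi> f G \<noteq> 0"
    using assms unfolding lin_ext_def by (rule sum.not_neutral_contains_not_neutral)
  then show ?thesis using that by auto
qed

text \<open>A point of the realization is approximated by a vertex where its barycentric coordinate is
  at least the average.\<close>

definition near_vertex :: "('v \<Rightarrow> real) \<Rightarrow> 'v"
  where "near_vertex y = (SOME v. v \<in> V \<and> 1 \<le> real (card V) * y v)"

definition simplex_verts :: "nat \<Rightarrow> ((nat \<Rightarrow> real) \<Rightarrow> 'v \<Rightarrow> real) \<Rightarrow> 'v list"
  where "simplex_verts p f = map (\<lambda>i. near_vertex (f (\<lambda>j. if j = i then 1 else 0))) [0..<Suc p]"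

lemma length_simplex_verts [simp]: "length (simplex_verts p f) = Suc p"
  by (simp add: simplex_verts_def)

text \<open>A simplicial approximation on chains: a simplex goes to the list of vertices near its
  corners. On the realization it commutes with the boundary for simplices of any size, but the
  resulting sets are known to be faces only for small ones, by \<open>approx_small\<close>.\<close>

definition approx_chain :: "nat \<Rightarrow> ('v \<Rightarrow> real) chain \<Rightarrow> 'v set \<Rightarrow> int"
  where "approx_chain p = lin_ext (\<lambda>f. list_chain (simplex_verts p f))"

lemma simplex_verts_face:
  assumes "k \<le> Suc p"
  shows "simplex_verts p (singular_face (Suc p) k f)
    = take k (simplex_verts (Suc p) f) @ drop (Suc k) (simplex_verts (Suc p) f)"
proof (rule nth_equalityI)
  fix i assume "i < length (simplex_verts p (singular_face (Suc p) k f))"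
  then have i: "i \<le> p" by (simp add: simplex_verts_def)
  have "simplical_face k (\<lambda>j. if j = i then 1 else 0 :: real)
      = (\<lambda>j. if j = (if i < k then i else Suc i) then 1 else 0)"
    by (auto simp: simplical_face_def fun_eq_iff)
  then have "simplex_verts p (singular_face (Suc p) k f) ! i
      = near_vertex (f (\<lambda>j. if j = (if i < k then i else Suc i) then 1 else 0))"
    using i by (simp add: simplex_verts_def singular_face_def del: upt_Suc)
  then show "simplex_verts p (singular_face (Suc p) k f) ! i
      = (take k (simplex_verts (Suc p) f) @ drop (Suc k) (simplex_verts (Suc p) f)) ! i"
    using i assms by (auto simp: simplex_verts_def nth_append min_def simp del: upt_Suc)
qed (use assms in \<open>simp add: simplex_verts_def\<close>)

lemma iterated_subdivision_boundary:
  assumes "singular_chain p X c"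
  shows "singular_chain p X ((singular_subdivision p ^^ n) c)"
    and "chain_boundary p ((singular_subdivision p ^^ n) c)
      = (singular_subdivision (p - Suc 0) ^^ n) (chain_boundary p c)"
proof (induction n)
  case (Suc n)
  { case 1 then show ?case using Suc by (simp add: singular_chain_singular_subdivision) }
  { case 2 then show ?case using Suc by (simp add: chain_boundary_singular_subdivision) }
qed (use assms in simp_all)

lemma iterated_subdivision_sum:
  "(singular_subdivision p ^^ n) (\<Sum>i\<in>I. c i) = (\<Sum>i\<in>I. (singular_subdivision p ^^ n) (c i))"
proof (induction I rule: infinite_finite_induct)
  case (insert i I)
  have "(singular_subdivision p ^^ n) (a + b) = (singular_subdivision p ^^ n) a + (singular_subdivision p ^^ n) b" for a b :: "'a chain"
    by (induction n) (auto simp: singular_subdivision_add)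
  then show ?case using insert by simp
qed auto

lemma iterated_subdivision_cmul:
  "(singular_subdivision p ^^ n) (frag_cmul k c) = frag_cmul k ((singular_subdivision p ^^ n) c)"
  by (induction n) (auto simp: singular_subdivision_def frag_extend_cmul)

subsection \<open>Realized simplices\<close>

definition real_simplex :: "'v list \<Rightarrow> (nat \<Rightarrow> real) \<Rightarrow> 'v \<Rightarrow> real"
  where "real_simplex l = (\<lambda>x\<in>standard_simplex (length l - 1).
    \<lambda>v. \<Sum>j<length l. (if l ! j = v then 1 else 0) * x j)"

lemma singular_face_real_simplex:
  assumes "length l = Suc (Suc p)" "k \<le> Suc p"
  shows "singular_face (Suc p) k (real_simplex l) = real_simplex (take k l @ drop (Suc k) l)"
proof -
  define l' where "l' = take k l @ drop (Suc k) l"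
  have len: "length l' = Suc p" using assms by (simp add: l'_def)
  have l': "l' ! j = (if j < k then l ! j else l ! Suc j)" if "j < Suc p" for j
    using that assms by (auto simp: l'_def nth_append min_def)
  have sum: "(\<Sum>j<length l. (if l ! j = v then 1 else 0) * simplical_face k x j)
      = (\<Sum>j<length l'. (if l' ! j = v then 1 else 0) * x j)" for x :: "nat \<Rightarrow> real" and v
  proof -
    have "(\<Sum>j<length l. (if l ! j = v then 1 else 0) * simplical_face k x j)
        = (\<Sum>j\<in>{..Suc p}. (if j < k then (if l ! j = v then 1 else 0) * x j else if j = k then 0
             else (if l ! Suc (j - Suc 0) = v then 1 else 0) * x (j - Suc 0)))"
      by (rule sum.cong) (auto simp: assms simplical_face_def lessThan_Suc_atMost)
    also have "\<dots> = (\<Sum>j\<le>Suc p - Suc 0. if j < k then (if l ! j = v then 1 else 0) * x j else (if l ! Suc j = v then 1 else 0) * x j)"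
      by (rule sum.zero_middle) (use assms in auto)
    also have "\<dots> = (\<Sum>j<length l'. (if l' ! j = v then 1 else 0) * x j)"
      unfolding len by (rule sum.cong) (auto simp: l')
    finally show ?thesis .
  qed
  have "singular_face (Suc p) k (real_simplex l) x = real_simplex l' x" for x
  proof (cases "x \<in> standard_simplex p")
    case True
    then have "simplical_face k x \<in> standard_simplex (Suc p)"
      using simplical_face_in_standard_simplex[of "Suc p" k x] assms by simp
    then show ?thesis using True sum by (simp add: singular_face_def real_simplex_def len assms(1))
  qed (simp add: singular_face_def real_simplex_def len)
  then show ?thesis unfolding l'_def by (rule ext)
qed

lemma real_simplex_point:
  assumes x: "x \<in> standard_simplex (length l - 1)" and l: "l \<noteq> []" "set l \<subseteq> W" "finite W"
  shows "\<forall>v. 0 \<le> real_simplex l x v" "{v. real_simplex l x v \<noteq> 0} \<subseteq> set l"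
    "(\<Sum>v\<in>W. real_simplex l x v) = 1"
proof -
  have e: "real_simplex l x v = (\<Sum>j<length l. (if l ! j = v then 1 else 0) * x j)" for v
    using x by (simp add: real_simplex_def)
  show "\<forall>v. 0 \<le> real_simplex l x v"
    unfolding e using x by (auto intro!: sum_nonneg simp: standard_simplex_def)
  show "{v. real_simplex l x v \<noteq> 0} \<subseteq> set l"
  proof
    fix v assume "v \<in> {v. real_simplex l x v \<noteq> 0}"
    then have "(\<Sum>j<length l. (if l ! j = v then 1 else 0) * x j) \<noteq> 0" by (simp add: e)
    then obtain j where "j \<in> {..<length l}" "(if l ! j = v then 1 else 0) * x j \<noteq> 0"
      by (rule sum.not_neutral_contains_not_neutral)
    then show "v \<in> set l" by (auto split: if_splits)
  qed
  have W: "l ! j \<in> W" if "j < length l" for j using nth_mem[OF that] l(2) by blast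
  have "(\<Sum>v\<in>W. real_simplex l x v) = (\<Sum>j<length l. \<Sum>v\<in>W. (if l ! j = v then 1 else 0) * x j)"
    unfolding e by (rule sum.swap)
  also have "\<dots> = (\<Sum>j<length l. x j)"
    using l W by (intro sum.cong refl) (simp add: if_distrib[of "\<lambda>u. u * _"] cong: if_cong)
  also have "{..<length l} = {..length l - 1}" using l(1) by (cases l) auto
  finally show "(\<Sum>v\<in>W. real_simplex l x v) = 1" using x by (simp add: standard_simplex_def)
qed

definition vlist :: "'v set \<Rightarrow> 'v list"
  where "vlist G = (SOME l. set l = G \<and> sorted_wrt (\<lambda>u v. e u < e v) l)"

lemma sorted_list_unique:
  assumes "sorted_wrt (\<lambda>u v. e u < e v) l" "sorted_wrt (\<lambda>u v. e u < e v) l'" "set l = set l'" "set l \<subseteq> V"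
  shows "l = l'"
proof -
  have "map e l = map e l'"
    using assms by (intro strict_sorted_equal) (auto simp: sorted_wrt_map)
  moreover have "inj_on e (set l \<union> set l')" using assms inj_on_subset[OF inj_e] by simp
  ultimately show ?thesis by (simp only: inj_on_map_eq_map)
qed

lemma vlist:
  assumes "G \<subseteq> V"
  shows "set (vlist G) = G" "sorted_wrt (\<lambda>u v. e u < e v) (vlist G)" "distinct (vlist G)" "length (vlist G) = card G"
proof -
  have fin: "finite G" and inj: "inj_on e G" using assms finite_V finite_subset inj_e inj_on_subset by blast+
  have "\<exists>l. set l = G \<and> sorted_wrt (\<lambda>u v. e u < e v) l"
  proof (intro exI conjI)
    let ?l = "map (inv_into G e) (sorted_list_of_set (e ` G))"
    show "set ?l = G" using fin inj by (simp add: image_image)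
    have "sorted_wrt (<) (sorted_list_of_set (e ` G))" by simp
    then show "sorted_wrt (\<lambda>u v. e u < e v) ?l"
      unfolding sorted_wrt_map using fin inj
      by (elim sorted_wrt_mono_rel[rotated]) (simp add: f_inv_into_f)
  qed
  then have *: "set (vlist G) = G \<and> sorted_wrt (\<lambda>u v. e u < e v) (vlist G)"
    unfolding vlist_def by (rule someI_ex)
  then show "set (vlist G) = G" "sorted_wrt (\<lambda>u v. e u < e v) (vlist G)" by auto
  then have "sorted_wrt (<) (map e (vlist G))" by (simp add: sorted_wrt_map)
  then have "distinct (map e (vlist G))" by (simp add: strict_sorted_iff)
  then show "distinct (vlist G)" by (simp add: distinct_map)
  then show "length (vlist G) = card G" using * distinct_card by metis
qed

lemma vlist_set:
  assumes "sorted_wrt (\<lambda>u v. e u < e v) l" "set l \<subseteq> V"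
  shows "vlist (set l) = l"
  using sorted_list_unique[of "vlist (set l)" l] vlist[OF assms(2)] assms by auto

lemma sorted_remove:
  assumes "sorted_wrt (\<lambda>u v. e u < e v) l"
  shows "sorted_wrt (\<lambda>u v. e u < e v) (take k l @ drop (Suc k) l)"
proof (cases "k < length l")
  case True
  have "sorted_wrt (\<lambda>u v. e u < e v) (take k l @ l ! k # drop (Suc k) l)"
    using assms True by (simp add: id_take_nth_drop[symmetric])
  then show ?thesis by (simp add: sorted_wrt_append)
qed (use assms in simp)

text \<open>In increasing order each new vertex precedes those already present, so every cone has
  sign 1. This matches the orientation of singular simplices with that of
  \<open>point\<close>.\<close>

lemma list_chain_sorted:
  assumes "sorted_wrt (\<lambda>u v. e u < e v) l" "set l \<subseteq> V"
  shows "list_chain l = (point (set l) :: 'v set \<Rightarrow> int)"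
  using assms
proof (induction l)
  case (Cons v l)
  have less: "e v < e u" if "u \<in> set l" for u using that Cons.prems by auto
  then have v: "v \<notin> set l" by auto
  have "{u \<in> set l. e u < e v} = {}" using less by force
  then have s: "vsign v (set l) = (1::int)" unfolding vsign_def by (simp only: card.empty power_0)
  have "G - {v} = set l \<longleftrightarrow> G = insert v (set l)" if "v \<in> G" for G using that v by auto
  then show ?case using Cons s by (auto simp: cone_def point_def fun_eq_iff)
qed (auto simp: point_def)

definition real_chain :: "('v set \<Rightarrow> int) \<Rightarrow> ('v \<Rightarrow> real) chain"
  where "real_chain z = (\<Sum>G\<in>Pow V. frag_cmul (z G) (frag_of (real_simplex (vlist G))))"

lemma lookup_real_chain:
  "Poly_Mapping.lookup (real_chain z) x
    = (\<Sum>G\<in>Pow V. z G * Poly_Mapping.lookup (frag_of (real_simplex (vlist G))) x)"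
  by (simp add: real_chain_def lookup_sum)

text \<open>The statement starts at two vertices because the singular complex is not augmented,
  while \<open>bd\<close> of a vertex is the empty simplex.\<close>

lemma chain_boundary_real_simplex:
  assumes "G \<subseteq> V" "card G = Suc (Suc p)"
  shows "chain_boundary (Suc p) (frag_of (real_simplex (vlist G))) = real_chain (bd (point G))"
proof (rule poly_mapping_eqI)
  fix x
  define g where "g H = Poly_Mapping.lookup (frag_of (real_simplex (vlist H))) x" for H
  let ?l = "vlist G"
  let ?r = "\<lambda>k. take k ?l @ drop (Suc k) ?l"
  have len: "length ?l = Suc (Suc p)" using vlist[OF assms(1)] assms by simp
  have r: "sorted_wrt (\<lambda>u v. e u < e v) (?r k)" "set (?r k) \<subseteq> V" for k
    using sorted_remove vlist[OF assms(1)] set_take_subset[of k ?l] set_drop_subset[of "Suc k" ?l] assms(1)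
    by auto
  have bdG: "bd (point G) H = (\<Sum>k<length ?l. (- 1) ^ k * point (set (?r k)) H :: int)" for H
  proof -
    have "bd (point G) H = (bd (list_chain ?l) H :: int)"
      using list_chain_sorted[of ?l] vlist[OF assms(1)] assms(1) by simp
    also have "\<dots> = (\<Sum>k<length ?l. (- 1) ^ k * list_chain (?r k) H)"
      by (rule list_chain_sum) (use vlist(1)[OF assms(1)] assms(1) in simp)
    finally show ?thesis by (simp only: list_chain_sorted[OF r])
  qed
  have finp: "finite (Pow V)" using finite_V by simp
  have "Poly_Mapping.lookup (chain_boundary (Suc p) (frag_of (real_simplex ?l))) x
      = (\<Sum>k\<le>Suc p. (- 1) ^ k * Poly_Mapping.lookup (frag_of (singular_face (Suc p) k (real_simplex ?l))) x)"
    by (simp add: chain_boundary_of lookup_sum lookup_add del: sum.atMost_Suc)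
  also have "\<dots> = (\<Sum>k\<le>Suc p. (- 1) ^ k * g (set (?r k)))"
    by (intro sum.cong refl) (simp add: singular_face_real_simplex[OF len] g_def vlist_set[OF r] del: set_append)
  also have "\<dots> = (\<Sum>k<length ?l. \<Sum>H\<in>Pow V. (- 1) ^ k * point (set (?r k)) H * g H)"
  proof (rule sum.cong)
    fix k
    have "(\<Sum>H\<in>Pow V. (- 1) ^ k * point (set (?r k)) H * g H)
      = (\<Sum>H\<in>Pow V. if H = set (?r k) then (- 1) ^ k * g (set (?r k)) else 0)"
      by (intro sum.cong refl) (simp add: point_def)
    also have "\<dots> = (- 1) ^ k * g (set (?r k))" using r(2)[of k] finp by (simp add: sum.delta del: set_append)
    finally show "(- 1) ^ k * g (set (?r k)) = (\<Sum>H\<in>Pow V. (- 1) ^ k * point (set (?r k)) H * g H)" by simp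
  qed (use len in auto)
  also have "\<dots> = (\<Sum>H\<in>Pow V. bd (point G) H * g H)"
    unfolding bdG sum_distrib_right by (rule sum.swap)
  finally show "Poly_Mapping.lookup (chain_boundary (Suc p) (frag_of (real_simplex ?l))) x
      = Poly_Mapping.lookup (real_chain (bd (point G))) x"
    by (simp add: lookup_real_chain g_def)
qed

lemma chain_boundary_real_chain:
  assumes "z \<in> chains (Pow V) (Suc (Suc p))"
  shows "chain_boundary (Suc p) (real_chain z) = real_chain (bd z)"
proof (rule poly_mapping_eqI)
  fix x
  have z: "z H = (\<Sum>G\<in>Pow V. z G * point G H)" for H
  proof -
    have "(\<Sum>G\<in>Pow V. z G * point G H) = (\<Sum>G\<in>Pow V. if G = H then z H else 0)"
      by (intro sum.cong) (auto simp: point_def)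
    then show ?thesis using finite_V chainsD0[OF assms, of H] by (simp add: sum.delta)
  qed
  have bz: "bd z H = (\<Sum>G\<in>Pow V. z G * bd (point G) H)" for H
    by (subst z[abs_def]) (simp add: bd_sum bd_mult)
  have "chain_boundary (Suc p) (real_chain z)
      = (\<Sum>G\<in>Pow V. frag_cmul (z G) (chain_boundary (Suc p) (frag_of (real_simplex (vlist G)))))"
    by (simp add: real_chain_def chain_boundary_sum o_def chain_boundary_cmul)
  also have "\<dots> = (\<Sum>G\<in>Pow V. frag_cmul (z G) (real_chain (bd (point G))))"
  proof (rule sum.cong[OF refl])
    fix G assume G: "G \<in> Pow V"
    show "frag_cmul (z G) (chain_boundary (Suc p) (frag_of (real_simplex (vlist G))))
        = frag_cmul (z G) (real_chain (bd (point G)))"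
    proof (cases "z G = 0")
      case False
      then show ?thesis using chainsD[OF assms False] G chain_boundary_real_simplex[of G p] by simp
    qed simp
  qed
  finally show "Poly_Mapping.lookup (chain_boundary (Suc p) (real_chain z)) x
      = Poly_Mapping.lookup (real_chain (bd z)) x"
    by (simp add: lookup_sum lookup_real_chain bz sum_distrib_left sum_distrib_right mult.assoc)
      (rule sum.swap)
qed

subsection \<open>Simplicial complexes with null-homotopic realization\<close>

lemma near_vertex:
  assumes "\<And>v. 0 \<le> y v" "(\<Sum>v\<in>V. y v) = 1"
  shows "near_vertex y \<in> V" "1 \<le> real (card V) * y (near_vertex y)" "y (near_vertex y) \<noteq> 0"
proof -
  have ne: "V \<noteq> {}" using assms by auto
  have "\<exists>v. v \<in> V \<and> 1 \<le> real (card V) * y v"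
  proof (rule ccontr)
    assume "\<not> ?thesis"
    then have "real (card V) * y v < 1" if "v \<in> V" for v using that by force
    with ne finite_V have "(\<Sum>v\<in>V. real (card V) * y v) < (\<Sum>v\<in>V. 1)"
      by (intro sum_strict_mono)
    also have "(\<Sum>v\<in>V. real (card V) * y v) = real (card V) * (\<Sum>v\<in>V. y v)"
      by (rule sum_distrib_left[symmetric])
    finally show False using assms(2) by simp
  qed
  then have *: "near_vertex y \<in> V \<and> 1 \<le> real (card V) * y (near_vertex y)"
    unfolding near_vertex_def by (rule someI_ex)
  then show "near_vertex y \<in> V" "1 \<le> real (card V) * y (near_vertex y)" by auto
  then show "y (near_vertex y) \<noteq> 0" by auto
qed

context
  fixes K :: "'v set set"
  assumes K: "\<And>G H. G \<in> K \<Longrightarrow> H \<subseteq> G \<Longrightarrow> H \<in> K" and KV: "\<Union>K \<subseteq> V"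
begin

lemma topspace_realization:
  "topspace (realization K) = {t. (\<forall>v. 0 \<le> t v) \<and> {v. t v \<noteq> 0} \<in> K \<and> (\<Sum>v\<in>\<Union>K. t v) = 1}"
  by (simp add: realization_def)

lemma realization_pointD:
  assumes "y \<in> topspace (realization K)"
  shows "0 \<le> y v" "{v. y v \<noteq> 0} \<in> K" "(\<Sum>v\<in>V. y v) = 1"
    "near_vertex y \<in> V" "1 \<le> real (card V) * y (near_vertex y)" "y (near_vertex y) \<noteq> 0"
proof -
  show 1: "0 \<le> y v" "{v. y v \<noteq> 0} \<in> K" for v using assms by (auto simp: topspace_realization)
  have "(\<Sum>v\<in>V. y v) = (\<Sum>v\<in>\<Union>K. y v)"
    using 1(2) KV finite_V by (intro sum.mono_neutral_right) auto
  also have "\<dots> = 1" using assms by (simp add: topspace_realization)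
  finally show 2: "(\<Sum>v\<in>V. y v) = 1" .
  show "near_vertex y \<in> V" "1 \<le> real (card V) * y (near_vertex y)" "y (near_vertex y) \<noteq> 0"
    using near_vertex[OF 1(1) 2] by auto
qed

lemma simplex_vert_point:
  assumes "singular_simplex p X f" "u \<in> set (simplex_verts p f)"
  obtains y where "y \<in> f ` standard_simplex p" "y \<in> topspace X" "u = near_vertex y"
proof -
  obtain i where i: "i \<le> p" "u = near_vertex (f (\<lambda>j. if j = i then 1 else 0))"
  proof -
    have "u \<in> (\<lambda>i. near_vertex (f (\<lambda>j. if j = i then 1 else 0))) ` {0..<Suc p}"
      using assms(2) unfolding simplex_verts_def by (simp only: set_map set_upt)
    then obtain i where "i \<in> {0..<Suc p}" "u = near_vertex (f (\<lambda>j. if j = i then 1 else 0))" by (rule imageE)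
    then show ?thesis using that[of i] by simp
  qed
  then have "f (\<lambda>j. if j = i then 1 else 0) \<in> f ` standard_simplex p" by simp
  moreover have "f ` standard_simplex p \<subseteq> topspace X"
    using assms(1) by (auto simp: singular_simplex_def continuous_map_def Pi_iff)
  ultimately show ?thesis using that i(2) by blast
qed

lemma approx_chain_supp:
  assumes "approx_chain p c G \<noteq> 0"
  obtains f where "f \<in> Poly_Mapping.keys c" "G = set (simplex_verts p f)" "card G = Suc p"
proof -
  obtain f where f: "f \<in> Poly_Mapping.keys c" "list_chain (simplex_verts p f) G \<noteq> (0::int)"
    using assms unfolding approx_chain_def by (rule lin_ext_supp)
  have "G = set (simplex_verts p f) \<and> card G = length (simplex_verts p f)"
    by (rule list_chain_supp[OF f(2)])
  then show ?thesis using that f(1) length_simplex_verts by metis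
qed

lemma approx_chain_boundary:
  assumes "singular_chain (Suc p) (realization K) c"
  shows "bd (approx_chain (Suc p) c) G = approx_chain p (chain_boundary (Suc p) c) G"
  using assms unfolding singular_chain_def
proof (induction c rule: frag_induction)
  case zero
  then show ?case by (simp add: approx_chain_def)
next
  case (one f)
  then have f: "set (simplex_verts (Suc p) f) \<subseteq> V"
    using simplex_vert_point[of "Suc p" "realization K" f] realization_pointD(4) by blast
  have "bd (approx_chain (Suc p) (frag_of f)) G = bd (list_chain (simplex_verts (Suc p) f)) G"
    by (simp add: approx_chain_def)
  also have "\<dots> = (\<Sum>k\<le>Suc p. (- 1) ^ k * list_chain (simplex_verts p (singular_face (Suc p) k f)) G)"
    unfolding list_chain_sum[OF f]
    by (rule sum.cong) (simp_all add: lessThan_Suc_atMost simplex_verts_face)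
  also have "\<dots> = approx_chain p (chain_boundary (Suc p) (frag_of f)) G"
    by (simp add: chain_boundary_of approx_chain_def lin_ext_sum lin_ext_add lin_ext_cmul del: sum.atMost_Suc)
  finally show ?case .
next
  case (diff a b)
  then show ?case
    by (simp add: approx_chain_def lin_ext_diff[abs_def] bd_diff chain_boundary_diff)
qed

text \<open>The target is the closed face: knowing that all points are supported in \<open>l\<close>
  is what confines the approximating vertices after subdivision.\<close>

lemma singular_simplex_real_simplex:
  assumes "l \<noteq> []" "set l \<in> K"
  shows "singular_simplex (length l - 1) (subtopology (realization K) {y. {v. y v \<noteq> 0} \<subseteq> set l}) (real_simplex l)"
proof -
  have fin: "finite (\<Union>K)" by (rule finite_subset[OF KV finite_V])
  have "continuous_map (subtopology (powertop_real UNIV) (standard_simplex (length l - 1))) (powertop_real UNIV)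
      (\<lambda>x v. \<Sum>j<length l. (if l ! j = v then 1 else 0) * x j)"
    unfolding continuous_map_componentwise_UNIV
    by (intro allI continuous_map_sum continuous_map_real_mult_left
        continuous_map_from_subtopology continuous_map_product_projection) auto
  then have cont: "continuous_map (subtopology (powertop_real UNIV) (standard_simplex (length l - 1))) (powertop_real UNIV)
      (real_simplex l)"
    by (rule continuous_map_eq) (simp add: real_simplex_def)
  have "real_simplex l x \<in> {t. (\<forall>v. 0 \<le> t v) \<and> {v. t v \<noteq> 0} \<in> K \<and> (\<Sum>v\<in>\<Union>K. t v) = 1} \<inter> {y. {v. y v \<noteq> 0} \<subseteq> set l}"
    if "x \<in> standard_simplex (length l - 1)" for x
    using real_simplex_point[OF that assms(1) _ fin] K[OF assms(2)] assms(2) by auto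
  then show ?thesis
    using cont by (auto simp: singular_simplex_def realization_def subtopology_subtopology
        continuous_map_in_subtopology real_simplex_def)
qed

text \<open>Sperner's lemma in homological form.\<close>

lemma approx_subdivided_simplex:
  assumes "G \<in> K" "card G = Suc p"
  shows "approx_chain p ((singular_subdivision p ^^ n) (frag_of (real_simplex (vlist G)))) H = point G H"
  using assms
proof (induction p arbitrary: G H)
  case (0 G)
  then obtain v where v: "G = {v}" by (auto simp: card_1_singleton_iff)
  have GV: "G \<subseteq> V" using 0 KV by blast
  have l: "vlist G = [v]" using vlist[OF GV] v by (cases "vlist G") (auto simp: insert_absorb)
  have ss: "singular_simplex 0 (subtopology (realization K) {y. {v. y v \<noteq> 0} \<subseteq> G}) (real_simplex (vlist G))"
    using singular_simplex_real_simplex[of "[v]"] l 0 v by simp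
  have "set (simplex_verts 0 (real_simplex (vlist G))) \<subseteq> {v}"
  proof
    fix u assume "u \<in> set (simplex_verts 0 (real_simplex (vlist G)))"
    with ss obtain y where "y \<in> topspace (subtopology (realization K) {y. {v. y v \<noteq> 0} \<subseteq> G})" "u = near_vertex y"
      by (rule simplex_vert_point)
    then show "u \<in> {v}" using realization_pointD(6)[of y] v by auto
  qed
  then have "simplex_verts 0 (real_simplex (vlist G)) = [v]" by (simp add: simplex_verts_def)
  moreover have "(singular_subdivision 0 ^^ n) (frag_of (real_simplex (vlist G))) = frag_of (real_simplex (vlist G))"
    using ss by (induction n) (auto intro!: singular_subdivision_zero simp: singular_chain_of)
  moreover have "list_chain [v] = (point {v} :: 'v set \<Rightarrow> int)" using list_chain_sorted[of "[v]"] GV v by simp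
  ultimately show ?case using v by (simp add: approx_chain_def del: list_chain.simps)
next
  case (Suc p G)
  have GV: "G \<subseteq> V" using Suc.prems KV by blast
  let ?f = "frag_of (real_simplex (vlist G))"
  let ?c = "(singular_subdivision (Suc p) ^^ n) ?f"
  let ?X = "subtopology (realization K) {y. {v. y v \<noteq> 0} \<subseteq> G}"
  have len: "length (vlist G) = Suc (Suc p)" "set (vlist G) = G" using vlist[OF GV] Suc.prems by auto
  then have "vlist G \<noteq> []" by auto
  from singular_simplex_real_simplex[OF this] have "singular_chain (Suc p) ?X ?f"
    using len Suc.prems by (simp add: singular_chain_of)
  note c = iterated_subdivision_boundary[OF this, of n]
  \<comment> \<open>The subdivided simplices stay in the closed face, so their approximating
    vertices lie in \<open>G\<close>, and a set of full size is then \<open>G\<close>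
    itself.\<close>
  have supp: "F = G" if F: "approx_chain (Suc p) ?c F \<noteq> 0" for F
  proof -
    obtain f where f: "f \<in> Poly_Mapping.keys ?c" "F = set (simplex_verts (Suc p) f)" "card F = Suc (Suc p)"
      using F by (rule approx_chain_supp)
    have ss: "singular_simplex (Suc p) ?X f" using f(1) c(1) by (auto simp: singular_chain_def)
    have "F \<subseteq> G"
    proof
      fix u assume "u \<in> F"
      then obtain y where "y \<in> topspace ?X" "u = near_vertex y"
        using simplex_vert_point[OF ss] f(2) by blast
      then show "u \<in> G" using realization_pointD(6)[of y] by auto
    qed
    then show ?thesis using f(3) Suc.prems card_subset_eq[of G F] GV finite_V finite_subset by metis
  qed
  obtain v where v: "v \<in> G" using Suc.prems by fastforce
  \<comment> \<open>By induction both chains have the same boundary, so their difference is a cycle.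
    Being a multiple of the single simplex \<open>G\<close>, it must vanish.\<close>
  define D where "D F = approx_chain (Suc p) ?c F - point G F" for F
  have "bd D F = 0" for F
  proof -
    have "chain_boundary (Suc p) ?f = real_chain (bd (point G))"
      using chain_boundary_real_simplex[OF GV Suc.prems(2)] .
    then have "bd (approx_chain (Suc p) ?c) F = approx_chain p ((singular_subdivision p ^^ n) (real_chain (bd (point G)))) F"
      using approx_chain_boundary[of p ?c F] c singular_chain_subtopology by auto
    also have "\<dots> = (\<Sum>H\<in>Pow V. bd (point G) H * approx_chain p ((singular_subdivision p ^^ n) (frag_of (real_simplex (vlist H)))) F)"
      by (simp add: real_chain_def iterated_subdivision_sum iterated_subdivision_cmul approx_chain_def lin_ext_sum lin_ext_cmul)
    also have "\<dots> = (\<Sum>H\<in>Pow V. bd (point G) H * point H F)"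
    proof (rule sum.cong[OF refl])
      fix H
      show "bd (point G) H * approx_chain p ((singular_subdivision p ^^ n) (frag_of (real_simplex (vlist H)))) F
        = bd (point G) H * point H F"
      proof (cases "bd (point G) H = (0::int)")
        case False
        have "point G \<in> chains K (Suc (Suc p))" using Suc.prems by (auto simp: chains_def point_def)
        then have "bd (point G :: 'v set \<Rightarrow> int) \<in> chains K (Suc p)" by (rule bd_chains) (rule K)
        then have "H \<in> K" "card H = Suc p" using chainsD False by blast+
        then show ?thesis using Suc.IH by simp
      qed simp
    qed
    also have "\<dots> = (\<Sum>H\<in>Pow V. if H = F then bd (point G) F else 0)"
      by (intro sum.cong) (auto simp: point_def)
    also have "\<dots> = bd (point G) F"
      using finite_V by (auto simp: sum.delta bd_def)
    finally show ?thesis by (simp add: D_def[abs_def] bd_diff)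
  qed
  moreover have "bd D (G - {v}) = vsign v (G - {v}) * D G"
  proof -
    have D0: "D F = 0" if "F \<noteq> G" for F using that supp[of F] by (auto simp: D_def point_def)
    have "bd D (G - {v}) = (\<Sum>u\<in>V - (G - {v}). if u = v then vsign v (G - {v}) * D G else 0)"
    proof -
      have "vsign u (G - {v}) * D (insert u (G - {v})) = (if u = v then vsign v (G - {v}) * D G else 0)"
        if "u \<in> V - (G - {v})" for u
      proof (cases "u = v")
        case True
        then have "insert u (G - {v}) = G" using v by auto
        then show ?thesis using True by simp
      next
        case False
        then have "insert u (G - {v}) \<noteq> G" using v that by auto
        then show ?thesis using False D0 by simp
      qed
      then show ?thesis using GV by (simp add: bd_def Diff_subset[THEN subset_trans])
    qed
    also have "\<dots> = vsign v (G - {v}) * D G" using finite_V v GV by (subst sum.delta) auto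
    finally show ?thesis .
  qed
  ultimately have "vsign v (G - {v}) * D G = 0" by metis
  then have "vsign v (G - {v}) * (vsign v (G - {v}) * D G) = 0" by (simp only: mult_zero_right)
  then have "D G = 0" by (simp only: vsign_square')
  then show ?case using supp[of H] by (cases "H = G") (auto simp: D_def point_def)
qed

text \<open>An approximating vertex has coordinate at least 1 / card V at some point of the simplex,
  and that point differs from \<open>y\<close> by less than this in every coordinate. All
  approximating vertices thus lie in the support of the single point \<open>y\<close>, which is a
  face.\<close>

lemma approx_small:
  assumes f: "singular_simplex p (realization K) f"
    and y: "y \<in> topspace (realization K)"
    and small: "f \<in> standard_simplex p \<rightarrow> {t. \<forall>v\<in>V. \<bar>t v - y v\<bar> * real (card V) < 1}"
  shows "set (simplex_verts p f) \<in> K"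
proof -
  have "set (simplex_verts p f) \<subseteq> {v. y v \<noteq> 0}"
  proof
    fix u assume "u \<in> set (simplex_verts p f)"
    with f obtain t where t: "t \<in> f ` standard_simplex p" "t \<in> topspace (realization K)" "u = near_vertex t"
      by (rule simplex_vert_point)
    have u: "u \<in> V" "1 \<le> real (card V) * t u" using realization_pointD[OF t(2)] t(3) by auto
    moreover have "\<bar>t u - y u\<bar> * real (card V) < 1" using small t(1) u(1) by auto
    moreover have "t u * real (card V) \<le> \<bar>t u\<bar> * real (card V)" by (intro mult_right_mono) auto
    ultimately show "u \<in> {v. y v \<noteq> 0}" by (auto simp: mult.commute)
  qed
  then show ?thesis using K realization_pointD(2)[OF y] by blast
qed

text \<open>A simplicial cycle \<open>z\<close>, realized as a singular cycle, is homologous to its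
  image under the constant map. Subdividing the singular chain between the two until its simplices
  are small, and then approximating it, gives a simplicial chain whose boundary is \<open>z\<close>
  minus a cycle supported on one vertex.\<close>

lemma acyclic_if_nullhomotopic:
  assumes hom: "homotopic_with (\<lambda>_. True) (realization K) (realization K) id (\<lambda>_. a)"
    and a: "a \<in> topspace (realization K)"
  shows "acyclic_over TYPE(int) K"
  unfolding acyclic_over_def
proof (intro allI ballI impI)
  let ?X = "realization K"
  let ?w = "near_vertex a"
  have w: "?w \<in> V" using realization_pointD(4)[OF a] .
  have wK: "H \<in> K" if "H \<subseteq> {?w}" for H
    using realization_pointD(2,6)[OF a] K[of "{v. a v \<noteq> 0}" H] that by auto
  \<comment> \<open>Cycles supported on one vertex bound by the cone from it. The cone is nonzero
    only in degree 0, where it is a multiple of the vertex.\<close>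
  have cone_w: "\<exists>u\<in>chains K (Suc p). \<forall>G. bd u G = c G"
    if c: "\<And>G. c G \<noteq> 0 \<Longrightarrow> G \<subseteq> {?w} \<and> card G = p" and bc: "\<And>G. bd c G = (0::int)" for c p
  proof (intro bexI[of _ "cone ?w c"] allI)
    have "bd c = (\<lambda>G. 0)" using bc by (rule ext)
    moreover have "cone ?w (\<lambda>G. 0) = (\<lambda>G. 0 :: int)" by (auto simp: cone_def)
    moreover have "bd (cone ?w c) G = c G - cone ?w (bd c) G" for G
      by (rule bd_cone) (use w c in auto)
    ultimately show "bd (cone ?w c) G = c G" for G by simp
    show "cone ?w c \<in> chains K (Suc p)"
    proof (rule chainsI)
      fix G assume "cone ?w c G \<noteq> 0"
      then have G: "?w \<in> G" "c (G - {?w}) \<noteq> 0" by (auto simp: cone_def split: if_splits)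
      then have "G = {?w}" using c[OF G(2)] by blast
      moreover from this have "p = 0" using c[OF G(2)] by simp
      ultimately show "G \<in> K \<and> card G = Suc p" using wK by simp
    qed
  qed
  fix p and z :: "'v set \<Rightarrow> int" assume z: "z \<in> chains K p" and bz: "\<forall>G. bd z G = 0"
  show "\<exists>u\<in>chains K (Suc p). \<forall>G. bd u G = z G"
  proof (cases p)
    case 0
    \<comment> \<open>Degree 0 has no singular counterpart; the cone alone settles it.\<close>
    have "G = {}" if "z G \<noteq> 0" for G
    proof -
      have "G \<in> K" "card G = 0" using chainsD[OF z that] 0 by auto
      moreover then have "finite G" using KV finite_V by (meson Union_upper finite_subset)
      ultimately show ?thesis by simp
    qed
    then show ?thesis using cone_w[of z p] bz 0 by force
  next
    case (Suc q)
    let ?c = "real_chain z"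
    have zV: "z \<in> chains (Pow V) p" using z KV by (auto simp: chains_def)
    have cX: "singular_chain q ?X ?c"
      unfolding real_chain_def
    proof (rule singular_chain_sum)
      fix G assume G: "G \<in> Pow V"
      show "singular_chain q ?X (frag_cmul (z G) (frag_of (real_simplex (vlist G))))"
      proof (cases "z G = 0")
        case False
        have "G \<in> K" "card G = Suc q" using chainsD[OF z False] Suc by auto
        moreover then have "vlist G \<noteq> []" "set (vlist G) = G" "length (vlist G) = Suc q" using vlist[of G] G by auto
        ultimately have "singular_simplex q ?X (real_simplex (vlist G))"
          using singular_simplex_real_simplex[of "vlist G"] by (simp add: singular_simplex_subtopology)
        then show ?thesis by (simp add: singular_chain_cmul singular_chain_of)
      qed simp
    qed
    have "chain_boundary q ?c = 0"
    proof (cases q)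
      case 0
      then show ?thesis by (simp add: chain_boundary_def)
    next
      case (Suc r)
      have "bd z = (\<lambda>G. 0)" using bz by auto
      then show ?thesis
        using chain_boundary_real_chain[of z r] zV Suc \<open>p = Suc q\<close> by (simp add: real_chain_def)
    qed
    then have "singular_relcycle q ?X {} ?c" using cX by (simp add: singular_cycle)
    from homotopic_imp_homologous_rel_chain_maps[OF _ this, of "{}" ?X id "\<lambda>_. a"]
    have "homologous_rel q ?X {} (chain_map q id ?c) (chain_map q (\<lambda>_. a) ?c)" using hom by simp
    moreover have "chain_map q id ?c = ?c" using chain_map_id_gen[OF cX, of id] by simp
    ultimately obtain b where b: "singular_chain (Suc q) ?X b"
      "chain_boundary (Suc q) b = ?c - chain_map q (\<lambda>_. a) ?c"
      by (auto simp: homologous_rel_def singular_boundary)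
    let ?a = "chain_map q (\<lambda>_. a) ?c"
    have aX: "singular_chain q (subtopology ?X {a}) ?a"
      using cX by (rule singular_chain_chain_map) (use a in \<open>simp add: continuous_map_in_subtopology\<close>)
    \<comment> \<open>Open neighbourhoods of the size required by \<open>approx_small\<close>. Some
      iterated subdivision of \<open>b\<close> has each of its simplices inside one of them.\<close>
    define C where "C = (\<lambda>y. topspace ?X \<inter> {t. \<forall>v\<in>V. \<bar>t v - y v\<bar> * real (card V) < 1}) ` topspace ?X"
    have openC: "openin ?X U" if "U \<in> C" for U
    proof -
      obtain y where y: "U = topspace ?X \<inter> {t. \<forall>v\<in>V. \<bar>t v - y v\<bar> * real (card V) < 1}"
        using \<open>U \<in> C\<close> by (auto simp: C_def)
      have "openin ?X {t \<in> topspace ?X. \<bar>t v - y v\<bar> * real (card V) \<in> {..<1}}" for v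
      proof (rule openin_continuous_map_preimage)
        show "continuous_map ?X euclideanreal (\<lambda>t. \<bar>t v - y v\<bar> * real (card V))"
          unfolding realization_def
          by (intro continuous_intros continuous_map_from_subtopology continuous_map_product_projection) auto
      qed auto
      moreover have "U = topspace ?X \<inter> (\<Inter>v\<in>V. {t \<in> topspace ?X. \<bar>t v - y v\<bar> * real (card V) \<in> {..<1}})"
        using y by auto
      ultimately show ?thesis using finite_V
        by (cases "V = {}") (auto intro!: openin_Int openin_Inter)
    qed
    have "topspace ?X \<subseteq> \<Union>C" by (auto simp: C_def)
    from sufficient_iterated_singular_subdivision_exists[OF openC this b(1)]
    obtain n where n: "\<And>f. f \<in> Poly_Mapping.keys ((singular_subdivision (Suc q) ^^ n) b) \<Longrightarrow>
        \<exists>U\<in>C. f \<in> standard_simplex (Suc q) \<rightarrow> U" by (metis order_refl)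
    define u where "u = approx_chain (Suc q) ((singular_subdivision (Suc q) ^^ n) b)"
    define c' where "c' = approx_chain q ((singular_subdivision q ^^ n) ?a)"
    have u: "u \<in> chains K (Suc p)"
    proof (rule chainsI)
      fix G assume "u G \<noteq> 0"
      then obtain f where f: "f \<in> Poly_Mapping.keys ((singular_subdivision (Suc q) ^^ n) b)"
        "G = set (simplex_verts (Suc q) f)" "card G = Suc (Suc q)"
        unfolding u_def by (rule approx_chain_supp)
      obtain y where y: "y \<in> topspace ?X" "f \<in> standard_simplex (Suc q) \<rightarrow> {t. \<forall>v\<in>V. \<bar>t v - y v\<bar> * real (card V) < 1}"
        using n[OF f(1)] by (auto simp: C_def)
      have "singular_simplex (Suc q) ?X f"
        using f(1) iterated_subdivision_boundary(1)[OF b(1)] by (auto simp: singular_chain_def)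
      from approx_small[OF this y] show "G \<in> K \<and> card G = Suc p" using f Suc by simp
    qed
    have real: "approx_chain q ((singular_subdivision q ^^ n) ?c) G = z G" for G
    proof -
      have "approx_chain q ((singular_subdivision q ^^ n) ?c) G = (\<Sum>H\<in>Pow V. z H *
          approx_chain q ((singular_subdivision q ^^ n) (frag_of (real_simplex (vlist H)))) G)"
        by (simp add: real_chain_def iterated_subdivision_sum iterated_subdivision_cmul approx_chain_def lin_ext_sum lin_ext_cmul)
      also have "\<dots> = (\<Sum>H\<in>Pow V. if H = G then z G else 0)"
      proof (rule sum.cong[OF refl])
        fix H
        show "z H * approx_chain q ((singular_subdivision q ^^ n) (frag_of (real_simplex (vlist H)))) G
            = (if H = G then z G else 0)"
        proof (cases "z H = 0")
          case False
          then have "H \<in> K" "card H = Suc q" using chainsD[OF z] Suc by auto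
          then show ?thesis using approx_subdivided_simplex[of H q n G] by (auto simp: point_def)
        qed auto
      qed
      also have "\<dots> = z G" using finite_V chainsD0[OF zV, of G] by (auto simp: sum.delta)
      finally show ?thesis .
    qed
    have bu: "bd u G = z G - c' G" for G
    proof -
      have "bd u G = approx_chain q ((singular_subdivision q ^^ n) (?c - ?a)) G"
        unfolding u_def
        using approx_chain_boundary[OF iterated_subdivision_boundary(1)[OF b(1)]]
          iterated_subdivision_boundary(2)[OF b(1), of n] b(2) by simp
      then show ?thesis
        using real by (simp add: singular_subdivision_power_diff c'_def approx_chain_def lin_ext_diff)
    qed
    \<comment> \<open>The image under the constant map need not be the zero chain, but all its
      simplices sit at \<open>a\<close>, so that their approximations use only the vertex near
      \<open>a\<close>.\<close>
    have "\<exists>u'\<in>chains K (Suc p). \<forall>G. bd u' G = c' G"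
    proof (rule cone_w)
      fix G
      show "G \<subseteq> {?w} \<and> card G = p" if "c' G \<noteq> 0"
      proof -
        obtain f where f: "f \<in> Poly_Mapping.keys ((singular_subdivision q ^^ n) ?a)"
          "G = set (simplex_verts q f)" "card G = Suc q"
          using \<open>c' G \<noteq> 0\<close> unfolding c'_def by (rule approx_chain_supp)
        have ss: "singular_simplex q (subtopology ?X {a}) f"
          using f(1) iterated_subdivision_boundary(1)[OF aX] by (auto simp: singular_chain_def)
        have "G \<subseteq> {?w}"
        proof
          fix v assume "v \<in> G"
          then obtain y where "y \<in> topspace (subtopology ?X {a})" "v = near_vertex y"
            using simplex_vert_point[OF ss] f(2) by blast
          then show "v \<in> {?w}" by simp
        qed
        then show ?thesis using f Suc by simp
      qed
      have "c' = (\<lambda>G. z G - bd u G)" using bu by auto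
      then have "bd c' G = bd z G - bd (bd u) G" by (simp only: bd_diff)
      then show "bd c' G = 0" using bz bd_bd[of u G] by simp
    qed
    then obtain u' where u': "u' \<in> chains K (Suc p)" "\<And>G. bd u' G = c' G" by blast
    show ?thesis
      by (rule bexI[of _ "\<lambda>G. u G + u' G"]) (use u u' bu in \<open>auto simp: bd_add intro: chains_add\<close>)
  qed
qed

end

end

section \<open>Deleting a face from a sphere\<close>

text \<open>Each point \<open>y\<close> moves along the normalized segment from \<open>y\<close> to
  the antipode of \<open>x\<close>. The segment misses the origin because \<open>y\<close> is not
  \<open>x\<close>, and the motion never passes through \<open>x\<close>.\<close>

lemma contractible_punctured_nsphere:
  assumes "x \<in> topspace (nsphere m)"
  shows "contractible_space (subtopology (nsphere m) (topspace (nsphere m) - {x}))"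
proof -
  define T where "T = {y :: nat \<Rightarrow> real. (\<Sum>i\<le>m. (y i)\<^sup>2) = 1 \<and> (\<forall>i>m. y i = 0)}"
  have top: "topspace (nsphere m) = T" by (simp add: nsphere T_def)
  define Y where "Y = subtopology (powertop_real UNIV) (T - {x})"
  have Y: "subtopology (nsphere m) (topspace (nsphere m) - {x}) = Y"
    unfolding top by (simp add: nsphere T_def Y_def subtopology_subtopology) (simp add: Int_Diff Int_absorb1)
  have x: "(\<Sum>i\<le>m. (x i)\<^sup>2) = 1" "\<And>i. i > m \<Longrightarrow> x i = 0" using assms unfolding top by (auto simp: T_def)
  define u where "u t y i = (1 - t) * y i - t * x i" for t :: real and y :: "nat \<Rightarrow> real" and i
  define N where "N t y = sqrt (\<Sum>i\<le>m. (u t y i)\<^sup>2)" for t y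
  \<comment> \<open>This serves twice: a zero of \<open>u t y\<close> and an arrival of the homotopy
    at \<open>x\<close> would both make \<open>y\<close> proportional to \<open>x\<close> with
    factors of these signs.\<close>
  have same: "y = x" if y: "y \<in> T" and t: "0 \<le> a" "0 < b" "\<And>i. i \<le> m \<Longrightarrow> a * y i = b * x i" for y a b
  proof -
    have "a\<^sup>2 * (\<Sum>i\<le>m. (y i)\<^sup>2) = b\<^sup>2 * (\<Sum>i\<le>m. (x i)\<^sup>2)"
      using t by (auto simp: sum_distrib_left simp flip: power_mult_distrib intro!: sum.cong)
    then have "a\<^sup>2 = b\<^sup>2" using y x by (simp add: T_def)
    then have ab: "a = b" using t by (simp add: power2_eq_iff_nonneg)
    show ?thesis
    proof
      fix i show "y i = x i" using t(3)[of i] ab t(2) y x(2)[of i] by (cases "i \<le> m") (auto simp: T_def)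
    qed
  qed
  have Npos: "N t y > 0" if t: "0 \<le> t" "t \<le> 1" and y: "y \<in> T" "y \<noteq> x" for t y
  proof (rule ccontr)
    assume "\<not> ?thesis"
    then have "(\<Sum>i\<le>m. (u t y i)\<^sup>2) \<le> 0" by (simp add: N_def)
    then have "(\<Sum>i\<le>m. (u t y i)\<^sup>2) = 0" by (intro antisym sum_nonneg) auto
    then have "u t y i = 0" if "i \<le> m" for i using that by (subst (asm) sum_nonneg_eq_0_iff) auto
    then have e: "(1 - t) * y i = t * x i" if "i \<le> m" for i using that by (simp add: u_def)
    show False
    proof (cases "t = 0")
      case True
      then have "(\<Sum>i\<le>m. (y i)\<^sup>2) = 0" using e by simp
      then show False using y by (simp add: T_def)
    next
      case False
      then show False using same[of y "1 - t" t] t y e by auto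
    qed
  qed
  define h where "h = (\<lambda>(t, y) i. u t y i / N t y)"
  have "homotopic_with (\<lambda>_. True) Y Y id (\<lambda>_ i. - x i)"
  proof (subst homotopic_with, simp, intro exI[of _ h] conjI ballI)
    have cu: "continuous_map (prod_topology (top_of_set {0..1}) Y) euclideanreal (\<lambda>p. u (fst p) (snd p) i)" for i
    proof -
      have 1: "continuous_map (prod_topology (top_of_set {0..1::real}) Y) euclideanreal fst"
        using continuous_map_fst continuous_map_into_fulltopology by blast
      have "continuous_map Y euclideanreal (\<lambda>y. y i)"
        unfolding Y_def by (intro continuous_map_from_subtopology continuous_map_product_projection) auto
      then have 2: "continuous_map (prod_topology (top_of_set {0..1::real}) Y) euclideanreal (\<lambda>p. snd p i)"
        using continuous_map_compose[OF continuous_map_snd, where g = "\<lambda>y. y i"] by (simp add: o_def)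
      show ?thesis unfolding u_def by (intro continuous_intros 1 2)
    qed
    then have cN: "continuous_map (prod_topology (top_of_set {0..1}) Y) euclideanreal (\<lambda>p. N (fst p) (snd p))"
      unfolding N_def by (intro continuous_intros) auto
    have "continuous_map (prod_topology (top_of_set {0..1}) Y) (powertop_real UNIV) h"
      unfolding continuous_map_componentwise_UNIV
    proof
      fix i
      have "continuous_map (prod_topology (top_of_set {0..1}) Y) euclideanreal (\<lambda>p. u (fst p) (snd p) i / N (fst p) (snd p))"
      proof (intro continuous_map_real_divide cu cN)
        show "N (fst p) (snd p) \<noteq> 0" if "p \<in> topspace (prod_topology (top_of_set {0..1}) Y)" for p
          using Npos[of "fst p" "snd p"] that by (auto simp: Y_def)
      qed
      then show "continuous_map (prod_topology (top_of_set {0..1}) Y) euclideanreal (\<lambda>p. h p i)"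
        by (simp add: h_def case_prod_beta)
    qed
    moreover have "h (t, y) \<in> T - {x}" if t: "0 \<le> t" "t \<le> 1" and y: "y \<in> T" "y \<noteq> x" for t y
    proof -
      have p: "N t y > 0" using Npos[OF t y] .
      have "(\<Sum>i\<le>m. (h (t, y) i)\<^sup>2) = (\<Sum>i\<le>m. (u t y i)\<^sup>2) / (N t y)\<^sup>2"
        by (simp add: h_def power_divide sum_divide_distrib)
      also have "(\<Sum>i\<le>m. (u t y i)\<^sup>2) = (N t y)\<^sup>2" by (simp add: N_def sum_nonneg)
      finally have "h (t, y) \<in> T" using p y x(2) by (auto simp: T_def h_def u_def)
      moreover have "h (t, y) \<noteq> x"
      proof
        assume "h (t, y) = x"
        then have "u t y i = N t y * x i" for i using p by (auto simp: h_def fun_eq_iff field_simps)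
        then have "(1 - t) * y i = (t + N t y) * x i" for i by (simp add: u_def algebra_simps)
        then show False using same[of y "1 - t" "t + N t y"] t y p by auto
      qed
      ultimately show ?thesis by simp
    qed
    moreover from this have "h \<in> topspace (prod_topology (top_of_set {0..1}) Y) \<rightarrow> T - {x}"
      by (intro funcsetI) (force simp: Y_def)
    ultimately show "continuous_map (prod_topology (top_of_set {0..1}) Y) Y h"
      unfolding Y_def continuous_map_in_subtopology by blast
  next
    fix y assume "y \<in> topspace Y"
    then have y: "y \<in> T" by (simp add: Y_def)
    then have "N 0 y = 1" "\<And>i. u 0 y i = y i" by (simp_all add: N_def u_def T_def)
    then show "h (0, y) = id y" by (simp add: h_def)
    have "N 1 y = 1" "\<And>i. u 1 y i = - x i" using x by (simp_all add: N_def u_def)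
    then show "h (1, y) = (\<lambda>i. - x i)" by (simp add: h_def)
  qed auto
  then show ?thesis unfolding Y contractible_space_def by blast
qed

definition deletion :: "'v set set \<Rightarrow> 'v set \<Rightarrow> 'v set set"
  where "deletion \<Delta> F = {G \<in> \<Delta>. \<not> F \<subseteq> G}"

lemma continuous_map_Min:
  assumes "finite F" "F \<noteq> {}" "\<And>v. v \<in> F \<Longrightarrow> continuous_map X euclideanreal (g v)"
  shows "continuous_map X euclideanreal (\<lambda>t. Min ((\<lambda>v. g v t) ` F))"
  using assms
proof (induction F rule: finite_ne_induct)
  case (insert v F)
  then have "(\<lambda>t. Min ((\<lambda>v. g v t) ` insert v F)) = (\<lambda>t. min (g v t) (Min ((\<lambda>v. g v t) ` F)))"
    by auto
  then show ?case using insert by (simp add: continuous_map_real_min)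
qed simp

text \<open>The realization of the deletion is a retract of the sphere punctured at the barycenter of
  \<open>F\<close>: subtract the least coordinate on \<open>F\<close> from all coordinates on \<open>F\<close> and normalize.\<close>

lemma deletion_nullhomotopic:
  fixes \<Delta> :: "'v set set"
  assumes sphere: "simplicial_sphere \<Delta>" and F: "F \<in> \<Delta>" "F \<noteq> {}"
  obtains a where "a \<in> topspace (realization (deletion \<Delta> F))"
    "homotopic_with (\<lambda>_. True) (realization (deletion \<Delta> F)) (realization (deletion \<Delta> F)) id (\<lambda>_. a)"
proof -
  let ?D = "deletion \<Delta> F"
  obtain m where m: "realization \<Delta> homeomorphic_space nsphere m" and cx: "simplicial_complex \<Delta>"
    using sphere by (auto simp: simplicial_sphere_def)
  obtain h k where hk: "homeomorphic_maps (realization \<Delta>) (nsphere m) h k"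
    using m by (auto simp: homeomorphic_space_def)
  have fin: "finite \<Delta>" "finite F" "finite (\<Union>\<Delta>)" using cx F by (auto simp: simplicial_complex_def)
  have closed: "H \<in> \<Delta>" if "G \<in> \<Delta>" "H \<subseteq> G" for G H using cx that by (auto simp: simplicial_complex_def)
  have cF: "card F > 0" using fin F by (simp add: card_gt_0_iff)
  define pts where "pts L = {t :: 'v \<Rightarrow> real. (\<forall>v. 0 \<le> t v) \<and> {v. t v \<noteq> 0} \<in> L \<and> (\<Sum>v\<in>\<Union>L. t v) = 1}" for L
  have R: "realization L = subtopology (powertop_real UNIV) (pts L)" for L
    by (simp add: realization_def pts_def)
  have top: "topspace (realization L) = pts L" for L by (simp add: R)
  have sumD: "(\<Sum>v\<in>\<Union>?D. t v) = (\<Sum>v\<in>\<Union>\<Delta>. t v)" if "{v. t v \<noteq> 0} \<in> ?D" for t :: "'v \<Rightarrow> real"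
    using that fin by (intro sum.mono_neutral_left) (auto simp: deletion_def)
  have D\<Delta>: "pts ?D \<subseteq> pts \<Delta>" using sumD by (auto simp: pts_def) (auto simp: deletion_def)
  define x where "x v = (if v \<in> F then 1 / real (card F) else 0)" for v
  have suppx: "{v. x v \<noteq> 0} = F" using cF by (auto simp: x_def)
  have "(\<Sum>v\<in>\<Union>\<Delta>. x v) = (\<Sum>v\<in>F. x v)"
    using F fin by (intro sum.mono_neutral_right) (auto simp: x_def)
  then have x: "x \<in> pts \<Delta>" using cF F suppx by (auto simp: pts_def x_def)
  have xD: "x \<notin> pts ?D" by (simp add: pts_def suppx deletion_def)
  define \<mu> where "\<mu> t = Min (t ` F)" for t :: "'v \<Rightarrow> real"
  have \<mu>_le: "\<mu> t \<le> t v" if "v \<in> F" for t v using that fin by (simp add: \<mu>_def)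
  have \<mu>_in: "\<exists>v\<in>F. \<mu> t = t v" for t
  proof -
    have "Min (t ` F) \<in> t ` F" using fin F by (intro Min_in) auto
    then show ?thesis unfolding \<mu>_def by blast
  qed
  \<comment> \<open>This keeps the normalizing denominator positive: the coordinates on
    \<open>F\<close> sum to at most 1, and \<open>card F\<close> times their minimum can equal 1
    only at the barycenter.\<close>
  have \<mu>_lt: "card F * \<mu> t < 1" if t: "t \<in> pts \<Delta>" "t \<noteq> x" for t
  proof -
    have F\<Delta>: "F \<subseteq> \<Union>\<Delta>" using F by auto
    have 1: "card F * \<mu> t \<le> (\<Sum>v\<in>F. t v)"
      using sum_mono[of F "\<lambda>_. \<mu> t" t] \<mu>_le by simp
    have 2: "(\<Sum>v\<in>F. t v) \<le> (\<Sum>v\<in>\<Union>\<Delta>. t v)"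
      using t F\<Delta> fin by (intro sum_mono2) (auto simp: pts_def)
    have 3: "(\<Sum>v\<in>\<Union>\<Delta>. t v) = 1" using t by (simp add: pts_def)
    have "card F * \<mu> t \<noteq> 1"
    proof
      assume e: "card F * \<mu> t = 1"
      then have "(\<Sum>v\<in>F. t v - \<mu> t) = 0" using 1 2 3 by (simp add: sum_subtractf)
      then have "\<forall>v\<in>F. t v - \<mu> t = 0" using \<mu>_le fin by (subst (asm) sum_nonneg_eq_0_iff) auto
      moreover have "(\<Sum>v\<in>\<Union>\<Delta> - F. t v) = 0"
        using 1 2 3 e sum.subset_diff[OF F\<Delta> fin(3), of t] by linarith
      then have "\<forall>v\<in>\<Union>\<Delta> - F. t v = 0" using t fin by (subst (asm) sum_nonneg_eq_0_iff) (auto simp: pts_def)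
      moreover have "t v = 0" if "v \<notin> \<Union>\<Delta>" for v using t that by (auto simp: pts_def)
      moreover have "\<mu> t = 1 / card F" using e cF by (simp add: field_simps)
      ultimately have "t v = x v" for v by (cases "v \<in> F"; cases "v \<in> \<Union>\<Delta>") (auto simp: x_def)
      then show False using t(2) by auto
    qed
    then show ?thesis using 1 2 3 by linarith
  qed
  define r where "r t v = (t v - (if v \<in> F then \<mu> t else 0)) / (1 - card F * \<mu> t)" for t v
  define P where "P = subtopology (powertop_real UNIV) (pts \<Delta> - {x})"
  have r_in: "r t \<in> pts ?D" if t: "t \<in> pts \<Delta>" "t \<noteq> x" for t
  proof -
    have pos: "1 - card F * \<mu> t > 0" using \<mu>_lt[OF t] by simp
    have nn: "0 \<le> t v" for v using t by (simp add: pts_def)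
    obtain w where w: "w \<in> F" "\<mu> t = t w" using \<mu>_in by blast
    have sub: "{v. r t v \<noteq> 0} \<subseteq> {v. t v \<noteq> 0}"
      using \<mu>_le[of _ t] nn w by (auto simp: r_def) (metis order_antisym)
    have "w \<notin> {v. r t v \<noteq> 0}" using w by (simp add: r_def)
    then have supp: "{v. r t v \<noteq> 0} \<in> ?D"
      using closed[OF _ sub] t w by (auto simp: deletion_def pts_def)
    have "(\<Sum>v\<in>\<Union>\<Delta>. if v \<in> F then \<mu> t else 0) = card F * \<mu> t"
    proof -
      have "F \<subseteq> \<Union>\<Delta>" using F by auto
      then have "\<Union>\<Delta> \<inter> F = F" by auto
      then show ?thesis using fin by (simp add: sum.If_cases)
    qed
    then have "(\<Sum>v\<in>\<Union>\<Delta>. r t v) = 1"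
      using t pos by (simp add: r_def sum_subtractf pts_def flip: sum_divide_distrib)
    moreover have "0 \<le> r t v" for v using pos nn \<mu>_le[of v t] by (auto simp: r_def)
    ultimately show ?thesis using sumD[OF supp] supp by (simp add: pts_def)
  qed
  have c\<mu>: "continuous_map P euclideanreal \<mu>"
    unfolding \<mu>_def P_def using fin F
    by (intro continuous_map_Min continuous_map_from_subtopology continuous_map_product_projection) auto
  have cr: "continuous_map P (realization ?D) r"
    unfolding R continuous_map_in_subtopology
  proof
    show "continuous_map P (powertop_real UNIV) r"
      unfolding continuous_map_componentwise_UNIV
    proof
      fix v
      have 1: "continuous_map P euclideanreal (\<lambda>t. t v)"
        unfolding P_def by (intro continuous_map_from_subtopology continuous_map_product_projection) auto
      have 2: "continuous_map P euclideanreal (\<lambda>t. if v \<in> F then \<mu> t else 0)" using c\<mu> by auto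
      show "continuous_map P euclideanreal (\<lambda>t. r t v)"
        unfolding r_def
      proof (intro continuous_intros 1 2 c\<mu>)
        show "1 - card F * \<mu> t \<noteq> 0" if "t \<in> topspace P" for t using \<mu>_lt[of t] that by (auto simp: P_def)
      qed auto
    qed
    show "r \<in> topspace P \<rightarrow> pts ?D" using r_in by (auto simp: P_def)
  qed
  have r_id: "r t = t" if t: "t \<in> pts ?D" for t
  proof -
    obtain w where w: "w \<in> F" "t w = 0" using t by (auto simp: pts_def deletion_def)
    then have "\<mu> t \<le> 0" using \<mu>_le[of w t] by simp
    moreover have "0 \<le> \<mu> t" using \<mu>_in[of t] t by (auto simp: pts_def)
    ultimately have "\<mu> t = 0" by simp
    then show ?thesis by (simp add: r_def fun_eq_iff)
  qed
  let ?S = "subtopology (nsphere m) (topspace (nsphere m) - {h x})"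
  have h: "continuous_map (realization \<Delta>) (nsphere m) h" "continuous_map (nsphere m) (realization \<Delta>) k"
    "\<And>t. t \<in> pts \<Delta> \<Longrightarrow> k (h t) = t" "\<And>y. y \<in> topspace (nsphere m) \<Longrightarrow> h (k y) = y"
    using hk by (auto simp: homeomorphic_maps_def top)
  have hx: "h x \<in> topspace (nsphere m)" using h(1) x by (auto simp: continuous_map_def top)
  have ch: "continuous_map (realization ?D) ?S h"
    unfolding continuous_map_in_subtopology
  proof
    have "realization ?D = subtopology (realization \<Delta>) (pts ?D)"
      using D\<Delta> by (simp add: R subtopology_subtopology Int_absorb1)
    then show "continuous_map (realization ?D) (nsphere m) h" using h(1) by (simp add: continuous_map_from_subtopology)
    show "h \<in> topspace (realization ?D) \<rightarrow> topspace (nsphere m) - {h x}"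
    proof
      fix t assume "t \<in> topspace (realization ?D)"
      then have "t \<in> pts \<Delta>" "t \<noteq> x" using D\<Delta> xD by (auto simp: top)
      then show "h t \<in> topspace (nsphere m) - {h x}"
        using h(1) h(3)[of t] h(3)[OF x] by (auto simp: continuous_map_def top)
    qed
  qed
  have ck: "continuous_map ?S P k"
    unfolding P_def continuous_map_in_subtopology
  proof
    show "continuous_map ?S (powertop_real UNIV) k"
      using h(2) unfolding R by (intro continuous_map_from_subtopology) (simp add: continuous_map_in_subtopology)
    show "k \<in> topspace ?S \<rightarrow> pts \<Delta> - {x}"
      using h(2,4) by (auto simp: continuous_map_def top)
  qed
  \<comment> \<open>The identity of the deletion factors through the contractible punctured sphere:
    first \<open>h\<close>, then \<open>k\<close>, then the retraction.\<close>
  obtain a where a: "homotopic_with (\<lambda>_. True) (realization ?D) (realization ?D) ((r \<circ> k) \<circ> h) (\<lambda>_. a)"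
    using nullhomotopic_through_contractible_space[OF ch continuous_map_compose[OF ck cr]
        contractible_punctured_nsphere[OF hx]] by blast
  have hom: "homotopic_with (\<lambda>_. True) (realization ?D) (realization ?D) id (\<lambda>_. a)"
    by (rule homotopic_with_eq[OF a]) (use h(3) D\<Delta> r_id in \<open>auto simp: top\<close>)
  \<comment> \<open>On an empty space a homotopy to a constant map would not place \<open>a\<close>
    in it; the image of the antipode of \<open>h x\<close> provides a point.\<close>
  have "topspace (realization ?D) \<noteq> {}"
  proof -
    have "(\<lambda>i. - h x i) \<in> topspace (nsphere m)" using hx by (simp add: nsphere)
    moreover have "(\<lambda>i. - h x i) \<noteq> h x"
    proof
      assume "(\<lambda>i. - h x i) = h x"
      then have "- h x i = h x i" for i by (rule fun_cong)
      then have "h x i = 0" for i by (metis neg_equal_zero)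
      then show False using hx by (simp add: nsphere)
    qed
    ultimately have "(\<lambda>i. - h x i) \<in> topspace ?S" by simp
    then have "r (k (\<lambda>i. - h x i)) \<in> topspace (realization ?D)"
      using ck cr by (simp add: continuous_map_def Pi_iff)
    then show ?thesis by auto
  qed
  moreover have "continuous_map (realization ?D) (realization ?D) (\<lambda>_. a)"
    using homotopic_with_imp_continuous_maps[OF hom] by blast
  ultimately have "a \<in> topspace (realization ?D)" by (auto simp: continuous_map_def)
  then show ?thesis using hom that by blast
qed

lemma (in vertex_order) deletion_acyclic:
  assumes sphere: "simplicial_sphere \<Delta>" and V: "\<Union>\<Delta> \<subseteq> V" and F: "F \<in> \<Delta>" "F \<noteq> {}"
  shows "acyclic_over TYPE('k::comm_ring_1) (deletion \<Delta> F)"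
proof -
  have closed: "H \<in> deletion \<Delta> F" if "G \<in> deletion \<Delta> F" "H \<subseteq> G" for G H
    using sphere that by (auto simp: simplicial_sphere_def simplicial_complex_def deletion_def)
  have DV: "\<Union>(deletion \<Delta> F) \<subseteq> V" using V by (auto simp: deletion_def)
  obtain a where "a \<in> topspace (realization (deletion \<Delta> F))"
    "homotopic_with (\<lambda>_. True) (realization (deletion \<Delta> F)) (realization (deletion \<Delta> F)) id (\<lambda>_. a)"
    using deletion_nullhomotopic[OF sphere F] by blast
  then have "acyclic_over TYPE(int) (deletion \<Delta> F)"
    using acyclic_if_nullhomotopic[of "deletion \<Delta> F"] closed DV by blast
  then show ?thesis using acyclic_over_any[of "deletion \<Delta> F"] closed DV by blast
qed

section \<open>Cohen--Macaulay families\<close>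

context vertex_order
begin

text \<open>The chains on the simplices containing \<open>F\<close> form, up to a shift, the chain complex of the
  link of \<open>F\<close>.\<close>

definition CM :: "'k::comm_ring_1 itself \<Rightarrow> 'v set set \<Rightarrow> nat \<Rightarrow> bool"
  where "CM _ \<Gamma> n \<longleftrightarrow> (\<forall>F\<in>\<Gamma>. \<forall>p<n. \<forall>c\<in>chains {G \<in> \<Gamma>. F \<subseteq> G} p.
    (\<forall>G. F \<subseteq> G \<longrightarrow> bd c G = (0::'k)) \<longrightarrow>
    (\<exists>w\<in>chains {G \<in> \<Gamma>. F \<subseteq> G} (Suc p). \<forall>G. F \<subseteq> G \<longrightarrow> bd w G = c G))"

definition restr :: "'v set \<Rightarrow> ('v set \<Rightarrow> 'k::comm_ring_1) \<Rightarrow> 'v set \<Rightarrow> 'k"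
  where "restr F c G = (if F \<subseteq> G then c G else 0)"

text \<open>Sets that contribute to the value at \<open>G\<close> contain \<open>G\<close>, hence
  \<open>F\<close>. Restriction to the simplices above \<open>F\<close> is therefore compatible with
  the boundary of the link.\<close>

lemma bd_restr: "F \<subseteq> G \<Longrightarrow> bd (restr F c) G = bd c G"
  by (auto simp: bd_def restr_def intro!: sum.cong)

lemma restr_chains: "c \<in> chains \<Gamma> p \<Longrightarrow> restr F c \<in> chains {G \<in> \<Gamma>. F \<subseteq> G} p"
  by (auto simp: chains_def restr_def)

lemma CM_D:
  fixes c :: "'v set \<Rightarrow> 'k::comm_ring_1"
  assumes "CM TYPE('k) \<Gamma> n" "F \<in> \<Gamma>" "p < n" "c \<in> chains {G \<in> \<Gamma>. F \<subseteq> G} p"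
    "\<And>G. F \<subseteq> G \<Longrightarrow> bd c G = 0"
  obtains w where "w \<in> chains {G \<in> \<Gamma>. F \<subseteq> G} (Suc p)" "\<And>G. F \<subseteq> G \<Longrightarrow> bd w G = c G"
  using assms unfolding CM_def by blast

text \<open>A cycle relative to the deletion has its boundary in the deletion, where that boundary,
  being a cycle, bounds again. Replacing \<open>c\<close> by \<open>c - b\<close> makes the cycle
  absolute without changing its values above \<open>F\<close>.\<close>

lemma relative_boundary:
  fixes c :: "'v set \<Rightarrow> 'k::comm_ring_1"
  assumes closed: "\<forall>G\<in>\<Delta>. Pow G \<subseteq> \<Delta>" and \<Delta>V: "\<Delta> \<subseteq> Pow V"
    and F: "F \<noteq> {}" and ac: "acyclic_over TYPE('k) (deletion \<Delta> F)"
    and c: "c \<in> chains {G \<in> \<Delta>. F \<subseteq> G} p" and bc: "\<And>G. F \<subseteq> G \<Longrightarrow> bd c G = 0"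
  obtains b where "b \<in> chains (deletion \<Delta> F) p" "\<And>G. bd b G = bd c G"
proof (cases p)
  case 0
  have "c G = 0" for G
  proof (rule ccontr)
    assume "c G \<noteq> 0"
    then have G: "G \<in> \<Delta>" "F \<subseteq> G" "card G = 0" using chainsD[OF c] 0 by auto
    moreover have "finite G" using G(1) \<Delta>V finite_subset[OF _ finite_V] by blast
    ultimately show False using F by simp
  qed
  then have "c = (\<lambda>G. 0)" by auto
  then show ?thesis using that[of "\<lambda>G. 0"] by (simp add: chains_def)
next
  case (Suc q)
  have "c \<in> chains \<Delta> (Suc q)" using c Suc by (auto simp: chains_def)
  then have b\<Delta>: "bd c \<in> chains \<Delta> q" by (rule bd_chains) (use closed in blast)
  have "bd c \<in> chains (deletion \<Delta> F) q"
  proof (rule chainsI)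
    fix G assume "bd c G \<noteq> 0"
    then show "G \<in> deletion \<Delta> F \<and> card G = q"
      using chainsD[OF b\<Delta>, of G] bc[of G] by (auto simp: deletion_def)
  qed
  from acyclic_overD[OF ac this bd_bd] show ?thesis using that Suc by auto
qed

text \<open>Relative cycles are made absolute by \<open>relative_boundary\<close>. An absolute cycle
  in degree below \<open>n\<close> involves no set containing \<open>F0\<close>, so it lies in the
  acyclic deletion of \<open>F0\<close> and bounds there.\<close>

lemma CM_of_acyclic_deletions:
  fixes \<Delta> :: "'v set set"
  assumes closed: "\<forall>G\<in>\<Delta>. Pow G \<subseteq> \<Delta>" and \<Delta>V: "\<Delta> \<subseteq> Pow V"
    and ac: "\<And>F. F \<in> \<Delta> \<Longrightarrow> F \<noteq> {} \<Longrightarrow> acyclic_over TYPE('k::comm_ring_1) (deletion \<Delta> F)"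
    and F0: "F0 \<in> \<Delta>" "card F0 = n"
  shows "CM TYPE('k) \<Delta> n"
  unfolding CM_def
proof (intro ballI allI impI)
  have fin: "finite G" if "G \<in> \<Delta>" for G using that \<Delta>V finite_subset[OF _ finite_V] by blast
  have absolute: "\<exists>w\<in>chains \<Delta> (Suc p). \<forall>G. bd w G = c G"
    if c: "c \<in> chains \<Delta> p" and p: "p < n" and bc: "\<And>G. bd c G = (0::'k)" for p c
  proof -
    have "c \<in> chains (deletion \<Delta> F0) p"
    proof (rule chainsI)
      fix G assume "c G \<noteq> 0"
      then have G: "G \<in> \<Delta>" "card G = p" using chainsD[OF c] by auto
      then have "\<not> F0 \<subseteq> G" using card_mono[OF fin[OF G(1)], of F0] p F0 by auto
      then show "G \<in> deletion \<Delta> F0 \<and> card G = p" using G by (simp add: deletion_def)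
    qed
    moreover have "F0 \<noteq> {}" using F0 p by auto
    ultimately obtain w where w: "w \<in> chains (deletion \<Delta> F0) (Suc p)" "\<And>G. bd w G = c G"
      using acyclic_overD[OF ac[OF F0(1)]] bc by blast
    have "w \<in> chains \<Delta> (Suc p)" using w(1) by (rule chains_mono) (auto simp: deletion_def)
    then show ?thesis using w(2) by blast
  qed
  fix F p and c :: "'v set \<Rightarrow> 'k"
  assume F: "F \<in> \<Delta>" and p: "p < n" and c: "c \<in> chains {G \<in> \<Delta>. F \<subseteq> G} p"
    and bc: "\<forall>G. F \<subseteq> G \<longrightarrow> bd c G = 0"
  have c\<Delta>: "c \<in> chains \<Delta> p" using c by (rule chains_mono) auto
  have "\<exists>b\<in>chains \<Delta> p. (\<forall>G. F \<subseteq> G \<longrightarrow> b G = 0) \<and> (\<forall>G. bd b G = bd c G)"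
  proof (cases "F = {}")
    case True
    then show ?thesis using bc by (intro bexI[of _ "\<lambda>G. 0"]) (auto simp: chains_def)
  next
    case False
    obtain b where b: "b \<in> chains (deletion \<Delta> F) p" "\<And>G. bd b G = bd c G"
      using relative_boundary[OF closed \<Delta>V False ac[OF F False] c] bc by blast
    have "b \<in> chains \<Delta> p" using b(1) by (rule chains_mono) (auto simp: deletion_def)
    moreover have "b G = 0" if "F \<subseteq> G" for G using chainsD0[OF b(1), of G] that by (auto simp: deletion_def)
    ultimately show ?thesis using b(2) by blast
  qed
  then obtain b where b: "b \<in> chains \<Delta> p" "\<And>G. F \<subseteq> G \<Longrightarrow> b G = 0" "\<And>G. bd b G = bd c G" by blast
  have "bd (\<lambda>G. c G - b G) G = 0" for G by (simp add: bd_diff b(3))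
  from absolute[OF chains_diff[OF c\<Delta> b(1)] p this]
  obtain w where w: "w \<in> chains \<Delta> (Suc p)" "\<And>G. bd w G = c G - b G" by blast
  show "\<exists>w\<in>chains {G \<in> \<Delta>. F \<subseteq> G} (Suc p). \<forall>G. F \<subseteq> G \<longrightarrow> bd w G = c G"
    by (rule bexI[OF _ restr_chains[OF w(1)]]) (simp add: bd_restr w(2) b(2))
qed

text \<open>If \<open>insert v F\<close> is not a face, the simplices above \<open>F\<close> are
  those of \<Delta>. Otherwise the cycle, made absolute, lies in the deletion of
  \<open>insert v F\<close>, which is acyclic; and a set above \<open>F\<close> that does not
  contain \<open>insert v F\<close> avoids \<open>v\<close>.\<close>

lemma CM_vertex_deletion:
  fixes \<Delta> :: "'v set set"
  assumes closed: "\<forall>G\<in>\<Delta>. Pow G \<subseteq> \<Delta>" and \<Delta>V: "\<Delta> \<subseteq> Pow V"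
    and ac: "\<And>F. F \<in> \<Delta> \<Longrightarrow> F \<noteq> {} \<Longrightarrow> acyclic_over TYPE('k::comm_ring_1) (deletion \<Delta> F)"
    and F0: "F0 \<in> \<Delta>" "card F0 = n" and v: "{v} \<in> \<Delta>"
  shows "CM TYPE('k) (deletion \<Delta> {v}) n"
  unfolding CM_def
proof (intro ballI allI impI)
  fix F p and c :: "'v set \<Rightarrow> 'k"
  assume F: "F \<in> deletion \<Delta> {v}" and p: "p < n" and c: "c \<in> chains {G \<in> deletion \<Delta> {v}. F \<subseteq> G} p"
    and bc: "\<forall>G. F \<subseteq> G \<longrightarrow> bd c G = 0"
  have F\<Delta>: "F \<in> \<Delta>" "v \<notin> F" using F by (auto simp: deletion_def)
  have c\<Delta>: "c \<in> chains {G \<in> \<Delta>. F \<subseteq> G} p" using c by (rule chains_mono) (auto simp: deletion_def)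
  show "\<exists>w\<in>chains {G \<in> deletion \<Delta> {v}. F \<subseteq> G} (Suc p). \<forall>G. F \<subseteq> G \<longrightarrow> bd w G = c G"
  proof (cases "insert v F \<in> \<Delta>")
    case False
    have "v \<notin> G" if "G \<in> \<Delta>" "F \<subseteq> G" for G
    proof
      assume "v \<in> G"
      then have "insert v F \<in> Pow G" using that by blast
      then show False using closed that(1) False by blast
    qed
    then have eq: "{G \<in> deletion \<Delta> {v}. F \<subseteq> G} = {G \<in> \<Delta>. F \<subseteq> G}"
      by (auto simp: deletion_def)
    have "CM TYPE('k) \<Delta> n" using closed \<Delta>V ac F0 by (rule CM_of_acyclic_deletions)
    from CM_D[OF this F\<Delta>(1) p c\<Delta>] show ?thesis unfolding eq using bc by blast
  next
    case True
    have "\<exists>b\<in>chains (deletion \<Delta> (insert v F)) p. (\<forall>G. F \<subseteq> G \<longrightarrow> b G = 0) \<and> (\<forall>G. bd b G = bd c G)"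
    proof (cases "F = {}")
      case True
      then show ?thesis using bc by (intro bexI[of _ "\<lambda>G. 0"]) (auto simp: chains_def)
    next
      case False
      obtain b where b: "b \<in> chains (deletion \<Delta> F) p" "\<And>G. bd b G = bd c G"
        using relative_boundary[OF closed \<Delta>V False ac[OF F\<Delta>(1) False] c\<Delta>] bc by blast
      have "b \<in> chains (deletion \<Delta> (insert v F)) p" using b(1) by (rule chains_mono) (auto simp: deletion_def)
      moreover have "b G = 0" if "F \<subseteq> G" for G using chainsD0[OF b(1), of G] that by (auto simp: deletion_def)
      ultimately show ?thesis using b(2) by blast
    qed
    then obtain b where b: "b \<in> chains (deletion \<Delta> (insert v F)) p" "\<And>G. F \<subseteq> G \<Longrightarrow> b G = 0"
      "\<And>G. bd b G = bd c G" by blast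
    have "c \<in> chains (deletion \<Delta> (insert v F)) p" using c by (rule chains_mono) (auto simp: deletion_def)
    note cb = chains_diff[OF this b(1)]
    have "bd (\<lambda>G. c G - b G) G = 0" for G by (simp add: bd_diff b(3))
    from acyclic_overD[OF ac[OF True] cb this]
    obtain w where w: "w \<in> chains (deletion \<Delta> (insert v F)) (Suc p)" "\<And>G. bd w G = c G - b G" by blast
    have "restr F w \<in> chains {G \<in> deletion \<Delta> (insert v F). F \<subseteq> G} (Suc p)" by (rule restr_chains[OF w(1)])
    then have "restr F w \<in> chains {G \<in> deletion \<Delta> {v}. F \<subseteq> G} (Suc p)"
      by (rule chains_mono) (auto simp: deletion_def)
    moreover have "\<forall>G. F \<subseteq> G \<longrightarrow> bd (restr F w) G = c G" by (simp add: bd_restr w(2) b(2))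
    ultimately show ?thesis by blast
  qed
qed

text \<open>Bound \<open>c\<close> by some \<open>w\<close> in \<Gamma> and push \<open>w\<close>
  off the vertices of colour \<open>i\<close>. The part of \<open>w\<close> above such a vertex
  \<open>v\<close> is a cycle there, because \<open>c\<close> has no simplex through
  \<open>v\<close>; it bounds some \<open>u v\<close>, and subtracting \<open>bd (u v)\<close>
  leaves the boundary of \<open>w\<close> alone. This correction takes place one degree higher,
  hence the loss of 1 in the bound.\<close>

lemma CM_remove_colour:
  fixes \<Gamma> :: "'v set set" and \<kappa> :: "'v \<Rightarrow> nat"
  assumes closed: "\<forall>G\<in>\<Gamma>. Pow G \<subseteq> \<Gamma>" and \<Gamma>V: "\<Gamma> \<subseteq> Pow V"
    and inj: "\<And>G. G \<in> \<Gamma> \<Longrightarrow> inj_on \<kappa> G"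
    and cm: "CM TYPE('k::comm_ring_1) \<Gamma> (Suc n)"
  shows "CM TYPE('k) {G \<in> \<Gamma>. i \<notin> \<kappa> ` G} n"
  unfolding CM_def
proof (intro ballI allI impI)
  fix F p and c :: "'v set \<Rightarrow> 'k"
  assume F: "F \<in> {G \<in> \<Gamma>. i \<notin> \<kappa> ` G}" and p: "p < n"
    and c: "c \<in> chains {G \<in> {G \<in> \<Gamma>. i \<notin> \<kappa> ` G}. F \<subseteq> G} p" and bc: "\<forall>G. F \<subseteq> G \<longrightarrow> bd c G = 0"
  have F\<Gamma>: "F \<in> \<Gamma>" using F by simp
  have c\<Gamma>: "c \<in> chains {G \<in> \<Gamma>. F \<subseteq> G} p" using c by (rule chains_mono) auto
  obtain w where w: "w \<in> chains {G \<in> \<Gamma>. F \<subseteq> G} (Suc p)" "\<And>G. F \<subseteq> G \<Longrightarrow> bd w G = c G"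
    using CM_D[OF cm F\<Gamma> _ c\<Gamma>] bc p by auto
  define Vi where "Vi = {v \<in> V. \<kappa> v = i}"
  have "\<exists>u. u \<in> chains {G \<in> \<Gamma>. insert v F \<subseteq> G} (Suc (Suc p)) \<and> (\<forall>G. insert v F \<subseteq> G \<longrightarrow> bd u G = w G)"
    if v: "v \<in> Vi" for v
  proof (cases "insert v F \<in> \<Gamma>")
    case True
    let ?wv = "restr (insert v F) w"
    have "w \<in> chains \<Gamma> (Suc p)" using w(1) by (rule chains_mono) auto
    then have wv: "?wv \<in> chains {G \<in> \<Gamma>. insert v F \<subseteq> G} (Suc p)" by (rule restr_chains)
    have b: "bd ?wv G = 0" if G: "insert v F \<subseteq> G" for G
    proof -
      have "bd ?wv G = c G" using G w(2) by (simp add: bd_restr)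
      also have "\<dots> = 0" using chainsD0[OF c, of G] G v by (auto simp: Vi_def)
      finally show ?thesis .
    qed
    obtain u where "u \<in> chains {G \<in> \<Gamma>. insert v F \<subseteq> G} (Suc (Suc p))" "\<And>G. insert v F \<subseteq> G \<Longrightarrow> bd u G = ?wv G"
      using CM_D[OF cm True _ wv b] p by auto
    then show ?thesis by (intro exI[of _ u]) (simp add: restr_def)
  next
    case False
    have "w G = 0" if "insert v F \<subseteq> G" for G
      using chainsD0[OF w(1), of G] closed that False by blast
    then show ?thesis by (intro exI[of _ "\<lambda>G. 0"]) (simp add: chains_def)
  qed
  then have "\<forall>v\<in>Vi. \<exists>u. u \<in> chains {G \<in> \<Gamma>. insert v F \<subseteq> G} (Suc (Suc p)) \<and>
      (\<forall>G. insert v F \<subseteq> G \<longrightarrow> bd u G = w G)" by blast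
  from bchoice[OF this] obtain u where
    u0: "\<forall>v\<in>Vi. u v \<in> chains {G \<in> \<Gamma>. insert v F \<subseteq> G} (Suc (Suc p)) \<and>
      (\<forall>G. insert v F \<subseteq> G \<longrightarrow> bd (u v) G = w G)" by blast
  have u: "u v \<in> chains {G \<in> \<Gamma>. insert v F \<subseteq> G} (Suc (Suc p))" if "v \<in> Vi" for v
    using u0 that by blast
  have bu: "bd (u v) G = w G" if "v \<in> Vi" "insert v F \<subseteq> G" for v G
    using u0 that by blast
  have finVi: "finite Vi" using finite_V by (simp add: Vi_def)
  define W where "W G = w G - (\<Sum>v\<in>Vi. bd (u v) G)" for G
  have W: "W \<in> chains \<Gamma> (Suc p)"
    unfolding W_def
  proof (intro chains_diff chains_sum)
    show "w \<in> chains \<Gamma> (Suc p)" using w(1) by (rule chains_mono) auto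
    fix v assume "v \<in> Vi"
    then have "u v \<in> chains {G \<in> \<Gamma>. insert v F \<subseteq> G} (Suc (Suc p))" by (rule u)
    then have "u v \<in> chains \<Gamma> (Suc (Suc p))" by (rule chains_mono) auto
    then show "bd (u v) \<in> chains \<Gamma> (Suc p)" by (rule bd_chains) (use closed in blast)
  qed
  \<comment> \<open>A simplex contains at most one vertex of colour \<open>i\<close>, so the
    corrections for different vertices do not interfere.\<close>
  have Wi: "W G = 0" if G: "F \<subseteq> G" "i \<in> \<kappa> ` G" "G \<subseteq> V" for G
  proof -
    obtain x where x: "x \<in> G" "\<kappa> x = i" using G(2) by blast
    then have xVi: "x \<in> Vi" using G(3) by (auto simp: Vi_def)
    have other: "bd (u v) G = 0" if v: "v \<in> Vi" "v \<noteq> x" for v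
    proof (rule ccontr)
      assume "bd (u v) G \<noteq> 0"
      then obtain y where "u v (insert y G) \<noteq> 0" using bd_supp by metis
      then have y: "insert y G \<in> \<Gamma>" "v \<in> insert y G" using chainsD[OF u[OF v(1)]] by auto
      moreover have "\<kappa> v = \<kappa> x" using v x by (simp add: Vi_def)
      ultimately show False using inj_onD[OF inj[OF y(1)], of v x] x v by auto
    qed
    have "(\<Sum>v\<in>Vi. bd (u v) G) = bd (u x) G + (\<Sum>v\<in>Vi - {x}. bd (u v) G)"
      using finVi xVi by (rule sum.remove)
    also have "(\<Sum>v\<in>Vi - {x}. bd (u v) G) = 0" using other by (intro sum.neutral) auto
    also have "bd (u x) G = w G" using bu[OF xVi, of G] x G by auto
    finally show ?thesis by (simp add: W_def)
  qed
  show "\<exists>w\<in>chains {G \<in> {G \<in> \<Gamma>. i \<notin> \<kappa> ` G}. F \<subseteq> G} (Suc p). \<forall>G. F \<subseteq> G \<longrightarrow> bd w G = c G"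
  proof (rule bexI)
    show "\<forall>G. F \<subseteq> G \<longrightarrow> bd (restr F W) G = c G"
    proof (intro allI impI)
      fix G assume G: "F \<subseteq> G"
      have "bd W G = bd w G - (\<Sum>v\<in>Vi. bd (bd (u v)) G)"
        by (simp only: W_def[abs_def] bd_diff bd_sum)
      also have "\<dots> = c G" using w(2)[OF G] by (simp add: bd_bd)
      finally show "bd (restr F W) G = c G" using bd_restr[OF G, of W] by simp
    qed
    show "restr F W \<in> chains {G \<in> {G \<in> \<Gamma>. i \<notin> \<kappa> ` G}. F \<subseteq> G} (Suc p)"
    proof (rule chainsI)
      fix G assume "restr F W G \<noteq> 0"
      then have G: "F \<subseteq> G" "W G \<noteq> 0" by (auto simp: restr_def split: if_splits)
      then have "G \<in> \<Gamma>" "card G = Suc p" using chainsD[OF W] by auto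
      moreover have "i \<notin> \<kappa> ` G" using Wi G \<Gamma>V \<open>G \<in> \<Gamma>\<close> by blast
      ultimately show "G \<in> {G \<in> {G \<in> \<Gamma>. i \<notin> \<kappa> ` G}. F \<subseteq> G} \<and> card G = Suc p" using G by simp
    qed
  qed
qed

lemma CM_select_colours:
  fixes \<Gamma> :: "'v set set" and \<kappa> :: "'v \<Rightarrow> nat"
  assumes closed: "\<forall>G\<in>\<Gamma>. Pow G \<subseteq> \<Gamma>" and \<Gamma>V: "\<Gamma> \<subseteq> Pow V"
    and inj: "\<And>G. G \<in> \<Gamma> \<Longrightarrow> inj_on \<kappa> G" and colours: "\<And>G. G \<in> \<Gamma> \<Longrightarrow> \<kappa> ` G \<subseteq> S \<union> T"
    and fin: "finite S" "finite T" "S \<inter> T = {}"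
    and cm: "CM TYPE('k::comm_ring_1) \<Gamma> (card (S \<union> T))"
  shows "CM TYPE('k) {G \<in> \<Gamma>. \<kappa> ` G \<subseteq> S} (card S)"
  using fin(2,3) closed \<Gamma>V inj colours cm
proof (induction T arbitrary: \<Gamma> rule: finite_induct)
  case empty
  have "\<kappa> ` G \<subseteq> S" if "G \<in> \<Gamma>" for G using empty(5)[OF that] by simp
  then have "{G \<in> \<Gamma>. \<kappa> ` G \<subseteq> S} = \<Gamma>" by blast
  then show ?case using empty by simp
next
  case (insert i T)
  let ?\<Gamma> = "{G \<in> \<Gamma>. i \<notin> \<kappa> ` G}"
  have "card (S \<union> insert i T) = Suc (card (S \<union> T))" using insert.hyps insert.prems fin by auto
  then have "CM TYPE('k) ?\<Gamma> (card (S \<union> T))"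
    using CM_remove_colour[OF insert.prems(2-4)] insert.prems(6) by simp
  moreover have "\<forall>G\<in>?\<Gamma>. Pow G \<subseteq> ?\<Gamma>" using insert.prems(2) by auto
  moreover have "?\<Gamma> \<subseteq> Pow V" "\<And>G. G \<in> ?\<Gamma> \<Longrightarrow> inj_on \<kappa> G" "S \<inter> T = {}" using insert.prems by auto
  moreover have "\<kappa> ` G \<subseteq> S \<union> T" if "G \<in> ?\<Gamma>" for G using insert.prems(5)[of G] that by blast
  ultimately have "CM TYPE('k) {G \<in> ?\<Gamma>. \<kappa> ` G \<subseteq> S} (card S)" by (intro insert.IH)
  moreover have "{G \<in> ?\<Gamma>. \<kappa> ` G \<subseteq> S} = {G \<in> \<Gamma>. \<kappa> ` G \<subseteq> S}" using insert.prems(1) by auto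
  ultimately show ?case by simp
qed

end

section \<open>Coloured cycles\<close>

text \<open>Kept independent of the sphere: it also indexes the squarefree monomials in the
  variables of the polynomial ring, coloured by \<open>fst\<close>.\<close>

definition rainbow :: "'a set \<Rightarrow> ('a \<Rightarrow> nat) \<Rightarrow> nat set \<Rightarrow> 'a set set"
  where "rainbow V \<kappa> S = {G. G \<subseteq> V \<and> inj_on \<kappa> G \<and> \<kappa> ` G = S}"

text \<open>Vertices are ordered by colour first. The sign of a vertex relative to a rainbow set
  then depends on the colours only, which is what allows signs to be dropped in
  \<open>cyc\<close>.\<close>

locale coloured_order = vertex_order +
  fixes \<kappa> :: "'a \<Rightarrow> nat"
  assumes mono_\<kappa>: "\<And>u v. u \<in> V \<Longrightarrow> v \<in> V \<Longrightarrow> \<kappa> u < \<kappa> v \<Longrightarrow> e u < e v"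
begin

abbreviation transversals :: "nat set \<Rightarrow> 'a set set"
  where "transversals \<equiv> rainbow V \<kappa>"

definition colour_class :: "nat \<Rightarrow> 'a set"
  where "colour_class i = {v \<in> V. \<kappa> v = i}"

text \<open>On chains supported in one colour set, the simplicial boundary splits, up to sign, into one
  sum for each colour. The resulting signless equations describe the annihilator of the
  parameters \<open>\<theta>\<^sub>i\<close> under Macaulay duality.\<close>

definition cyc :: "'a set set \<Rightarrow> nat set \<Rightarrow> ('a set \<Rightarrow> 'k::comm_ring_1) set"
  where "cyc \<Gamma> S = {c. (\<forall>G. c G \<noteq> 0 \<longrightarrow> G \<in> \<Gamma> \<and> G \<in> transversals S) \<and>
    (\<forall>i\<in>S. \<forall>H\<in>transversals (S - {i}). (\<Sum>v\<in>colour_class i. c (insert v H)) = 0)}"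

definition csign :: "nat set \<Rightarrow> nat \<Rightarrow> 'k::comm_ring_1"
  where "csign S i = (- 1) ^ card {j \<in> S. j < i}"

lemma csign_square: "csign S i * (csign S i * x) = (x :: 'k::comm_ring_1)"
  by (simp add: csign_def flip: mult.assoc power_add mult_2)

lemma finite_colour_class [simp]: "finite (colour_class i)"
  using finite_V by (simp add: colour_class_def)

lemma finite_transversals [simp]: "finite (transversals S)"
  using finite_V by (auto simp: rainbow_def intro: finite_subset[of _ "Pow V"])

lemma transversals_insert:
  assumes "H \<in> transversals S" "v \<in> colour_class i" "i \<notin> S"
  shows "insert v H \<in> transversals (insert i S)" "v \<notin> H"
proof -
  show "v \<notin> H" using assms by (auto simp: rainbow_def colour_class_def)
  then show "insert v H \<in> transversals (insert i S)"
    using assms by (auto simp: rainbow_def colour_class_def)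
qed

lemma transversals_Diff:
  assumes "G \<in> transversals S" "v \<in> G"
  shows "G - {v} \<in> transversals (S - {\<kappa> v})"
  using assms by (auto simp: rainbow_def inj_on_def)

lemma transversals_colour: "G \<in> transversals S \<Longrightarrow> v \<in> G \<Longrightarrow> \<kappa> v \<in> S"
  by (auto simp: rainbow_def)

lemma transversals_card: "G \<in> transversals S \<Longrightarrow> card G = card S"
  using card_image[of \<kappa> G] by (auto simp: rainbow_def)

lemma transversals_empty: "transversals {} = {{}}"
  by (auto simp: rainbow_def)

lemma vsign_transversal:
  assumes "H \<in> transversals S" "v \<in> colour_class i" "i \<notin> S"
  shows "vsign v H = (csign S i :: 'k::comm_ring_1)"
proof -
  have less: "e u < e v \<longleftrightarrow> \<kappa> u < i" if "u \<in> H" for u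
  proof -
    have "u \<in> V" "v \<in> V" "\<kappa> v = i" using assms that by (auto simp: rainbow_def colour_class_def)
    moreover have "\<kappa> u \<noteq> i" using transversals_colour[OF assms(1) that] assms(3) by auto
    ultimately
    show ?thesis using mono_\<kappa>[of u v] mono_\<kappa>[of v u] by (metis linorder_neqE_nat order_less_asym)
  qed
  have "bij_betw \<kappa> {u \<in> H. e u < e v} {j \<in> S. j < i}"
    unfolding bij_betw_def
  proof
    show "inj_on \<kappa> {u \<in> H. e u < e v}" using assms(1) by (auto simp: rainbow_def inj_on_def)
    show "\<kappa> ` {u \<in> H. e u < e v} = {j \<in> S. j < i}" using assms(1) less by (auto simp: rainbow_def)
  qed
  then show ?thesis unfolding vsign_def csign_def by (simp add: bij_betw_same_card)
qed

lemma bd_transversal: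
  fixes c :: "'a set \<Rightarrow> 'k::comm_ring_1"
  assumes supp: "\<And>G. c G \<noteq> 0 \<Longrightarrow> G \<in> transversals (insert i S)" and i: "i \<notin> S" and H: "H \<in> transversals S"
  shows "bd c H = csign S i * (\<Sum>v\<in>colour_class i. c (insert v H))"
proof -
  have HV: "H \<subseteq> V" using H by (simp add: rainbow_def)
  have "(\<Sum>v\<in>V - H. vsign v H * c (insert v H)) = (\<Sum>v\<in>colour_class i. csign S i * c (insert v H))"
  proof (rule sum.mono_neutral_cong_right)
    show "colour_class i \<subseteq> V - H" using transversals_insert(2)[OF H _ i] by (auto simp: colour_class_def)
    show "\<forall>v\<in>V - H - colour_class i. vsign v H * c (insert v H) = 0"
    proof
      fix v assume v: "v \<in> V - H - colour_class i"
      have "c (insert v H) = 0"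
      proof (rule ccontr)
        assume "c (insert v H) \<noteq> 0"
        then have t: "insert v H \<in> transversals (insert i S)" by (rule supp)
        then have "\<kappa> ` insert v H = insert i S" by (simp add: rainbow_def)
        then have "insert (\<kappa> v) S = insert i S" using H by (simp add: rainbow_def)
        then have "i \<in> insert (\<kappa> v) S" by simp
        then have "\<kappa> v = i" using i by simp
        then show False using v by (auto simp: colour_class_def)
      qed
      then show "vsign v H * c (insert v H) = 0" by simp
    qed
    show "vsign v H * c (insert v H) = csign S i * c (insert v H)" if "v \<in> colour_class i" for v
    proof -
      have "vsign v H = (csign S i :: 'k)" by (rule vsign_transversal[OF H that i])
      then show ?thesis by simp
    qed
  qed (use finite_V in auto)
  then show ?thesis using HV by (simp add: bd_def sum_distrib_left)
qed

lemma bd_supp_transversal: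
  fixes c :: "'a set \<Rightarrow> 'k::comm_ring_1"
  assumes supp: "\<And>G. c G \<noteq> 0 \<Longrightarrow> G \<in> transversals S" and b: "bd c H \<noteq> 0"
  obtains i where "i \<in> S" "H \<in> transversals (S - {i})"
proof -
  obtain v where v: "v \<in> V - H" "c (insert v H) \<noteq> 0" using bd_supp[OF b] by blast
  then have t: "insert v H \<in> transversals S" by (intro supp)
  then have "insert v H - {v} \<in> transversals (S - {\<kappa> v})" by (rule transversals_Diff) simp
  moreover have "insert v H - {v} = H" using v by auto
  moreover have "\<kappa> v \<in> S" using t by (auto simp: rainbow_def)
  ultimately show ?thesis using that by simp
qed

lemma cyc_iff_bd:
  fixes c :: "'a set \<Rightarrow> 'k::comm_ring_1"
  assumes supp: "\<And>G. c G \<noteq> 0 \<Longrightarrow> G \<in> \<Gamma> \<and> G \<in> transversals S"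
  shows "c \<in> cyc \<Gamma> S \<longleftrightarrow> (\<forall>H. bd c H = 0)"
proof -
  have b: "bd c H = csign (S - {i}) i * (\<Sum>v\<in>colour_class i. c (insert v H))"
    if "i \<in> S" "H \<in> transversals (S - {i})" for i H
    by (rule bd_transversal) (use supp that in \<open>auto simp: insert_absorb\<close>)
  show ?thesis
  proof
    assume c: "c \<in> cyc \<Gamma> S"
    show "\<forall>H. bd c H = 0"
    proof (rule allI, rule ccontr)
      fix H assume n: "bd c H \<noteq> 0"
      then obtain i where i: "i \<in> S" "H \<in> transversals (S - {i})"
        using bd_supp_transversal[of c S H] supp by blast
      then have "(\<Sum>v\<in>colour_class i. c (insert v H)) = 0" using c unfolding cyc_def by blast
      then show False using n b[OF i] by simp
    qed
  next
    assume z: "\<forall>H. bd c H = 0"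
    have "(\<Sum>v\<in>colour_class i. c (insert v H)) = 0" if i: "i \<in> S" "H \<in> transversals (S - {i})" for i H
    proof -
      have "csign (S - {i}) i * (\<Sum>v\<in>colour_class i. c (insert v H)) = 0" using b[OF i] z by simp
      then have "csign (S - {i}) i * (csign (S - {i}) i * (\<Sum>v\<in>colour_class i. c (insert v H))) = 0"
        by (simp only: mult_zero_right)
      then show ?thesis by (simp only: csign_square)
    qed
    then show "c \<in> cyc \<Gamma> S" using supp unfolding cyc_def by blast
  qed
qed

text \<open>A cycle on the colours \<open>S\<close> lies one degree below the top for
  \<open>insert j S\<close>, so the Cohen--Macaulay condition at the empty face makes it a boundary.
  Counting vertices shows that the bounding chain lives on transversals.\<close>

lemma cyc_lift:
  fixes y :: "'a set \<Rightarrow> 'k::comm_ring_1"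
  assumes \<Gamma>V: "\<Gamma> \<subseteq> Pow V" and empty: "{} \<in> \<Gamma>" and inj: "\<forall>G\<in>\<Gamma>. inj_on \<kappa> G" and S: "finite S" "j \<notin> S"
    and cm: "CM TYPE('k) {G \<in> \<Gamma>. \<kappa> ` G \<subseteq> insert j S} (card (insert j S))" and y: "y \<in> cyc \<Gamma> S"
  obtains w where "\<And>G. w G \<noteq> 0 \<Longrightarrow> G \<in> \<Gamma> \<and> G \<in> transversals (insert j S)" "\<And>H. bd w H = y H"
proof -
  let ?\<Gamma> = "{G \<in> \<Gamma>. \<kappa> ` G \<subseteq> insert j S}"
  have supp: "G \<in> \<Gamma> \<and> G \<in> transversals S" if "y G \<noteq> 0" for G using y that by (auto simp: cyc_def)
  have by0: "bd y G = 0" for G using cyc_iff_bd[OF supp] y by blast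
  have "y \<in> chains {G \<in> ?\<Gamma>. {} \<subseteq> G} (card S)"
  proof (rule chainsI)
    fix G assume "y G \<noteq> 0"
    then have "G \<in> \<Gamma>" "G \<in> transversals S" using supp by auto
    then show "G \<in> {G \<in> ?\<Gamma>. {} \<subseteq> G} \<and> card G = card S"
      using transversals_card by (auto simp: rainbow_def)
  qed
  moreover have "card S < card (insert j S)" using S by simp
  ultimately obtain w where w: "w \<in> chains {G \<in> ?\<Gamma>. {} \<subseteq> G} (Suc (card S))" "\<And>G. {} \<subseteq> G \<Longrightarrow> bd w G = y G"
    using CM_D[OF cm, of "{}" "card S" y] empty by0 by auto
  show ?thesis
  proof (rule that)
    fix G assume "w G \<noteq> 0"
    then have G: "G \<in> \<Gamma>" "\<kappa> ` G \<subseteq> insert j S" "card G = card (insert j S)" using chainsD[OF w(1)] S by auto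
    have "card (\<kappa> ` G) = card (insert j S)" using card_image[OF inj[rule_format, OF G(1)]] G(3) by simp
    then have "\<kappa> ` G = insert j S" using card_subset_eq[OF _ G(2)] S by simp
    then show "G \<in> \<Gamma> \<and> G \<in> transversals (insert j S)" using G \<Gamma>V inj by (auto simp: rainbow_def)
  next
    show "bd w H = y H" for H using w(2) by simp
  qed
qed

text \<open>Write \<open>z\<close> as the boundary of \<open>w\<close>; up to sign it is the sum,
  over the vertices \<open>v\<close> of colour \<open>j\<close>, of the parts of \<open>w\<close>
  through \<open>v\<close>. Each part is a cycle on the colours \<open>S\<close> in the deletion of
  \<open>v\<close>. Filling it there closes the cone from \<open>v\<close> over it to a cycle on
  \<open>insert j S\<close> that has the same part through \<open>v\<close>.\<close>

lemma cyc_decompose: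
  fixes z :: "'a set \<Rightarrow> 'k::comm_ring_1"
  assumes \<Delta>V: "\<Delta> \<subseteq> Pow V" and closed: "\<forall>G\<in>\<Delta>. Pow G \<subseteq> \<Delta>" and empty: "{} \<in> \<Delta>"
    and inj: "\<forall>G\<in>\<Delta>. inj_on \<kappa> G" and S: "finite S" "j \<notin> S"
    and cm: "CM TYPE('k) {G \<in> \<Delta>. \<kappa> ` G \<subseteq> insert j S} (card (insert j S))"
    and cmv: "\<forall>v\<in>V. CM TYPE('k) {G \<in> deletion \<Delta> {v}. \<kappa> ` G \<subseteq> insert j S} (card (insert j S))"
    and z: "z \<in> cyc \<Delta> S"
  shows "\<exists>Z. (\<forall>v\<in>colour_class j. Z v \<in> cyc \<Delta> (insert j S)) \<and>
    (\<forall>G\<in>transversals S. z G = (\<Sum>v\<in>colour_class j. Z v (insert v G)))"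
proof -
  let ?j = "csign S j :: 'k"
  obtain w where w: "\<And>G. w G \<noteq> 0 \<Longrightarrow> G \<in> \<Delta> \<and> G \<in> transversals (insert j S)" "\<And>H. bd w H = z H"
    using cyc_lift[OF \<Delta>V empty inj S cm z] by blast
  have zS: "z G = 0" if "G \<notin> transversals S" for G using z that by (auto simp: cyc_def)
  have zw: "z G = ?j * (\<Sum>v\<in>colour_class j. w (insert v G))" if "G \<in> transversals S" for G
    using bd_transversal[of w j S G] w that S by metis
  have notS: "i \<in> S \<Longrightarrow> H \<in> transversals (insert j S - {i}) \<Longrightarrow> H \<notin> transversals S" for i H
    using S by (auto simp: rainbow_def)
  \<comment> \<open>A chain on \<open>insert j S\<close> whose boundary lives on the transversals of
    \<open>S\<close> satisfies the sum equations of all colours other than \<open>j\<close>.\<close>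
  have Dw: "(\<Sum>x\<in>colour_class i. w' (insert x H)) = 0"
    if w': "\<And>G. w' G \<noteq> 0 \<Longrightarrow> G \<in> transversals (insert j S)" "\<And>H. bd w' H = y H"
      and y: "\<And>G. G \<notin> transversals S \<Longrightarrow> y G = 0"
      and i: "i \<in> S" and H: "H \<in> transversals (insert j S - {i})" for w' y :: "'a set \<Rightarrow> 'k" and i H
  proof -
    have "bd w' H = csign (insert j S - {i}) i * (\<Sum>x\<in>colour_class i. w' (insert x H))"
      by (rule bd_transversal[OF _ _ H]) (use w' i in \<open>auto simp: insert_absorb\<close>)
    moreover have "bd w' H = 0" using w'(2) y notS[OF i H] by simp
    ultimately have "csign (insert j S - {i}) i * (csign (insert j S - {i}) i * (\<Sum>x\<in>colour_class i. w' (insert x H))) = 0"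
      by (metis mult_zero_right)
    then show ?thesis by (simp only: csign_square)
  qed
  have "\<exists>Zv. Zv \<in> cyc \<Delta> (insert j S) \<and> (\<forall>G\<in>transversals S. Zv (insert v G) = ?j * w (insert v G))"
    if v: "v \<in> colour_class j" for v
  proof -
    have vV: "v \<in> V" "\<kappa> v = j" using v by (auto simp: colour_class_def)
    define y where "y G = (if G \<in> transversals S then ?j * w (insert v G) else 0)" for G
    have y_supp: "G \<in> deletion \<Delta> {v} \<and> G \<in> transversals S" if "y G \<noteq> 0" for G
    proof -
      have G: "G \<in> transversals S" "w (insert v G) \<noteq> 0" using that by (auto simp: y_def split: if_splits)
      then have "insert v G \<in> \<Delta>" using w(1) by blast
      then have "G \<in> \<Delta>" using closed by blast
      then show ?thesis using G(1) transversals_insert(2)[OF G(1) v S(2)] by (simp add: deletion_def)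
    qed
    have "y \<in> cyc (deletion \<Delta> {v}) S"
    proof -
      have "(\<Sum>x\<in>colour_class i. y (insert x H)) = 0" if i: "i \<in> S" and H: "H \<in> transversals (S - {i})" for i H
      proof -
        have ne: "j \<notin> S - {i}" using S by simp
        have vH: "insert v H \<in> transversals (insert j S - {i})"
        proof -
          have "insert j (S - {i}) = insert j S - {i}" using i S by auto
          then show ?thesis using transversals_insert(1)[OF H v ne] by simp
        qed
        have "insert x H \<in> transversals S" if "x \<in> colour_class i" for x
          using transversals_insert(1)[OF H that] i by (simp add: insert_absorb)
        then have "(\<Sum>x\<in>colour_class i. y (insert x H)) = (\<Sum>x\<in>colour_class i. ?j * w (insert x (insert v H)))"
          by (intro sum.cong refl) (simp add: y_def insert_commute)
        also have "\<dots> = ?j * (\<Sum>x\<in>colour_class i. w (insert x (insert v H)))" by (simp add: sum_distrib_left)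
        also have "(\<Sum>x\<in>colour_class i. w (insert x (insert v H))) = 0"
          by (rule Dw[of w z]) (use w zS i vH in auto)
        finally show ?thesis by simp
      qed
      then show ?thesis using y_supp unfolding cyc_def by blast
    qed
    moreover have "deletion \<Delta> {v} \<subseteq> Pow V" "{} \<in> deletion \<Delta> {v}" "\<forall>G\<in>deletion \<Delta> {v}. inj_on \<kappa> G"
      using \<Delta>V empty inj by (auto simp: deletion_def)
    ultimately obtain w' where w': "\<And>G. w' G \<noteq> 0 \<Longrightarrow> G \<in> deletion \<Delta> {v} \<and> G \<in> transversals (insert j S)"
      "\<And>H. bd w' H = y H"
      using cyc_lift[OF _ _ _ S cmv[rule_format, OF vV(1)], of y] by blast
    have yS: "y G = 0" if "G \<notin> transversals S" for G using that by (simp add: y_def)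
    have yw': "y G = ?j * (\<Sum>x\<in>colour_class j. w' (insert x G))" if "G \<in> transversals S" for G
      using bd_transversal[of w' j S G] w' that S by metis
    have w'v: "w' G = 0" if "v \<in> G" for G using w'(1)[of G] that by (auto simp: deletion_def)
    \<comment> \<open>The cone from \<open>v\<close> over \<open>y\<close>, closed by the filling
      \<open>w'\<close>. Since \<open>w'\<close> avoids \<open>v\<close>, the values at sets through
      \<open>v\<close> come from \<open>y\<close> alone, and the equation at colour \<open>j\<close>
      says that \<open>w'\<close> fills \<open>y\<close>.\<close>
    define Zv where "Zv G = (if v \<in> G then y (G - {v}) else - ?j * w' G)" for G
    have "Zv \<in> cyc \<Delta> (insert j S)"
      unfolding cyc_def mem_Collect_eq
    proof (intro conjI allI impI ballI)
      fix G assume nz: "Zv G \<noteq> 0"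
      show "G \<in> \<Delta>" "G \<in> transversals (insert j S)"
      proof -
        have "G \<in> \<Delta> \<and> G \<in> transversals (insert j S)"
        proof (cases "v \<in> G")
          case True
          then have "w G \<noteq> 0" using nz by (auto simp: Zv_def y_def insert_absorb split: if_splits)
          then show ?thesis by (rule w(1))
        next
          case False
          then have "w' G \<noteq> 0" using nz by (auto simp: Zv_def)
          then show ?thesis using w'(1) by (auto simp: deletion_def)
        qed
        then show "G \<in> \<Delta>" "G \<in> transversals (insert j S)" by auto
      qed
    next
      fix i H assume i: "i \<in> insert j S" and H: "H \<in> transversals (insert j S - {i})"
      show "(\<Sum>x\<in>colour_class i. Zv (insert x H)) = 0"
      proof (cases "i = j")
        case True
        then have HS: "H \<in> transversals S" using H S by simp
        have vH: "v \<notin> H" using transversals_insert(2)[OF HS v S(2)] .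
        have "(\<Sum>x\<in>colour_class j. Zv (insert x H)) = Zv (insert v H) + (\<Sum>x\<in>colour_class j - {v}. Zv (insert x H))"
          using v by (intro sum.remove) auto
        also have "Zv (insert v H) = y H" using vH by (simp add: Zv_def)
        also have "(\<Sum>x\<in>colour_class j - {v}. Zv (insert x H)) = (\<Sum>x\<in>colour_class j - {v}. - ?j * w' (insert x H))"
          using vH by (intro sum.cong refl) (auto simp: Zv_def)
        also have "\<dots> = (\<Sum>x\<in>colour_class j. - ?j * w' (insert x H))"
          using v w'v by (intro sum.mono_neutral_left) auto
        also have "\<dots> = - y H" unfolding yw'[OF HS] by (simp add: sum_distrib_left sum_negf)
        finally show ?thesis using True by simp
      next
        case False
        then have iS: "i \<in> S" using i by simp
        show ?thesis
        proof (cases "v \<in> H")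
          case True
          define H' where "H' = H - {v}"
          have H': "H' \<in> transversals (S - {i})"
          proof -
            have "insert j S - {i} - {\<kappa> v} = S - {i}" using vV S by auto
            then show ?thesis using transversals_Diff[OF H True] by (simp add: H'_def)
          qed
          have "(\<Sum>x\<in>colour_class i. Zv (insert x H)) = (\<Sum>x\<in>colour_class i. y (insert x H'))"
          proof (rule sum.cong[OF refl])
            fix x assume "x \<in> colour_class i"
            then have "x \<noteq> v" using vV False by (auto simp: colour_class_def)
            then have "insert x H - {v} = insert x H'" by (auto simp: H'_def)
            then show "Zv (insert x H) = y (insert x H')" using True by (simp add: Zv_def)
          qed
          also have "\<dots> = 0" using \<open>y \<in> cyc (deletion \<Delta> {v}) S\<close> iS H' unfolding cyc_def by blast
          finally show ?thesis .
        next
          case vH: False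
          have "(\<Sum>x\<in>colour_class i. Zv (insert x H)) = (\<Sum>x\<in>colour_class i. - ?j * w' (insert x H))"
          proof (rule sum.cong[OF refl])
            fix x assume "x \<in> colour_class i"
            then have "x \<noteq> v" using vV False by (auto simp: colour_class_def)
            then show "Zv (insert x H) = - ?j * w' (insert x H)" using vH by (simp add: Zv_def)
          qed
          also have "\<dots> = - ?j * (\<Sum>x\<in>colour_class i. w' (insert x H))" by (simp add: sum_distrib_left sum_negf)
          also have "(\<Sum>x\<in>colour_class i. w' (insert x H)) = 0"
            by (rule Dw[of w' y]) (use w' yS iS H in auto)
          finally show ?thesis by simp
        qed
      qed
    qed
    moreover have "Zv (insert v G) = ?j * w (insert v G)" if "G \<in> transversals S" for G
      using transversals_insert(2)[OF that v S(2)] that by (simp add: Zv_def y_def)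
    ultimately show ?thesis by blast
  qed
  then have "\<forall>v\<in>colour_class j. \<exists>Zv. Zv \<in> cyc \<Delta> (insert j S) \<and> (\<forall>G\<in>transversals S. Zv (insert v G) = ?j * w (insert v G))"
    by blast
  from bchoice[OF this] obtain Z where Z: "\<And>v. v \<in> colour_class j \<Longrightarrow> Z v \<in> cyc \<Delta> (insert j S)"
    "\<And>v G. v \<in> colour_class j \<Longrightarrow> G \<in> transversals S \<Longrightarrow> Z v (insert v G) = ?j * w (insert v G)" by blast
  show ?thesis
  proof (intro exI[of _ Z] conjI ballI)
    show "Z v \<in> cyc \<Delta> (insert j S)" if "v \<in> colour_class j" for v using Z(1) that .
    show "z G = (\<Sum>v\<in>colour_class j. Z v (insert v G))" if "G \<in> transversals S" for G
      using Z(2)[OF _ that] zw[OF that] by (simp add: sum_distrib_left)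
  qed
qed

text \<open>The dual form of the assertion that contractions of \<phi> span the
  \<open>S\<close>-cycles. By \<open>cyc_decompose\<close> a cycle is a sum of contractions of
  cycles with one colour more; once all colours are present, only multiples of \<phi>
  remain.\<close>

lemma cyc_orthogonal:
  fixes \<phi> c :: "'a set \<Rightarrow> 'k::comm_ring_1"
  assumes \<Delta>V: "\<Delta> \<subseteq> Pow V" and closed: "\<forall>G\<in>\<Delta>. Pow G \<subseteq> \<Delta>" and empty: "{} \<in> \<Delta>"
    and inj: "\<forall>G\<in>\<Delta>. inj_on \<kappa> G" and C: "finite C"
    and cm: "\<And>S. S \<subseteq> C \<Longrightarrow> CM TYPE('k) {G \<in> \<Delta>. \<kappa> ` G \<subseteq> S} (card S)"
    and cmv: "\<And>v S. v \<in> V \<Longrightarrow> S \<subseteq> C \<Longrightarrow> CM TYPE('k) {G \<in> deletion \<Delta> {v}. \<kappa> ` G \<subseteq> S} (card S)"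
    and \<phi>: "\<And>z. z \<in> cyc \<Delta> C \<Longrightarrow> \<exists>a. \<forall>G. z G = a * \<phi> G"
    and S: "S \<subseteq> C" and c: "\<And>G'. G' \<in> transversals (C - S) \<Longrightarrow> (\<Sum>G\<in>transversals S. c G * \<phi> (G \<union> G')) = 0"
    and z: "z \<in> cyc \<Delta> S"
  shows "(\<Sum>G\<in>transversals S. c G * z G) = 0"
proof -
  \<comment> \<open>Generalized for the induction: \<open>T\<close> is the set of colours still
    missing, and \<open>G'\<close> records the vertices of the colours added to \<open>S\<close> so
    far.\<close>
  have "(\<Sum>G\<in>transversals S. c G * z (G \<union> G')) = 0"
    if "S \<subseteq> U" "U \<union> T = C" "U \<inter> T = {}" "z \<in> cyc \<Delta> U" "G' \<in> transversals (U - S)" "finite T" for U T z G'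
    using that(6,1-5)
  proof (induction T arbitrary: U z G' rule: finite_induct)
    case empty
    then have "U = C" by simp
    then obtain a where a: "\<And>G. z G = a * \<phi> G" using \<phi> empty by blast
    have "(\<Sum>G\<in>transversals S. c G * z (G \<union> G')) = a * (\<Sum>G\<in>transversals S. c G * \<phi> (G \<union> G'))"
      by (simp add: a sum_distrib_left mult.left_commute)
    then show ?case using c[of G'] empty \<open>U = C\<close> by simp
  next
    case (insert j T)
    have jU: "j \<notin> U" and UC: "insert j U \<subseteq> C" using insert.prems by auto
    have finU: "finite U" using finite_subset[OF UC C] by simp
    have cmvU: "\<forall>v\<in>V. CM TYPE('k) {G \<in> deletion \<Delta> {v}. \<kappa> ` G \<subseteq> insert j U} (card (insert j U))"
      using cmv UC by blast
    obtain Z where Z: "\<And>v. v \<in> colour_class j \<Longrightarrow> Z v \<in> cyc \<Delta> (insert j U)"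
      "\<And>G. G \<in> transversals U \<Longrightarrow> z G = (\<Sum>v\<in>colour_class j. Z v (insert v G))"
      using cyc_decompose[OF \<Delta>V closed assms(3) inj finU jU cm[OF UC] cmvU insert.prems(4)] by blast
    have GG: "G \<union> G' \<in> transversals U" if "G \<in> transversals S" for G
    proof -
      have "\<kappa> ` G \<inter> \<kappa> ` G' = {}" using that insert.prems(5) by (auto simp: rainbow_def)
      then have "inj_on \<kappa> (G \<union> G')"
        using that insert.prems(5) by (auto simp: rainbow_def inj_on_Un)
      then show ?thesis using that insert.prems(1,5) by (auto simp: rainbow_def image_Un)
    qed
    have "(\<Sum>G\<in>transversals S. c G * z (G \<union> G'))
        = (\<Sum>G\<in>transversals S. \<Sum>v\<in>colour_class j. c G * Z v (G \<union> insert v G'))"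
      using Z(2)[OF GG] by (intro sum.cong refl) (simp add: sum_distrib_left)
    also have "\<dots> = (\<Sum>v\<in>colour_class j. \<Sum>G\<in>transversals S. c G * Z v (G \<union> insert v G'))"
      by (rule sum.swap)
    also have "\<dots> = (\<Sum>v\<in>colour_class j. 0)"
    proof (rule sum.cong[OF refl])
      fix v assume v: "v \<in> colour_class j"
      show "(\<Sum>G\<in>transversals S. c G * Z v (G \<union> insert v G')) = 0"
      proof (rule insert.IH)
        show "Z v \<in> cyc \<Delta> (insert j U)" using Z(1) v .
        have "insert j (U - S) = insert j U - S" using jU insert.prems(1) by auto
        then show "insert v G' \<in> transversals (insert j U - S)"
          using transversals_insert(1)[OF insert.prems(5) v] jU by simp
      qed (use insert.prems insert.hyps in auto)
    qed
    finally show ?case by simp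
  qed
  from this[of S "C - S" z "{}"] show ?thesis
    using S C z by (simp add: transversals_empty Un_absorb1 Un_Diff_cancel)
qed

text \<open>The cross-polytope cycle: expand the product, over the colours \<open>i\<close>, of the
  vertex of \<open>G0\<close> minus \<open>\<beta> i\<close>. The sign counts the factors taken from
  \<beta>, and the sum over a colour class has just two possible terms, of opposite sign.\<close>

lemma transversal_tensor_cyc:
  fixes \<beta> :: "nat \<Rightarrow> 'a"
  assumes S: "finite S" and all: "transversals S \<subseteq> \<Delta>"
    and \<beta>: "\<And>i. i \<in> S \<Longrightarrow> \<beta> i \<in> colour_class i" and G0: "G0 \<in> transversals S" "G0 \<inter> \<beta> ` S = {}"
  shows "(\<lambda>G. if G \<in> transversals S \<and> G \<subseteq> G0 \<union> \<beta> ` S then (- 1) ^ card (G - G0) else 0 :: 'k::comm_ring_1) \<in> cyc \<Delta> S"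
    (is "?z \<in> _")
  unfolding cyc_def mem_Collect_eq
proof (intro conjI allI impI ballI)
  show "G \<in> \<Delta>" "G \<in> transversals S" if "?z G \<noteq> 0" for G using that all by (auto split: if_splits)
next
  fix i H assume i: "i \<in> S" and H: "H \<in> transversals (S - {i})"
  obtain g where g: "g \<in> G0" "\<kappa> g = i" using G0 i by (auto simp: rainbow_def)
  have gc: "g \<in> colour_class i" using g G0 by (auto simp: rainbow_def colour_class_def)
  have ne: "g \<noteq> \<beta> i" using g G0 i by auto
  have only: "x = g \<or> x = \<beta> i" if "x \<in> colour_class i" "x \<in> G0 \<union> \<beta> ` S" for x
  proof -
    have "x = g" if "x \<in> G0"
      using inj_onD[of \<kappa> G0 x g] G0 g \<open>x \<in> colour_class i\<close> that by (auto simp: rainbow_def colour_class_def)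
    moreover have "x = \<beta> i" if "x \<in> \<beta> ` S"
      using that \<beta> \<open>x \<in> colour_class i\<close> by (auto simp: colour_class_def)
    ultimately show ?thesis using that by blast
  qed
  have tr: "insert x H \<in> transversals S" "x \<notin> H" if "x \<in> colour_class i" for x
    using transversals_insert[OF H that] i by (simp_all add: insert_absorb)
  have "(\<Sum>x\<in>colour_class i. ?z (insert x H)) = (\<Sum>x\<in>{g, \<beta> i}. ?z (insert x H))"
    using only gc \<beta>[OF i] by (intro sum.mono_neutral_right) auto
  also have "\<dots> = ?z (insert g H) + ?z (insert (\<beta> i) H)" using ne by simp
  also have "\<dots> = 0"
  proof (cases "H \<subseteq> G0 \<union> \<beta> ` S")
    case True
    have finH: "finite H" using H finite_V finite_subset by (auto simp: rainbow_def)
    have "insert g H - G0 = H - G0" using g by auto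
    moreover have "insert (\<beta> i) H - G0 = insert (\<beta> i) (H - G0)" using G0 i by auto
    moreover have "card (insert (\<beta> i) (H - G0)) = Suc (card (H - G0))"
      using finH tr(2)[OF \<beta>[OF i]] by simp
    ultimately show ?thesis using True tr(1)[OF gc] tr(1)[OF \<beta>[OF i]] g i by simp
  qed simp
  finally show "(\<Sum>x\<in>colour_class i. ?z (insert x H)) = 0" .
qed

text \<open>The equation of \<phi> at colour \<open>i\<close> expresses the pairing with a set
  through \<open>\<beta> i\<close> by pairings with sets that have another vertex of that colour
  instead. Induction on the number of vertices from \<beta> reduces everything to sets that avoid
  them.\<close>

lemma extend_orthogonality:
  fixes \<phi> c :: "'a set \<Rightarrow> 'k::comm_ring_1"
  assumes \<phi>: "\<phi> \<in> cyc \<Delta> C" and C: "finite C" and S: "S \<subseteq> C" and \<beta>: "\<And>i. i \<in> C \<Longrightarrow> \<beta> i \<in> colour_class i"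
    and c: "\<And>G'. G' \<in> transversals (C - S) \<Longrightarrow> G' \<inter> \<beta> ` C = {} \<Longrightarrow> (\<Sum>G\<in>transversals S. c G * \<phi> (G \<union> G')) = 0"
    and G': "G' \<in> transversals (C - S)"
  shows "(\<Sum>G\<in>transversals S. c G * \<phi> (G \<union> G')) = 0"
  using G'
proof (induction "card (G' \<inter> \<beta> ` C)" arbitrary: G' rule: less_induct)
  case less
  show ?case
  proof (cases "G' \<inter> \<beta> ` C = {}")
    case True
    then show ?thesis using c less.prems by blast
  next
    case False
    then obtain i where i: "i \<in> C" "\<beta> i \<in> G'" by auto
    have \<kappa>i: "\<kappa> (\<beta> i) = i" using \<beta>[OF i(1)] by (simp add: colour_class_def)
    define H where "H = G' - {\<beta> i}"
    have iS: "i \<in> C - S" using transversals_colour[OF less.prems i(2)] \<kappa>i by simp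
    have H: "H \<in> transversals (C - S - {i})" using transversals_Diff[OF less.prems i(2)] \<kappa>i by (simp add: H_def)
    have G'H: "G' = insert (\<beta> i) H" using i by (auto simp: H_def)
    have tr: "insert x H \<in> transversals (C - S)" if "x \<in> colour_class i" for x
      using transversals_insert(1)[OF H that] iS by (simp add: insert_absorb)
    have zero: "(\<Sum>G\<in>transversals S. c G * \<phi> (G \<union> insert x H)) = 0" if x: "x \<in> colour_class i - {\<beta> i}" for x
    proof (rule less.hyps)
      have "x \<notin> \<beta> ` C" using x \<beta> by (auto simp: colour_class_def)
      then have "insert x H \<inter> \<beta> ` C = G' \<inter> \<beta> ` C - {\<beta> i}" by (auto simp: H_def)
      moreover have "finite (G' \<inter> \<beta> ` C)" using C by simp
      ultimately show "card (insert x H \<inter> \<beta> ` C) < card (G' \<inter> \<beta> ` C)" using i by (simp add: card_Diff1_less del: card_Diff_insert card_Diff_singleton)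
      show "insert x H \<in> transversals (C - S)" using tr x by blast
    qed
    have sum0: "(\<Sum>x\<in>colour_class i. \<phi> (G \<union> insert x H)) = 0" if G: "G \<in> transversals S" for G
    proof -
      have "\<kappa> ` G \<inter> \<kappa> ` H = {}" using G H by (auto simp: rainbow_def)
      then have "inj_on \<kappa> (G \<union> H)" using G H by (auto simp: rainbow_def inj_on_Un)
      moreover have "S \<union> (C - S - {i}) = C - {i}" using S iS by auto
      ultimately have "G \<union> H \<in> transversals (C - {i})" using G H by (auto simp: rainbow_def image_Un)
      then have "(\<Sum>x\<in>colour_class i. \<phi> (insert x (G \<union> H))) = 0" using \<phi> i(1) unfolding cyc_def by blast
      then show ?thesis by simp
    qed
    have "(\<Sum>x\<in>colour_class i. \<Sum>G\<in>transversals S. c G * \<phi> (G \<union> insert x H))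
       = (\<Sum>G\<in>transversals S. \<Sum>x\<in>colour_class i. c G * \<phi> (G \<union> insert x H))"
      by (rule sum.swap)
    also have "\<dots> = 0" using sum0 by (simp flip: sum_distrib_left)
    finally have "(\<Sum>x\<in>colour_class i. \<Sum>G\<in>transversals S. c G * \<phi> (G \<union> insert x H)) = 0" .
    moreover have "(\<Sum>x\<in>colour_class i. \<Sum>G\<in>transversals S. c G * \<phi> (G \<union> insert x H))
      = (\<Sum>G\<in>transversals S. c G * \<phi> (G \<union> insert (\<beta> i) H))
        + (\<Sum>x\<in>colour_class i - {\<beta> i}. \<Sum>G\<in>transversals S. c G * \<phi> (G \<union> insert x H))"
      using \<beta>[OF i(1)] by (intro sum.remove) auto
    ultimately show ?thesis using zero G'H by simp
  qed
qed

end

section \<open>Top cycles of a balanced sphere and the pairing they define\<close>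

lemma exists_coloured_order:
  assumes "finite V"
  obtains e where "coloured_order e V (\<kappa> :: 'v \<Rightarrow> nat)"
proof -
  obtain e0 :: "'v \<Rightarrow> nat" and N where e0: "e0 ` V = {i. i < N}" "inj_on e0 V"
    using finite_imp_inj_to_nat_seg[OF assms] by blast
  have N: "e0 v < N" if "v \<in> V" for v using e0(1) that by blast
  \<comment> \<open>A lexicographic order: \<open>e0 v < N\<close> on \<open>V\<close>, so the
    colour decides first.\<close>
  let ?e = "\<lambda>v. \<kappa> v * N + e0 v"
  have mono: "?e u < ?e v" if "u \<in> V" "v \<in> V" "\<kappa> u < \<kappa> v" for u v
  proof -
    have "?e u < \<kappa> u * N + N" using N[OF that(1)] by simp
    also have "\<dots> = Suc (\<kappa> u) * N" by simp
    also have "\<dots> \<le> \<kappa> v * N" using that(3) by (intro mult_le_mono1) simp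
    finally show ?thesis by simp
  qed
  have "inj_on ?e V"
  proof (rule inj_onI)
    fix u v assume uv: "u \<in> V" "v \<in> V" "?e u = ?e v"
    then have "\<kappa> u = \<kappa> v" using mono[of u v] mono[of v u] by (metis linorder_neqE_nat nat_neq_iff)
    then have "e0 u = e0 v" using uv(3) by simp
    then show "u = v" using e0(2) uv by (auto dest: inj_onD)
  qed
  then have "coloured_order ?e V \<kappa>" using assms mono by unfold_locales auto
  then show ?thesis by (rule that)
qed

context coloured_order
begin

text \<open>A top cycle with coefficient 0 at \<open>F\<close> lies in the deletion of
  \<open>F\<close> and bounds there, but no face has more than \<open>card C\<close> vertices. One
  coefficient thus determines a top cycle.\<close>

lemma top_cycle_zero:
  fixes y :: "'a set \<Rightarrow> 'k::comm_ring_1"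
  assumes y: "y \<in> cyc \<Delta> C" and F: "F \<in> \<Delta>" "card F = card C" "y F = 0"
    and top: "\<And>G. G \<in> \<Delta> \<Longrightarrow> card G \<le> card C" and fin: "\<And>G. G \<in> \<Delta> \<Longrightarrow> finite G"
    and ac: "acyclic_over TYPE('k) (deletion \<Delta> F)"
  shows "y G = 0"
proof -
  have supp: "G \<in> \<Delta> \<and> G \<in> transversals C" if "y G \<noteq> 0" for G using y that by (auto simp: cyc_def)
  have b: "bd y G = 0" for G using cyc_iff_bd[OF supp] y by blast
  have "y \<in> chains (deletion \<Delta> F) (card C)"
  proof (rule chainsI)
    fix G assume n: "y G \<noteq> 0"
    then have G: "G \<in> \<Delta>" "card G = card C" using supp transversals_card by auto
    have "\<not> F \<subseteq> G"
    proof
      assume "F \<subseteq> G"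
      then have "F = G" using card_subset_eq[OF fin[OF G(1)]] F(2) G(2) by simp
      then show False using n F(3) by simp
    qed
    then show "G \<in> deletion \<Delta> F \<and> card G = card C" using G by (simp add: deletion_def)
  qed
  then obtain u where u: "u \<in> chains (deletion \<Delta> F) (Suc (card C))" "\<And>G. bd u G = y G"
    using acyclic_overD[OF ac _ b] by blast
  have "u G = 0" for G
  proof (rule ccontr)
    assume "u G \<noteq> 0"
    then have "G \<in> \<Delta>" "card G = Suc (card C)" using chainsD[OF u(1)] by (auto simp: deletion_def)
    then show False using top[of G] by simp
  qed
  then have "u = (\<lambda>G. 0)" by (rule ext)
  then show ?thesis using u(2)[of G] by simp
qed

end

text \<open>Nondegeneracy of the pairing defined by a fundamental cycle \<open>\<phi>\<close>, after one vertex
  \<open>\<beta> i\<close> of each colour has been eliminated by means of \<open>\<theta>\<^sub>i\<close>.\<close>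

lemma sphere_nondegenerate_form:
  fixes \<Delta> :: "'v set set" and \<kappa> :: "'v \<Rightarrow> nat"
  assumes sphere: "simplicial_sphere \<Delta>" and dim: "complex_dim \<Delta> = int d - 1" and d: "d > 0"
    and col: "proper_coloring d \<Delta> \<kappa>" and \<beta>: "\<And>i. i \<in> {1..d} \<Longrightarrow> \<beta> i \<in> \<Union>\<Delta> \<and> \<kappa> (\<beta> i) = i"
  obtains \<phi> :: "'v set \<Rightarrow> 'k::field" where
    "\<And>S c G. S \<subseteq> {1..d} \<Longrightarrow> rainbow (\<Union>\<Delta>) \<kappa> S \<subseteq> \<Delta> \<Longrightarrow>
      (\<And>G'. G' \<in> rainbow (\<Union>\<Delta>) \<kappa> ({1..d} - S) \<Longrightarrow> G' \<inter> \<beta> ` {1..d} = {} \<Longrightarrow>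
        (\<Sum>G\<in>rainbow (\<Union>\<Delta>) \<kappa> S. c G * \<phi> (G \<union> G')) = 0) \<Longrightarrow>
      (\<And>G. G \<in> rainbow (\<Union>\<Delta>) \<kappa> S \<Longrightarrow> G \<inter> \<beta> ` S \<noteq> {} \<Longrightarrow> c G = 0) \<Longrightarrow>
      G \<in> rainbow (\<Union>\<Delta>) \<kappa> S \<Longrightarrow> c G = 0"
proof -
  have cx: "simplicial_complex \<Delta>" using sphere by (simp add: simplicial_sphere_def)
  then have fin\<Delta>: "finite \<Delta>" "{} \<in> \<Delta>" and fin: "\<And>G. G \<in> \<Delta> \<Longrightarrow> finite G" and closed: "\<forall>G\<in>\<Delta>. Pow G \<subseteq> \<Delta>"
    by (auto simp: simplicial_complex_def)
  define V where "V = \<Union>\<Delta>"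
  have finV: "finite V" using fin\<Delta> fin by (auto simp: V_def)
  obtain e where e: "coloured_order e V \<kappa>" using exists_coloured_order[OF finV] .
  interpret coloured_order e V \<kappa> by (rule e)
  define C where "C = {1..d}"
  have C: "finite C" "card C = d" by (auto simp: C_def)
  have \<Delta>V: "\<Delta> \<subseteq> Pow V" by (auto simp: V_def)
  have inj: "\<forall>G\<in>\<Delta>. inj_on \<kappa> G"
  proof (intro ballI inj_onI, rule ccontr)
    fix G u v assume G: "G \<in> \<Delta>" "u \<in> G" "v \<in> G" "\<kappa> u = \<kappa> v" "u \<noteq> v"
    then have "{u, v} \<in> Pow G" by simp
    then have "{u, v} \<in> \<Delta>" by (rule subsetD[OF bspec[OF closed G(1)]])
    then show False using G col by (auto simp: proper_coloring_def)
  qed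
  have colours: "\<kappa> ` G \<subseteq> C" if "G \<in> \<Delta>" for G using col that by (auto simp: proper_coloring_def C_def)
  have Max: "Max (card ` \<Delta>) = d" using dim by (simp add: complex_dim_def)
  then have top: "card G \<le> card C" if "G \<in> \<Delta>" for G using that fin\<Delta> C Max_ge[of "card ` \<Delta>" "card G"] by auto
  have "d \<in> card ` \<Delta>" using Max_in[of "card ` \<Delta>"] Max fin\<Delta> by auto
  then obtain F where F: "F \<in> \<Delta>" "card F = d" by auto
  have "F \<noteq> {}" using F d by auto
  have ac: "acyclic_over TYPE('k) (deletion \<Delta> G)" if "G \<in> \<Delta>" "G \<noteq> {}" for G
    by (rule deletion_acyclic[OF sphere _ that]) (simp add: V_def)
  have cm: "CM TYPE('k) {G \<in> \<Delta>. \<kappa> ` G \<subseteq> S} (card S)" if S: "S \<subseteq> C" for S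
  proof (rule CM_select_colours[where T = "C - S"])
    have "CM TYPE('k) \<Delta> d" using closed \<Delta>V ac F by (rule CM_of_acyclic_deletions)
    then show "CM TYPE('k) \<Delta> (card (S \<union> (C - S)))" using C S by (simp add: Un_absorb1)
    show "\<kappa> ` G \<subseteq> S \<union> (C - S)" if "G \<in> \<Delta>" for G using colours[OF that] by blast
  qed (use closed \<Delta>V inj C finite_subset[OF S C(1)] in auto)
  have cmv: "CM TYPE('k) {G \<in> deletion \<Delta> {v}. \<kappa> ` G \<subseteq> S} (card S)" if v: "v \<in> V" and S: "S \<subseteq> C" for S v
  proof (rule CM_select_colours[where T = "C - S"])
    have "{v} \<in> \<Delta>" using v closed by (auto simp: V_def)
    with closed \<Delta>V ac F have "CM TYPE('k) (deletion \<Delta> {v}) d" by (rule CM_vertex_deletion)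
    then show "CM TYPE('k) (deletion \<Delta> {v}) (card (S \<union> (C - S)))" using C S by (simp add: Un_absorb1)
    show "\<kappa> ` G \<subseteq> S \<union> (C - S)" if "G \<in> deletion \<Delta> {v}" for G
      using colours[of G] that by (auto simp: deletion_def)
    show "\<forall>G\<in>deletion \<Delta> {v}. Pow G \<subseteq> deletion \<Delta> {v}" using closed by (auto simp: deletion_def)
    show "deletion \<Delta> {v} \<subseteq> Pow V" using \<Delta>V by (auto simp: deletion_def)
    show "inj_on \<kappa> G" if "G \<in> deletion \<Delta> {v}" for G using inj that by (auto simp: deletion_def)
  qed (use C finite_subset[OF S C(1)] in auto)
  have zero: "y G = 0" if "y \<in> cyc \<Delta> C" "y F = 0" for y :: "'v set \<Rightarrow> 'k" and G
    using top_cycle_zero[OF that(1) F(1) _ that(2) top fin ac[OF F(1) \<open>F \<noteq> {}\<close>]] F(2) C(2) by simp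
  have "\<exists>\<phi>\<in>cyc \<Delta> C. \<forall>z\<in>cyc \<Delta> C. \<exists>a :: 'k. \<forall>G. z G = a * \<phi> G"
  proof (cases "\<exists>\<phi>\<in>cyc \<Delta> C. \<phi> F \<noteq> (0::'k)")
    case True
    then obtain \<phi> where \<phi>: "\<phi> \<in> cyc \<Delta> C" "\<phi> F \<noteq> (0::'k)" by blast
    have "\<forall>G. z G = z F / \<phi> F * \<phi> G" if z: "z \<in> cyc \<Delta> C" for z
    proof
      fix G
      let ?a = "z F / \<phi> F"
      let ?y = "\<lambda>G. z G - ?a * \<phi> G"
      have "?y \<in> cyc \<Delta> C"
        unfolding cyc_def mem_Collect_eq
      proof (intro conjI allI impI ballI)
        fix G assume "?y G \<noteq> 0"
        then have "z G \<noteq> 0 \<or> \<phi> G \<noteq> 0" by auto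
        then show "G \<in> \<Delta>" "G \<in> transversals C" using z \<phi>(1) unfolding cyc_def by blast+
      next
        fix i H assume iH: "i \<in> C" "H \<in> transversals (C - {i})"
        then have "(\<Sum>v\<in>colour_class i. z (insert v H)) = 0" "(\<Sum>v\<in>colour_class i. \<phi> (insert v H)) = 0"
          using z \<phi>(1) unfolding cyc_def by blast+
        then show "(\<Sum>v\<in>colour_class i. ?y (insert v H)) = 0"
          by (simp only: sum_subtractf sum_distrib_left[symmetric] mult_zero_right diff_self)
      qed
      then have "?y G = 0" by (rule zero) (use \<phi> in simp)
      then show "z G = ?a * \<phi> G" by simp
    qed
    then show ?thesis using \<phi>(1) by blast
  next
    case False
    have "(\<lambda>G. 0 :: 'k) \<in> cyc \<Delta> C" by (simp add: cyc_def)
    moreover have "z G = 0" if "z \<in> cyc \<Delta> C" for z :: "'v set \<Rightarrow> 'k" and G using zero[OF that] False that by auto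
    ultimately show ?thesis by (intro bexI[of _ "\<lambda>G. 0"] ballI exI[of _ 0]) auto
  qed
  then obtain \<phi> where \<phi>: "\<phi> \<in> cyc \<Delta> C" "\<And>z. z \<in> cyc \<Delta> C \<Longrightarrow> \<exists>a :: 'k. \<forall>G. z G = a * \<phi> G" by blast
  have \<beta>c: "\<beta> i \<in> colour_class i" if "i \<in> C" for i
    unfolding colour_class_def using \<beta>[of i] that by (auto simp: V_def C_def)
  show ?thesis
  proof (rule that[of \<phi>])
    fix S c G0
    assume S: "S \<subseteq> {1..d}" and full: "rainbow (\<Union>\<Delta>) \<kappa> S \<subseteq> \<Delta>"
      and orth: "\<And>G'. G' \<in> rainbow (\<Union>\<Delta>) \<kappa> ({1..d} - S) \<Longrightarrow> G' \<inter> \<beta> ` {1..d} = {} \<Longrightarrow>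
        (\<Sum>G\<in>rainbow (\<Union>\<Delta>) \<kappa> S. c G * \<phi> (G \<union> G')) = 0"
      and c0: "\<And>G. G \<in> rainbow (\<Union>\<Delta>) \<kappa> S \<Longrightarrow> G \<inter> \<beta> ` S \<noteq> {} \<Longrightarrow> c G = 0"
      and G0: "G0 \<in> rainbow (\<Union>\<Delta>) \<kappa> S"
    note [folded V_def C_def] = this
    have SC: "S \<subseteq> C" using S by (simp add: C_def)
    have finS: "finite S" using finite_subset[OF SC C(1)] .
    show "c G0 = 0"
    proof (cases "G0 \<inter> \<beta> ` S = {}")
      case False
      then show ?thesis using c0 G0 by blast
    next
      case True
      \<comment> \<open>Transversals in the support other than \<open>G0\<close> meet \<beta>, where
        \<open>c\<close> vanishes, so pairing with this cycle isolates \<open>c G0\<close>.\<close>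
      let ?z = "\<lambda>G. if G \<in> transversals S \<and> G \<subseteq> G0 \<union> \<beta> ` S then (- 1) ^ card (G - G0) else 0 :: 'k"
      have G0': "G0 \<in> transversals S" using G0 by (simp add: V_def)
      have z: "?z \<in> cyc \<Delta> S"
        by (rule transversal_tensor_cyc[OF finS _ _ G0' True]) (use full \<beta>c SC in \<open>auto simp: V_def\<close>)
      have o: "(\<Sum>G\<in>transversals S. c G * \<phi> (G \<union> G')) = 0" if "G' \<in> transversals (C - S)" for G'
        by (rule extend_orthogonality[OF \<phi>(1) C(1) SC \<beta>c _ that]) (use orth in \<open>auto simp: V_def C_def\<close>)
      have "(\<Sum>G\<in>transversals S. c G * ?z G) = 0"
        by (rule cyc_orthogonal[OF \<Delta>V closed fin\<Delta>(2) inj C(1) cm cmv \<phi>(2) SC o z])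
      moreover have "(\<Sum>G\<in>transversals S. c G * ?z G) = (\<Sum>G\<in>transversals S. if G = G0 then c G0 else 0)"
      proof (rule sum.cong[OF refl])
        fix G assume G: "G \<in> transversals S"
        show "c G * ?z G = (if G = G0 then c G0 else 0)"
        proof (cases "G = G0")
          case True
          then show ?thesis using G by simp
        next
          case False
          have "c G = 0" if sub: "G \<subseteq> G0 \<union> \<beta> ` S"
          proof -
            have "\<not> G \<subseteq> G0"
            proof
              assume "G \<subseteq> G0"
              moreover have "finite G0" using G0' finV finite_subset by (auto simp: rainbow_def)
              moreover have "card G = card G0" using transversals_card G G0' by metis
              ultimately show False using card_subset_eq False by blast
            qed
            then have "G \<inter> \<beta> ` S \<noteq> {}" using sub by blast
            then show ?thesis using c0 G by (simp add: V_def)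
          qed
          then show ?thesis using False by auto
        qed
      qed
      moreover have "\<dots> = c G0" using G0' by simp
      ultimately show ?thesis by simp
    qed
  qed
qed

section \<open>Dimensions of spans of polynomials\<close>

lemma mpoly_ring_simps [simp]:
  "monoid.mult (mpoly_ring X) = (*)" "one (mpoly_ring X) = 1" "ring.zero (mpoly_ring X) = 0" "add (mpoly_ring X) = (+)"
  by (auto simp: mpoly_ring_def)

lemma mpoly_carrier_iff:
  "p \<in> carrier (mpoly_ring X) \<longleftrightarrow> (\<forall>m\<in>Poly_Mapping.keys p. Poly_Mapping.keys m \<subseteq> X)"
  by (simp add: mpoly_ring_def)

lemma mpoly_ring_ring: "ring (mpoly_ring X :: ('x, 'k::field) mpoly ring)"
  using mpoly_ring_cring[of X] by (rule cring.axioms)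

definition span_set :: "'b set \<Rightarrow> ('b \<Rightarrow> ('x, 'k::field) mpoly) \<Rightarrow> ('x, 'k) mpoly set"
  where "span_set B p = {(\<Sum>b\<in>B. Poly_Mapping.single 0 (c b) * p b) | c. True}"

lemma span_setI: "(\<Sum>b\<in>B. Poly_Mapping.single 0 (c b) * p b) \<in> span_set B p"
  by (auto simp: span_set_def)

lemma scalar_in_carrier: "Poly_Mapping.single 0 (a :: 'k::field) \<in> carrier (mpoly_ring X)"
  by (simp add: mpoly_carrier_iff)

lemma mpoly_carrier_add:
  "p \<in> carrier (mpoly_ring X) \<Longrightarrow> q \<in> carrier (mpoly_ring X) \<Longrightarrow> p + q \<in> carrier (mpoly_ring X)"
  using ring.ring_simprules(1)[OF mpoly_ring_ring, of p X q] by (simp only: mpoly_ring_simps)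

lemma mpoly_carrier_mult:
  "p \<in> carrier (mpoly_ring X) \<Longrightarrow> q \<in> carrier (mpoly_ring X) \<Longrightarrow> p * q \<in> carrier (mpoly_ring X)"
  using ring.ring_simprules(5)[OF mpoly_ring_ring, of p X q] by (simp only: mpoly_ring_simps)

lemma mpoly_carrier_sum:
  "(\<And>i. i \<in> I \<Longrightarrow> p i \<in> carrier (mpoly_ring X)) \<Longrightarrow> (\<Sum>i\<in>I. p i) \<in> carrier (mpoly_ring X)"
proof (induction I rule: infinite_finite_induct)
  case (insert i I)
  show ?case unfolding sum.insert[OF insert.hyps]
    by (intro mpoly_carrier_add insert.IH insert.prems) auto
qed (auto simp: mpoly_carrier_iff)

lemma span_set_carrier:
  assumes "p ` B \<subseteq> carrier (mpoly_ring X)"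
  shows "span_set B p \<subseteq> carrier (mpoly_ring X)"
proof
  fix q assume "q \<in> span_set B p"
  then obtain c where "q = (\<Sum>b\<in>B. Poly_Mapping.single 0 (c b) * p b)" by (auto simp: span_set_def)
  then show "q \<in> carrier (mpoly_ring X)"
    using assms by (simp only:) (intro mpoly_carrier_sum mpoly_carrier_mult scalar_in_carrier, blast)
qed

lemma span_set_insert:
  assumes "finite B" "b \<notin> B"
  shows "span_set (insert b B) p = ring.line_extension (mpoly_ring X) scalars (p b) (span_set B p)"
proof (rule Set.set_eqI)
  fix q
  have "q \<in> ring.line_extension (mpoly_ring X) scalars (p b) (span_set B p)
      \<longleftrightarrow> (\<exists>k\<in>scalars. \<exists>v\<in>span_set B p. q = k * p b + v)"
    using ring.line_extension_mem_iff[OF mpoly_ring_ring[of X], of q scalars "p b" "span_set B p"] by simp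
  also have "\<dots> \<longleftrightarrow> (\<exists>a c. q = Poly_Mapping.single 0 a * p b + (\<Sum>b\<in>B. Poly_Mapping.single 0 (c b) * p b))"
    by (auto simp: scalars_def span_set_def)
  also have "\<dots> \<longleftrightarrow> q \<in> span_set (insert b B) p"
  proof
    assume "\<exists>a c. q = Poly_Mapping.single 0 a * p b + (\<Sum>b\<in>B. Poly_Mapping.single 0 (c b) * p b)"
    then obtain a c where q: "q = Poly_Mapping.single 0 a * p b + (\<Sum>b\<in>B. Poly_Mapping.single 0 (c b) * p b)" by blast
    have "(\<Sum>x\<in>insert b B. Poly_Mapping.single 0 ((c(b := a)) x) * p x) = q"
      using assms by (auto simp: q intro!: sum.cong)
    then show "q \<in> span_set (insert b B) p" using span_setI[of "c(b := a)" p "insert b B"] by simp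
  qed (use assms in \<open>auto simp: span_set_def\<close>)
  finally show "q \<in> span_set (insert b B) p \<longleftrightarrow>
      q \<in> ring.line_extension (mpoly_ring X) scalars (p b) (span_set B p)" by simp
qed

lemma scalar_add: "Poly_Mapping.single 0 (a + b) * p = Poly_Mapping.single 0 a * p + Poly_Mapping.single 0 b * (p :: ('x, 'k::field) mpoly)"
  by (simp add: single_add distrib_right)

lemma scalar_mult: "Poly_Mapping.single 0 (a * b) * p = Poly_Mapping.single 0 a * (Poly_Mapping.single 0 b * (p :: ('x, 'k::field) mpoly))"
  by (simp add: mult_single flip: mult.assoc)

lemma span_set_closed:
  assumes "v \<in> span_set B p" "w \<in> span_set B p"
  shows "Poly_Mapping.single 0 a * w + v \<in> span_set B p"
proof -
  obtain c c' where "v = (\<Sum>b\<in>B. Poly_Mapping.single 0 (c b) * p b)" "w = (\<Sum>b\<in>B. Poly_Mapping.single 0 (c' b) * p b)"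
    using assms by (auto simp: span_set_def)
  then have "Poly_Mapping.single 0 a * w + v = (\<Sum>b\<in>B. Poly_Mapping.single 0 (a * c' b + c b) * p b)"
    by (simp add: scalar_add scalar_mult sum.distrib sum_distrib_left)
  then show ?thesis using span_setI by metis
qed

lemma scalars_carrier: "scalars \<subseteq> carrier (mpoly_ring X :: ('x, 'k::field) mpoly ring)"
  by (auto simp: scalars_def scalar_in_carrier)

text \<open>A further generator either leaves the image of the span unchanged or raises its
  dimension by one; the first case contradicts independence. With \<open>h = id\<close> this yields
  the Hilbert function of a polynomial, with the reduction map the dimensions of the reduced
  Stanley--Reisner ring.\<close>

lemma dimension_image_span_set:
  fixes p :: "'b \<Rightarrow> ('x, 'k::field) mpoly"
  assumes hom: "ring_hom_ring (mpoly_ring X) Q h" and B: "finite B" "p ` B \<subseteq> carrier (mpoly_ring X)"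
  shows "\<exists>m\<le>card B. ring.dimension Q m (h ` scalars) (h ` span_set B p) \<and>
    ((\<forall>c. h (\<Sum>b\<in>B. Poly_Mapping.single 0 (c b) * p b) = \<zero>\<^bsub>Q\<^esub> \<longrightarrow> (\<forall>b\<in>B. c b = 0)) \<longrightarrow> m = card B)"
  using B
proof (induction B rule: finite_induct)
  case empty
  interpret ring_hom_ring "mpoly_ring X" Q h by (rule hom)
  have "h ` span_set {} p = {\<zero>\<^bsub>Q\<^esub>}" using hom_zero by (auto simp: span_set_def)
  then show ?case using S.dimension.zero_dim by auto
next
  case (insert b B)
  interpret ring_hom_ring "mpoly_ring X" Q h by (rule hom)
  have pb: "p b \<in> carrier (mpoly_ring X)" using insert.prems by blast
  obtain m where m: "m \<le> card B" "S.dimension m (h ` scalars) (h ` span_set B p)"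
    "(\<forall>c. h (\<Sum>b\<in>B. Poly_Mapping.single 0 (c b) * p b) = \<zero>\<^bsub>Q\<^esub> \<longrightarrow> (\<forall>b\<in>B. c b = 0)) \<Longrightarrow> m = card B"
    using insert.IH insert.prems by blast
  have sp: "span_set B p \<subseteq> carrier (mpoly_ring X)" using insert.prems by (intro span_set_carrier) blast
  let ?ind = "\<lambda>B. \<forall>c. h (\<Sum>b\<in>B. Poly_Mapping.single 0 (c b) * p b) = \<zero>\<^bsub>Q\<^esub> \<longrightarrow> (\<forall>b\<in>B. c b = 0)"
  have ext: "h ` span_set (insert b B) p = S.line_extension (h ` scalars) (h (p b)) (h ` span_set B p)"
    using span_set_insert[OF insert.hyps, of p X] line_extension_hom[OF scalars_carrier pb sp] by simp
  show ?case
  proof (cases "h (p b) \<in> h ` span_set B p")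
    case True
    then obtain w where w: "w \<in> span_set B p" "h (p b) = h w" by blast
    have "h ` span_set (insert b B) p = h ` span_set B p"
    proof (intro equalityI subsetI)
      fix q assume "q \<in> h ` span_set (insert b B) p"
      then obtain k v where kv: "k \<in> scalars" "v \<in> span_set B p" "q = h k \<otimes>\<^bsub>Q\<^esub> h (p b) \<oplus>\<^bsub>Q\<^esub> h v"
        unfolding ext S.line_extension_mem_iff by blast
      obtain a where a: "k = Poly_Mapping.single 0 a" using kv(1) by (auto simp: scalars_def)
      have c: "k \<in> carrier (mpoly_ring X)" "w \<in> carrier (mpoly_ring X)" "v \<in> carrier (mpoly_ring X)"
        using scalars_carrier kv w sp by blast+
      have "h (k * w + v) = h k \<otimes>\<^bsub>Q\<^esub> h w \<oplus>\<^bsub>Q\<^esub> h v"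
        using hom_add[OF mpoly_carrier_mult[OF c(1,2)] c(3)] hom_mult[OF c(1,2)] by (simp only: mpoly_ring_simps)
      then have "q = h (k * w + v)" using kv(3) w(2) by simp
      moreover have "k * w + v \<in> span_set B p" unfolding a by (rule span_set_closed[OF kv(2) w(1)])
      ultimately show "q \<in> h ` span_set B p" by blast
    next
      fix q assume "q \<in> h ` span_set B p"
      then obtain v where v: "v \<in> span_set B p" "q = h v" by blast
      have "0 * p b + v \<in> span_set (insert b B) p"
        unfolding span_set_insert[OF insert.hyps, of p X] ring.line_extension_mem_iff[OF mpoly_ring_ring] mpoly_ring_simps
        using v(1) by (intro bexI[of _ 0] bexI[of _ v]) (auto simp: scalars_def intro: exI[of _ 0])
      then show "q \<in> h ` span_set (insert b B) p" using v(2) by simp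
    qed
    moreover have "\<not> ?ind (insert b B)"
    proof
      assume ind: "?ind (insert b B)"
      obtain c where c: "w = (\<Sum>b\<in>B. Poly_Mapping.single 0 (c b) * p b)" using w(1) by (auto simp: span_set_def)
      let ?c = "c(b := - 1)"
      have wc: "w \<in> carrier (mpoly_ring X)" using w(1) sp by blast
      have "(\<Sum>x\<in>insert b B. Poly_Mapping.single 0 (?c x) * p x) = Poly_Mapping.single 0 (- 1) * p b + w"
        using insert.hyps by (auto simp: c intro!: sum.cong)
      also have "h \<dots> = h (Poly_Mapping.single 0 (- 1)) \<otimes>\<^bsub>Q\<^esub> h (p b) \<oplus>\<^bsub>Q\<^esub> h w"
        using hom_add[OF mpoly_carrier_mult[OF scalar_in_carrier pb] wc] hom_mult[OF scalar_in_carrier pb]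
        by (simp only: mpoly_ring_simps)
      also have "\<dots> = h (Poly_Mapping.single 0 (- 1) * w + w)"
        using hom_add[OF mpoly_carrier_mult[OF scalar_in_carrier wc] wc] hom_mult[OF scalar_in_carrier wc] w(2)
        by (simp only: mpoly_ring_simps)
      also have "Poly_Mapping.single 0 (- 1) * w + w = 0"
      proof -
        have "Poly_Mapping.single 0 (- 1 + 1) * w = Poly_Mapping.single 0 (- 1) * w + Poly_Mapping.single 0 1 * w"
          by (rule scalar_add)
        then show ?thesis by simp
      qed
      also have "h 0 = \<zero>\<^bsub>Q\<^esub>" using hom_zero by simp
      finally have "?c b = 0" using ind by blast
      then show False by simp
    qed
    ultimately show ?thesis using m insert.hyps by (intro exI[of _ m]) auto
  next
    case False
    have "S.dimension (Suc m) (h ` scalars) (h ` span_set (insert b B) p)"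
      unfolding ext by (rule S.dimension.Suc_dim[OF _ False m(2)]) (rule hom_closed[OF pb])
    moreover have "Suc m = card (insert b B)" if ind: "?ind (insert b B)"
    proof -
      have "?ind B"
      proof (intro allI impI ballI)
        fix c x assume z: "h (\<Sum>b\<in>B. Poly_Mapping.single 0 (c b) * p b) = \<zero>\<^bsub>Q\<^esub>" and x: "x \<in> B"
        have "(\<Sum>x\<in>insert b B. Poly_Mapping.single 0 ((c(b := 0)) x) * p x) = (\<Sum>b\<in>B. Poly_Mapping.single 0 (c b) * p b)"
          using insert.hyps by (auto intro!: sum.cong)
        then have "h (\<Sum>x\<in>insert b B. Poly_Mapping.single 0 ((c(b := 0)) x) * p x) = \<zero>\<^bsub>Q\<^esub>"
          using z by (simp only:)
        from ind[rule_format, OF this] have "(c(b := 0)) x = 0" using x by blast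
        moreover have "x \<noteq> b" using x insert.hyps by blast
        ultimately show "c x = 0" by simp
      qed
      then show ?thesis using m(3) insert.hyps by simp
    qed
    ultimately show ?thesis using m(1) insert.hyps by (intro exI[of _ "Suc m"]) auto
  qed
qed

section \<open>Squarefree monomials\<close>

definition sqf :: "'x set \<Rightarrow> 'x \<Rightarrow>\<^sub>0 nat"
  where "sqf A = (\<Sum>x\<in>A. Poly_Mapping.single x 1)"

lemma lookup_sqf: "finite A \<Longrightarrow> Poly_Mapping.lookup (sqf A) y = (if y \<in> A then 1 else 0)"
  by (simp add: sqf_def lookup_sum lookup_single when_def)

lemma keys_sqf: "finite A \<Longrightarrow> Poly_Mapping.keys (sqf A) = A"
  by (intro Set.set_eqI) (simp only: in_keys_iff lookup_sqf, simp)

lemma sqf_Un: "finite A \<Longrightarrow> finite B \<Longrightarrow> A \<inter> B = {} \<Longrightarrow> sqf (A \<union> B) = sqf A + sqf B"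
  by (simp add: sqf_def sum.union_disjoint)

lemma sqf_eq_iff: "finite A \<Longrightarrow> finite B \<Longrightarrow> sqf A = sqf B \<longleftrightarrow> A = B"
  using keys_sqf by metis

lemma multidegree_sqf:
  assumes "finite A" "inj_on c A"
  shows "multidegree c (sqf A) = indicator (c ` A)"
proof
  fix i
  have "multidegree c (sqf A) i = (\<Sum>x\<in>A. indicator {c x} i)"
    using assms(1) by (simp add: multidegree_def keys_sqf lookup_sqf)
  also have "\<dots> = (\<Sum>j\<in>c ` A. indicator {j} i)" using assms(2) by (simp add: sum.reindex)
  also have "\<dots> = (\<Sum>j\<in>c ` A. if j = i then 1 else 0)" by (intro sum.cong) (auto simp: indicator_def)
  also have "\<dots> = indicator (c ` A) i" using assms(1) by (simp add: sum.delta indicator_def)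
  finally show "multidegree c (sqf A) i = indicator (c ` A) i" .
qed

text \<open>Within one colour the exponents are nonnegative and add up to at most 1, so each is at
  most 1 and no two variables of a colour occur together.\<close>

lemma multidegree_indicatorD:
  assumes m: "multidegree c m = indicator S"
  shows "m = sqf (Poly_Mapping.keys m)" "inj_on c (Poly_Mapping.keys m)" "c ` Poly_Mapping.keys m = S"
proof -
  let ?A = "Poly_Mapping.keys m"
  have deg: "multidegree c m (c x) = (\<Sum>y\<in>{y \<in> ?A. c y = c x}. int (Poly_Mapping.lookup m y))" for x
  proof -
    have "multidegree c m (c x) = (\<Sum>y\<in>?A. if c y = c x then int (Poly_Mapping.lookup m y) else 0)"
      unfolding multidegree_def by (intro sum.cong) (auto simp: indicator_def)
    then show ?thesis by (simp add: sum.inter_filter)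
  qed
  have le1: "multidegree c m i \<le> 1" for i by (simp add: m indicator_def)
  have ge1: "1 \<le> int (Poly_Mapping.lookup m x)" if "x \<in> ?A" for x
    using that by (simp add: in_keys_iff Suc_le_eq)
  have one: "Poly_Mapping.lookup m x = 1" if x: "x \<in> ?A" for x
  proof -
    have "int (Poly_Mapping.lookup m x) \<le> multidegree c m (c x)"
      unfolding deg by (rule member_le_sum) (use x in auto)
    then show ?thesis using ge1[OF x] le1[of "c x"] by linarith
  qed
  show "m = sqf ?A"
    by (rule poly_mapping_eqI) (use one in \<open>auto simp: lookup_sqf in_keys_iff\<close>)
  show "inj_on c ?A"
  proof (rule inj_onI, rule ccontr)
    fix x y assume xy: "x \<in> ?A" "y \<in> ?A" "c x = c y" "x \<noteq> y"
    have "(\<Sum>z\<in>{x, y}. int (Poly_Mapping.lookup m z)) \<le> multidegree c m (c x)"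
      unfolding deg by (rule sum_mono2) (use xy in auto)
    then show False using xy one le1[of "c x"] by simp
  qed
  show "c ` ?A = S"
  proof (intro equalityI subsetI)
    fix i assume "i \<in> c ` ?A"
    then obtain x where x: "x \<in> ?A" "i = c x" by blast
    have "int (Poly_Mapping.lookup m x) \<le> multidegree c m (c x)"
      unfolding deg by (rule member_le_sum) (use x in auto)
    then show "i \<in> S" using one[OF x(1)] x(2) by (cases "c x \<in> S") (auto simp: m)
  next
    fix i assume "i \<in> S"
    then have "multidegree c m i \<noteq> 0" by (simp add: m)
    then obtain x where "x \<in> ?A" "int (Poly_Mapping.lookup m x) * indicator {c x} i \<noteq> 0"
      unfolding multidegree_def by (rule sum.not_neutral_contains_not_neutral)
    then show "i \<in> c ` ?A" by (auto simp: indicator_def split: if_splits)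
  qed
qed

lemma finite_rainbow: "finite X \<Longrightarrow> finite (rainbow X c S)"
  by (auto simp: rainbow_def intro: finite_subset[of _ "Pow X"])

lemma rainbow_finite: "finite X \<Longrightarrow> A \<in> rainbow X c S \<Longrightarrow> finite A"
  by (auto simp: rainbow_def intro: finite_subset)

lemma graded_component_squarefree:
  assumes X: "finite X"
  shows "graded_component X c (indicator S) = span_set (rainbow X c S) (\<lambda>A. Poly_Mapping.single (sqf A) (1 :: 'k::field))"
proof (intro equalityI subsetI)
  fix p :: "('a, 'k) mpoly" assume p: "p \<in> graded_component X c (indicator S)"
  have keys: "Poly_Mapping.keys p \<subseteq> sqf ` rainbow X c S"
  proof
    fix m assume m: "m \<in> Poly_Mapping.keys p"
    then have "Poly_Mapping.keys m \<subseteq> X" "multidegree c m = indicator S"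
      using p by (auto simp: graded_component_def mpoly_carrier_iff)
    then have "m = sqf (Poly_Mapping.keys m)" "Poly_Mapping.keys m \<in> rainbow X c S"
      using multidegree_indicatorD[of c m S] by (auto simp: rainbow_def)
    then show "m \<in> sqf ` rainbow X c S" by blast
  qed
  have expand: "p = (\<Sum>A\<in>rainbow X c S. Poly_Mapping.single 0 (Poly_Mapping.lookup p (sqf A)) * Poly_Mapping.single (sqf A) 1)"
  proof (rule poly_mapping_eqI)
    fix m :: "'a \<Rightarrow>\<^sub>0 nat"
    have "Poly_Mapping.lookup (Poly_Mapping.single 0 a * Poly_Mapping.single (sqf A) (1 :: 'k)) m = (if sqf A = m then a else 0)" for a A
      by (simp add: mult_single lookup_single when_def)
    then have "Poly_Mapping.lookup (\<Sum>A\<in>rainbow X c S. Poly_Mapping.single 0 (Poly_Mapping.lookup p (sqf A)) * Poly_Mapping.single (sqf A) 1) m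
        = (\<Sum>A\<in>rainbow X c S. if sqf A = m then Poly_Mapping.lookup p m else 0)"
      unfolding lookup_sum by (intro sum.cong) auto
    also have "\<dots> = Poly_Mapping.lookup p m"
    proof (cases "m \<in> sqf ` rainbow X c S")
      case True
      then obtain A where A: "A \<in> rainbow X c S" "m = sqf A" by blast
      have "(\<Sum>B\<in>rainbow X c S. if sqf B = m then Poly_Mapping.lookup p m else 0)
          = (\<Sum>B\<in>rainbow X c S. if B = A then Poly_Mapping.lookup p m else 0)"
      proof (rule sum.cong[OF refl])
        fix B assume "B \<in> rainbow X c S"
        then have "sqf B = m \<longleftrightarrow> B = A" using A sqf_eq_iff[of B A] rainbow_finite[OF X] by simp
        then show "(if sqf B = m then Poly_Mapping.lookup p m else 0) = (if B = A then Poly_Mapping.lookup p m else 0)"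
          by simp
      qed
      then show ?thesis using A finite_rainbow[OF X] by (simp add: sum.delta)
    next
      case False
      then have "(\<Sum>B\<in>rainbow X c S. if sqf B = m then Poly_Mapping.lookup p m else 0) = 0"
        by (intro sum.neutral) auto
      moreover have "Poly_Mapping.lookup p m = 0" using False keys by (auto simp: in_keys_iff)
      ultimately show ?thesis by simp
    qed
    finally show "Poly_Mapping.lookup p m = Poly_Mapping.lookup (\<Sum>A\<in>rainbow X c S.
        Poly_Mapping.single 0 (Poly_Mapping.lookup p (sqf A)) * Poly_Mapping.single (sqf A) 1) m" by simp
  qed
  show "p \<in> span_set (rainbow X c S) (\<lambda>A. Poly_Mapping.single (sqf A) 1)"
    by (subst expand) (rule span_setI)
next
  fix p :: "('a, 'k) mpoly" assume "p \<in> span_set (rainbow X c S) (\<lambda>A. Poly_Mapping.single (sqf A) 1)"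
  then obtain a where "p = (\<Sum>A\<in>rainbow X c S. Poly_Mapping.single 0 (a A) * Poly_Mapping.single (sqf A) 1)"
    by (auto simp: span_set_def)
  then have p: "p = (\<Sum>A\<in>rainbow X c S. Poly_Mapping.single (sqf A) (a A))" by (simp add: mult_single)
  have "\<exists>A\<in>rainbow X c S. m = sqf A" if m: "m \<in> Poly_Mapping.keys p" for m
  proof -
    have "(\<Sum>A\<in>rainbow X c S. Poly_Mapping.lookup (Poly_Mapping.single (sqf A) (a A)) m) \<noteq> 0"
      using m by (simp add: p in_keys_iff lookup_sum)
    then obtain A where "A \<in> rainbow X c S" "Poly_Mapping.lookup (Poly_Mapping.single (sqf A) (a A)) m \<noteq> 0"
      by (rule sum.not_neutral_contains_not_neutral)
    then show ?thesis by (auto simp: lookup_single when_def split: if_splits)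
  qed
  moreover have "Poly_Mapping.keys (sqf A) \<subseteq> X" "multidegree c (sqf A) = indicator S" if "A \<in> rainbow X c S" for A
    using that keys_sqf[OF rainbow_finite[OF X that]] multidegree_sqf[OF rainbow_finite[OF X that]]
    by (auto simp: rainbow_def)
  ultimately show "p \<in> graded_component X c (indicator S)"
    unfolding graded_component_def mpoly_carrier_iff by fastforce
qed

lemma card_rainbow:
  assumes "finite S" "\<And>i. i \<in> S \<Longrightarrow> finite {x \<in> X. c x = i}"
  shows "card (rainbow X c S) = (\<Prod>i\<in>S. card {x \<in> X. c x = i})"
proof -
  have "bij_betw (\<lambda>g. g ` S) (PiE S (\<lambda>i. {x \<in> X. c x = i})) (rainbow X c S)"
  proof (rule bij_betwI[where g = "\<lambda>A. \<lambda>i\<in>S. inv_into A c i"])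
    show "(\<lambda>g. g ` S) \<in> PiE S (\<lambda>i. {x \<in> X. c x = i}) \<rightarrow> rainbow X c S"
    proof
      fix g assume g: "g \<in> PiE S (\<lambda>i. {x \<in> X. c x = i})"
      then have "g i \<in> X" "c (g i) = i" if "i \<in> S" for i using that by auto
      then show "g ` S \<in> rainbow X c S" by (auto simp: rainbow_def inj_on_def image_image)
    qed
    show "(\<lambda>A. \<lambda>i\<in>S. inv_into A c i) \<in> rainbow X c S \<rightarrow> PiE S (\<lambda>i. {x \<in> X. c x = i})"
    proof
      fix A assume A: "A \<in> rainbow X c S"
      have "inv_into A c i \<in> A" "c (inv_into A c i) = i" if "i \<in> S" for i
        using A that inv_into_into[of i c A] f_inv_into_f[of i c A] by (auto simp: rainbow_def)
      then show "(\<lambda>i\<in>S. inv_into A c i) \<in> PiE S (\<lambda>i. {x \<in> X. c x = i})" using A by (auto simp: rainbow_def)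
    qed
    show "(\<lambda>i\<in>S. inv_into (g ` S) c i) = g" if g: "g \<in> PiE S (\<lambda>i. {x \<in> X. c x = i})" for g
    proof (rule ext)
      fix i
      have cg: "c (g j) = j" if "j \<in> S" for j using g that by auto
      show "(\<lambda>i\<in>S. inv_into (g ` S) c i) i = g i"
      proof (cases "i \<in> S")
        case True
        have "inj_on c (g ` S)" using cg by (auto simp: inj_on_def)
        then have "inv_into (g ` S) c (c (g i)) = g i" using True by (intro inv_into_f_f) auto
        then show ?thesis using cg[OF True] True by simp
      qed (use g in auto)
    qed
    show "(\<lambda>i\<in>S. inv_into A c i) ` S = A" if A: "A \<in> rainbow X c S" for A
    proof -
      have cA: "c ` A = S" "inj_on c A" using A by (auto simp: rainbow_def)
      have "(\<lambda>i\<in>S. inv_into A c i) ` S = inv_into A c ` (c ` A)" unfolding cA(1) by auto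
      also have "\<dots> = A" using cA(2) by (rule inv_into_image_cancel) simp
      finally show ?thesis .
    qed
  qed
  then have "card (rainbow X c S) = card (PiE S (\<lambda>i. {x \<in> X. c x = i}))" by (simp add: bij_betw_same_card)
  then show ?thesis using assms(1) by (simp add: card_PiE)
qed

section \<open>Polynomials from multilinear forms\<close>

lemma lookup_scalar_mult:
  "Poly_Mapping.lookup (Poly_Mapping.single 0 a * p) m = (a :: 'k::field) * Poly_Mapping.lookup p m"
  unfolding mult_map_scale_conv_mult[symmetric] by (simp add: Poly_Mapping.map.rep_eq when_def)

text \<open>The factor is the product of the exponents in \<open>m + sqf A\<close> of the variables
  in \<open>A\<close>. It is 1 when \<open>m\<close> avoids \<open>A\<close>, so multilinear
  polynomials behave alike in every characteristic.\<close>

lemma lookup_monomial_diff_sqf: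
  assumes A: "finite A"
  shows "Poly_Mapping.lookup (monomial_diff (sqf A) f) m =
    (\<Prod>x\<in>A. of_nat (Suc (Poly_Mapping.lookup m x))) * Poly_Mapping.lookup f (m + sqf A)"
proof -
  let ?F = "\<lambda>x. partial_diff x ^^ Poly_Mapping.lookup (sqf A) x"
  interpret comp_fun_commute ?F by (rule comp_fun_commute_partial_diff)
  have "Poly_Mapping.lookup (Finite_Set.fold ?F f B) m =
      (\<Prod>x\<in>B. of_nat (Suc (Poly_Mapping.lookup m x))) * Poly_Mapping.lookup f (m + sqf B)" if "B \<subseteq> A" for B
    using finite_subset[OF that A] that
  proof (induction B arbitrary: m rule: finite_induct)
    case empty
    then show ?case by (simp add: sqf_def)
  next
    case (insert x B)
    let ?m = "m + Poly_Mapping.single x 1"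
    have "Finite_Set.fold ?F f (insert x B) = partial_diff x (Finite_Set.fold ?F f B)"
      using fold_insert[OF insert.hyps] insert.prems A
      by (simp add: lookup_sqf)
    then have "Poly_Mapping.lookup (Finite_Set.fold ?F f (insert x B)) m
      = of_nat (Suc (Poly_Mapping.lookup m x)) * Poly_Mapping.lookup (Finite_Set.fold ?F f B) ?m"
      by (simp only: lookup_partial_diff)
    also have "Poly_Mapping.lookup (Finite_Set.fold ?F f B) ?m
      = (\<Prod>y\<in>B. of_nat (Suc (Poly_Mapping.lookup ?m y))) * Poly_Mapping.lookup f (?m + sqf B)"
      using insert by simp
    also have "(\<Prod>y\<in>B. of_nat (Suc (Poly_Mapping.lookup ?m y))) = (\<Prod>y\<in>B. of_nat (Suc (Poly_Mapping.lookup m y)) :: 'b)"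
      using insert.hyps by (intro prod.cong refl) (auto simp: lookup_add lookup_single when_def)
    also have "?m + sqf B = m + sqf (insert x B)" using insert.hyps by (simp add: sqf_def add.assoc)
    finally show ?case using insert.hyps by (simp add: mult.assoc)
  qed
  then show ?thesis using A by (simp add: monomial_diff_def keys_sqf)
qed

definition form_poly :: "nat \<Rightarrow> (nat \<Rightarrow> nat) \<Rightarrow> ((nat \<times> nat) set \<Rightarrow> 'k::field) \<Rightarrow> (nat \<times> nat, 'k) mpoly"
  where "form_poly d n a = (\<Sum>A\<in>rainbow (variables d n) fst {1..d}. Poly_Mapping.single (sqf A) (a A))"

lemma finite_variables [simp]: "finite (variables d n)"
  by (simp add: variables_def)

lemma lookup_sqf_sum:
  assumes X: "finite X"
  shows "Poly_Mapping.lookup (\<Sum>A\<in>rainbow X c S. Poly_Mapping.single (sqf A) (a A)) m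
    = (if m \<in> sqf ` rainbow X c S then a (Poly_Mapping.keys m) else 0)"
proof -
  have fin: "finite A" if "A \<in> rainbow X c S" for A using rainbow_finite[OF X that] .
  have "Poly_Mapping.lookup (\<Sum>A\<in>rainbow X c S. Poly_Mapping.single (sqf A) (a A)) m
      = (\<Sum>A\<in>rainbow X c S. if sqf A = m then a A else 0)"
    unfolding lookup_sum by (intro sum.cong refl) (simp add: lookup_single when_def)
  also have "\<dots> = (\<Sum>A\<in>rainbow X c S. if A = Poly_Mapping.keys m \<and> m \<in> sqf ` rainbow X c S then a A else 0)"
  proof (rule sum.cong[OF refl])
    fix A assume A: "A \<in> rainbow X c S"
    have "sqf A = m \<longleftrightarrow> A = Poly_Mapping.keys m \<and> m \<in> sqf ` rainbow X c S"
    proof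
      assume "A = Poly_Mapping.keys m \<and> m \<in> sqf ` rainbow X c S"
      then obtain B where "B \<in> rainbow X c S" "m = sqf B" "A = Poly_Mapping.keys m" by blast
      then show "sqf A = m" using keys_sqf[OF fin] by metis
    qed (use A keys_sqf[OF fin[OF A]] in auto)
    then show "(if sqf A = m then a A else 0) = (if A = Poly_Mapping.keys m \<and> m \<in> sqf ` rainbow X c S then a A else 0)"
      by simp
  qed
  also have "\<dots> = (if m \<in> sqf ` rainbow X c S then a (Poly_Mapping.keys m) else 0)"
  proof (cases "m \<in> sqf ` rainbow X c S")
    case True
    then have "Poly_Mapping.keys m \<in> rainbow X c S" using keys_sqf[OF fin] by auto
    then show ?thesis using True finite_rainbow[OF X] by simp
  qed simp
  finally show ?thesis .
qed

lemma apply_diff_sqf_sum: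
  fixes c :: "'x set \<Rightarrow> 'k::field"
  assumes X: "finite X"
  shows "apply_diff (\<Sum>A\<in>rainbow X \<kappa> S. Poly_Mapping.single (sqf A) (c A)) f
    = (\<Sum>A\<in>rainbow X \<kappa> S. Poly_Mapping.single 0 (c A) * monomial_diff (sqf A) f)"
proof -
  let ?g = "\<Sum>A\<in>rainbow X \<kappa> S. Poly_Mapping.single (sqf A) (c A)"
  have fin: "finite A" if "A \<in> rainbow X \<kappa> S" for A using rainbow_finite[OF X that] .
  have "apply_diff ?g f = (\<Sum>m\<in>sqf ` rainbow X \<kappa> S. Poly_Mapping.single 0 (Poly_Mapping.lookup ?g m) * monomial_diff m f)"
    unfolding apply_diff_def
  proof (rule sum.mono_neutral_left)
    show "Poly_Mapping.keys ?g \<subseteq> sqf ` rainbow X \<kappa> S"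
    proof
      fix m assume "m \<in> Poly_Mapping.keys ?g"
      then have "Poly_Mapping.lookup ?g m \<noteq> 0" by (rule in_keys_iff[THEN iffD1])
      then show "m \<in> sqf ` rainbow X \<kappa> S" unfolding lookup_sqf_sum[OF X] by (auto split: if_splits)
    qed
  qed (use finite_rainbow[OF X] in \<open>auto simp: not_in_keys_iff_lookup_eq_zero\<close>)
  also have "\<dots> = (\<Sum>A\<in>rainbow X \<kappa> S. Poly_Mapping.single 0 (Poly_Mapping.lookup ?g (sqf A)) * monomial_diff (sqf A) f)"
    by (rule sum.reindex_cong[of sqf]) (use fin sqf_eq_iff in \<open>auto intro!: inj_onI\<close>)
  also have "\<dots> = (\<Sum>A\<in>rainbow X \<kappa> S. Poly_Mapping.single 0 (c A) * monomial_diff (sqf A) f)"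
  proof (rule sum.cong[OF refl])
    fix A assume A: "A \<in> rainbow X \<kappa> S"
    then have "Poly_Mapping.lookup ?g (sqf A) = c A" unfolding lookup_sqf_sum[OF X] by (simp add: keys_sqf[OF fin])
    then show "Poly_Mapping.single 0 (Poly_Mapping.lookup ?g (sqf A)) * monomial_diff (sqf A) f
        = Poly_Mapping.single 0 (c A) * monomial_diff (sqf A) f" by simp
  qed
  finally show ?thesis .
qed

lemma card_rainbow_variables:
  assumes "S \<subseteq> {1..d}"
  shows "card (rainbow (variables d n) fst S) = (\<Prod>k\<in>S. n k)"
proof -
  have e: "{x \<in> variables d n. fst x = i} = {i} \<times> {1..n i}" if "i \<in> S" for i
    using that assms by (auto simp: variables_def)
  have "card (rainbow (variables d n) fst S) = (\<Prod>i\<in>S. card {x \<in> variables d n. fst x = i})"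
    by (rule card_rainbow) (use assms finite_subset in auto)
  also have "\<dots> = (\<Prod>k\<in>S. n k)" by (intro prod.cong refl) (simp add: e card_cartesian_product_singleton)
  finally show ?thesis .
qed

text \<open>The coefficient at the monomial of \<open>A'\<close> of the derivative indexed by
  \<open>A\<close> is \<open>a (A \<union> A')\<close>. The hypothesis makes the rows of this matrix
  independent, hence also the derivatives, and there are as many of them as the product of the
  \<open>n k\<close> asks for.\<close>

lemma balanced_neighborly_form_poly:
  fixes a :: "(nat \<times> nat) set \<Rightarrow> 'k::field"
  assumes nondeg: "\<And>S c A. S \<subseteq> {1..d} \<Longrightarrow> real (card S) \<le> real d / 2 \<Longrightarrow>
    (\<And>A'. A' \<in> rainbow (variables d n) fst ({1..d} - S) \<Longrightarrow>
      (\<Sum>A\<in>rainbow (variables d n) fst S. c A * a (A \<union> A')) = 0) \<Longrightarrow>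
    A \<in> rainbow (variables d n) fst S \<Longrightarrow> c A = 0"
  shows "balanced_neighborly_polynomial d n (form_poly d n a)"
  unfolding balanced_neighborly_polynomial_def balanced_polynomial_def
proof (intro conjI allI impI)
  let ?X = "variables d n" and ?f = "form_poly d n a"
  have X: "finite ?X" by simp
  have graded: "graded_component ?X fst (indicator S) =
      {(\<Sum>A\<in>rainbow ?X fst S. Poly_Mapping.single (sqf A) (c A)) | c :: _ \<Rightarrow> 'k. True}" for S
    unfolding graded_component_squarefree[OF X] span_set_def by (simp add: mult_single)
  show "?f \<in> graded_component ?X fst (indicator {1..d})" unfolding graded form_poly_def by blast
  fix S assume S: "S \<subseteq> {1..d}" and small: "real (card S) \<le> real d / 2"
  let ?T = "{1..d} - S"
  define D where "D A = monomial_diff (sqf A) ?f" for A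
  have "{apply_diff g ?f | g. g \<in> graded_component ?X fst (indicator S)} = span_set (rainbow ?X fst S) D"
    unfolding graded span_set_def D_def apply_diff_sqf_sum[OF X, where \<kappa> = fst and S = S and f = ?f, symmetric]
    by blast
  moreover have D: "D ` rainbow ?X fst S \<subseteq> carrier (mpoly_ring ?X)"
  proof (rule image_subsetI)
    fix A assume A: "A \<in> rainbow ?X fst S"
    show "D A \<in> carrier (mpoly_ring ?X)"
      unfolding mpoly_carrier_iff
    proof
      fix m assume "m \<in> Poly_Mapping.keys (D A)"
      then have "Poly_Mapping.lookup (D A) m \<noteq> 0" by (rule in_keys_iff[THEN iffD1])
      then have "Poly_Mapping.lookup ?f (m + sqf A) \<noteq> 0"
        unfolding D_def lookup_monomial_diff_sqf[OF rainbow_finite[OF X A]] by auto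
      then have "m + sqf A \<in> sqf ` rainbow ?X fst {1..d}"
        unfolding form_poly_def lookup_sqf_sum[OF X] by (auto split: if_splits)
      then obtain B where B: "B \<in> rainbow ?X fst {1..d}" "m + sqf A = sqf B" by blast
      have "Poly_Mapping.keys m \<subseteq> Poly_Mapping.keys (m + sqf A)" by (auto simp: in_keys_iff lookup_add)
      also have "\<dots> = B" using B keys_sqf[OF rainbow_finite[OF X B(1)]] by simp
      finally show "Poly_Mapping.keys m \<subseteq> ?X" using B(1) by (auto simp: rainbow_def)
    qed
  qed
  moreover have "(\<forall>A\<in>rainbow ?X fst S. c A = 0)"
    if z: "id (\<Sum>A\<in>rainbow ?X fst S. Poly_Mapping.single 0 (c A) * D A) = \<zero>\<^bsub>mpoly_ring ?X\<^esub>" for c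
  proof
    fix A assume A: "A \<in> rainbow ?X fst S"
    show "c A = 0"
    proof (rule nondeg[OF S small _ A])
      fix A' assume A': "A' \<in> rainbow ?X fst ?T"
      have "(\<Sum>A\<in>rainbow ?X fst S. c A * a (A \<union> A')) =
          (\<Sum>A\<in>rainbow ?X fst S. Poly_Mapping.lookup (Poly_Mapping.single 0 (c A) * D A) (sqf A'))"
      proof (rule sum.cong[OF refl])
        fix A assume A: "A \<in> rainbow ?X fst S"
        have fin: "finite A" "finite A'" using rainbow_finite[OF X] A A' by auto
        have "fst ` A = S" "fst ` A' = ?T" using A A' by (auto simp: rainbow_def)
        then have img: "fst ` A \<inter> fst ` A' = {}" by simp
        then have disj: "A \<inter> A' = {}" by blast
        have "fst ` (A \<union> A') = {1..d}" using \<open>fst ` A = S\<close> \<open>fst ` A' = ?T\<close> S by (simp add: image_Un Un_absorb1)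
        moreover have "inj_on fst (A \<union> A')" using A A' img by (auto simp: rainbow_def inj_on_Un)
        ultimately have U: "A \<union> A' \<in> rainbow ?X fst {1..d}" using A A' by (auto simp: rainbow_def)
        have s: "sqf A' + sqf A = sqf (A \<union> A')" using sqf_Un[OF fin disj] by (simp add: add.commute)
        have "Poly_Mapping.lookup ?f (sqf (A \<union> A')) = a (A \<union> A')"
          unfolding form_poly_def lookup_sqf_sum[OF X] using U keys_sqf[of "A \<union> A'"] fin by simp
        moreover have "(\<Prod>x\<in>A. of_nat (Suc (Poly_Mapping.lookup (sqf A') x))) = (1 :: 'k)"
          using disj fin by (intro prod.neutral) (auto simp: lookup_sqf)
        ultimately have "Poly_Mapping.lookup (D A) (sqf A') = a (A \<union> A')"
          unfolding D_def lookup_monomial_diff_sqf[OF fin(1)] s by simp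
        then show "c A * a (A \<union> A') = Poly_Mapping.lookup (Poly_Mapping.single 0 (c A) * D A) (sqf A')"
          by (simp add: lookup_scalar_mult)
      qed
      also have "\<dots> = Poly_Mapping.lookup (\<Sum>A\<in>rainbow ?X fst S. Poly_Mapping.single 0 (c A) * D A) (sqf A')"
        by (simp only: lookup_sum)
      also have "\<dots> = 0" using z by simp
      finally show "(\<Sum>A\<in>rainbow ?X fst S. c A * a (A \<union> A')) = 0" .
    qed
  qed
  moreover have "ring_hom_ring (mpoly_ring ?X) (mpoly_ring ?X) (id :: (nat \<times> nat, 'k) mpoly \<Rightarrow> _)"
    by (rule ring_hom_ringI2[OF mpoly_ring_ring mpoly_ring_ring]) (auto simp: ring_hom_def)
  ultimately have "ring.dimension (mpoly_ring ?X) (card (rainbow ?X fst S)) scalars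
      {apply_diff g ?f | g. g \<in> graded_component ?X fst (indicator S)}"
    using dimension_image_span_set[of ?X "mpoly_ring ?X" id "rainbow ?X fst S" D] finite_rainbow[OF X] by auto
  then show "hilbert d n ?f S = (\<Prod>k\<in>S. n k)"
    using ring.dimI[OF mpoly_ring_ring scalars_subfield] card_rainbow_variables[OF S]
    by (simp add: hilbert_def over_def)
qed

section \<open>The reduced Stanley--Reisner ring in squarefree degrees\<close>

text \<open>This makes conditions on constant and linear coefficients define an ideal: if
  \<open>p\<close> has no constant term, only the constant term of \<open>q\<close> affects the
  linear coefficients of the product.\<close>

lemma lookup_mult_low:
  fixes p q :: "('x, 'k::field) mpoly"
  assumes p: "Poly_Mapping.lookup p 0 = 0"
  shows "Poly_Mapping.lookup (q * p) 0 = 0"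
    "Poly_Mapping.lookup (q * p) (Poly_Mapping.single v 1)
      = Poly_Mapping.lookup q 0 * Poly_Mapping.lookup p (Poly_Mapping.single v 1)"
proof -
  let ?v = "Poly_Mapping.single v (1::nat)"
  have split: "?v = l + r \<longleftrightarrow> l = 0 \<and> r = ?v \<or> l = ?v \<and> r = 0" for l r
  proof
    assume e: "?v = l + r"
    have sum: "Poly_Mapping.lookup ?v x = Poly_Mapping.lookup l x + Poly_Mapping.lookup r x" for x
      by (subst e) (rule lookup_add)
    have other: "Poly_Mapping.lookup l x = 0" "Poly_Mapping.lookup r x = 0" if "x \<noteq> v" for x
      using sum[of x] that by (simp_all add: lookup_single when_def)
    have "Poly_Mapping.lookup l v + Poly_Mapping.lookup r v = 1" using sum[of v] by simp
    then consider "Poly_Mapping.lookup l v = 0" "Poly_Mapping.lookup r v = 1"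
      | "Poly_Mapping.lookup l v = 1" "Poly_Mapping.lookup r v = 0" by linarith
    then show "l = 0 \<and> r = ?v \<or> l = ?v \<and> r = 0"
    proof cases
      case 1
      then have "l = 0" by (intro poly_mapping_eqI) (metis lookup_zero other(1))
      then show ?thesis using e by simp
    next
      case 2
      then have "r = 0" by (intro poly_mapping_eqI) (metis lookup_zero other(2))
      then show ?thesis using e by simp
    qed
  qed auto
  have zero: "0 = l + r \<longleftrightarrow> l = 0 \<and> r = 0" for l r :: "'x \<Rightarrow>\<^sub>0 nat"
  proof
    assume e: "0 = l + r"
    have "Poly_Mapping.lookup l x = 0" for x
    proof -
      have "Poly_Mapping.lookup (l + r) x = 0" using e by (metis lookup_zero)
      then show ?thesis by (simp add: lookup_add)
    qed
    then have "l = 0" by (intro poly_mapping_eqI) simp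
    then show "l = 0 \<and> r = 0" using e by simp
  qed simp
  have "(\<Sum>r. (Poly_Mapping.lookup p r when 0 = l + r)) = 0" for l
  proof (cases "l = 0")
    case True
    then have "(\<Sum>r. (Poly_Mapping.lookup p r when 0 = l + r)) = (\<Sum>r. (Poly_Mapping.lookup p r when r = 0))"
      by (simp add: zero)
    then show ?thesis using p by simp
  qed (simp add: zero)
  then show "Poly_Mapping.lookup (q * p) 0 = 0" by (simp add: lookup_mult)
  have "(\<Sum>r. (Poly_Mapping.lookup p r when ?v = l + r)) = (Poly_Mapping.lookup p ?v when l = 0)" for l
  proof -
    consider "l = 0" | "l = ?v" "l \<noteq> 0" | "l \<noteq> 0" "l \<noteq> ?v" by blast
    then show ?thesis
    proof cases
      case 1
      then have "(\<Sum>r. (Poly_Mapping.lookup p r when ?v = l + r)) = (\<Sum>r. (Poly_Mapping.lookup p r when ?v = r))" by simp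
      then show ?thesis using 1 by (simp only: Sum_any_when_equal') simp
    next
      case 2
      have "(\<Sum>r. (Poly_Mapping.lookup p r when ?v = l + r)) = (\<Sum>r. (Poly_Mapping.lookup p r when r = 0))"
        unfolding split using 2 by simp
      then show ?thesis using 2 p by (simp only: Sum_any_when_equal) simp
    next
      case 3
      then have "(\<Sum>r. (Poly_Mapping.lookup p r when ?v = l + r)) = (\<Sum>r::'x \<Rightarrow>\<^sub>0 nat. 0)"
        unfolding split by simp
      then show ?thesis using 3 by simp
    qed
  qed
  then show "Poly_Mapping.lookup (q * p) ?v = Poly_Mapping.lookup q 0 * Poly_Mapping.lookup p ?v"
    by (simp add: lookup_mult mult_when)
qed

lemma prod_mvar: "finite F \<Longrightarrow> (\<Prod>v\<in>F. mvar v) = Poly_Mapping.single (sqf F) 1"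
  by (induction F rule: finite_induct) (simp_all add: mvar_def mult_single sqf_def)

lemma mvar_sqf: "mvar v = Poly_Mapping.single (sqf {v}) 1"
  by (simp add: mvar_def sqf_def)

locale coloured_complex =
  fixes \<Delta> :: "'v set set" and \<kappa> :: "'v \<Rightarrow> nat" and d :: nat and K :: "'l::field itself"
  assumes cx: "simplicial_complex \<Delta>" and col: "proper_coloring d \<Delta> \<kappa>"
begin

abbreviation V where "V \<equiv> \<Union>\<Delta>"
abbreviation R :: "('v, 'l) mpoly ring" where "R \<equiv> vertex_ring \<Delta>"
abbreviation I :: "('v, 'l) mpoly set" where "I \<equiv> SR_ideal \<Delta>"
abbreviation T :: "('v, 'l) mpoly set set" where "T \<equiv> theta_ideal d \<Delta> \<kappa>"
abbreviation \<rho> :: "('v, 'l) mpoly \<Rightarrow> ('v, 'l) mpoly set set" where "\<rho> \<equiv> reduction_class d \<Delta> \<kappa>"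
abbreviation Q :: "('v, 'l) mpoly set set ring" where "Q \<equiv> SR_reduction d \<Delta> \<kappa>"
abbreviation xm :: "'v set \<Rightarrow> ('v, 'l) mpoly" where "xm A \<equiv> Poly_Mapping.single (sqf A) 1"

lemma finite_V: "finite V"
  using cx by (auto simp: simplicial_complex_def)

lemma finite_colour: "finite {v \<in> V. \<kappa> v = k}"
  by (rule finite_subset[OF _ finite_V]) blast

lemma xm_carrier: "A \<subseteq> V \<Longrightarrow> xm A \<in> carrier R"
  using keys_sqf[OF finite_subset[OF _ finite_V]] by (simp add: mpoly_carrier_iff)

lemma theta_carrier: "(theta \<Delta> \<kappa> k :: ('v, 'l) mpoly) \<in> carrier R"
  unfolding theta_def mvar_sqf by (intro mpoly_carrier_sum xm_carrier) auto

definition SR_gens :: "('v, 'l) mpoly set"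
  where "SR_gens = {\<Prod>v\<in>F. mvar v | F. F \<subseteq> V \<and> F \<notin> \<Delta>}"

lemma SR_gens_carrier: "SR_gens \<subseteq> carrier R"
  using prod_mvar[OF finite_subset[OF _ finite_V], where 'b = 'l] xm_carrier by (auto simp: SR_gens_def)

sublocale R: cring R by (rule mpoly_ring_cring)

lemma ideal_I: "ideal I R"
  unfolding SR_ideal_def SR_gens_def[symmetric] by (rule R.genideal_ideal[OF SR_gens_carrier])

lemma hom_I: "ring_hom_ring R (SR_ring \<Delta>) (SR_class \<Delta>)"
  using ideal.rcos_ring_hom_ring[OF ideal_I] unfolding SR_ring_def SR_class_def[abs_def] .

definition theta_gens :: "('v, 'l) mpoly set set"
  where "theta_gens = {SR_class \<Delta> (theta \<Delta> \<kappa> k) | k. k \<in> {1..d}}"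

lemma theta_gens_carrier: "theta_gens \<subseteq> carrier (SR_ring \<Delta>)"
  using ring_hom_closed[OF ring_hom_ring.homh[OF hom_I] theta_carrier] by (auto simp: theta_gens_def)

lemma ideal_T: "ideal T (SR_ring \<Delta>)"
  unfolding theta_ideal_def theta_gens_def[symmetric]
  by (rule ring.genideal_ideal[OF _ theta_gens_carrier]) (rule ring_hom_ring.axioms(2)[OF hom_I])

lemma hom_T: "ring_hom_ring (SR_ring \<Delta>) Q ((+>\<^bsub>SR_ring \<Delta>\<^esub>) T)"
  using ideal.rcos_ring_hom_ring[OF ideal_T] unfolding SR_reduction_def .

lemma hom_\<rho>: "ring_hom_ring R Q \<rho>"
proof -
  have "\<rho> = (+>\<^bsub>SR_ring \<Delta>\<^esub>) T \<circ> SR_class \<Delta>" by (simp add: fun_eq_iff reduction_class_def)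
  moreover have "(+>\<^bsub>SR_ring \<Delta>\<^esub>) T \<circ> SR_class \<Delta> \<in> ring_hom R Q"
    using ring_hom_trans[of "SR_class \<Delta>" R "SR_ring \<Delta>" "(+>\<^bsub>SR_ring \<Delta>\<^esub>) T" Q]
      ring_hom_ring.homh[OF hom_I] ring_hom_ring.homh[OF hom_T] by blast
  ultimately show ?thesis
    using ring_hom_ringI2[OF ring_hom_ring.axioms(1)[OF hom_I] ring_hom_ring.axioms(2)[OF hom_T]] by simp
qed

sublocale \<rho>: ring_hom_ring R Q \<rho> by (rule hom_\<rho>)

lemma \<rho>_zero_iff: "p \<in> carrier R \<Longrightarrow> \<rho> p = \<zero>\<^bsub>Q\<^esub> \<longleftrightarrow> SR_class \<Delta> p \<in> T"
proof -
  assume p: "p \<in> carrier R"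
  have "\<zero>\<^bsub>Q\<^esub> = T" by (simp add: SR_reduction_def FactRing_def)
  then show ?thesis
    using ideal.rcos_const_imp_mem[OF ideal_T ring_hom_closed[OF ring_hom_ring.homh[OF hom_I] p]]
      ring.a_rcos_zero[OF ring_hom_ring.axioms(2)[OF hom_I] ideal_T]
    by (auto simp: reduction_class_def)
qed

lemma \<rho>_nonface: "N \<subseteq> V \<Longrightarrow> N \<notin> \<Delta> \<Longrightarrow> \<rho> (xm N) = \<zero>\<^bsub>Q\<^esub>"
proof -
  assume N: "N \<subseteq> V" "N \<notin> \<Delta>"
  have "xm N \<in> SR_gens"
    unfolding SR_gens_def using N prod_mvar[OF finite_subset[OF N(1) finite_V], where 'b = 'l, symmetric] by blast
  then have "xm N \<in> I"
    using R.genideal_self[OF SR_gens_carrier] unfolding SR_ideal_def SR_gens_def[symmetric] by blast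
  then have "SR_class \<Delta> (xm N) = I" unfolding SR_class_def by (rule R.a_rcos_zero[OF ideal_I])
  moreover have "I = \<zero>\<^bsub>SR_ring \<Delta>\<^esub>" by (simp add: SR_ring_def FactRing_def)
  moreover have "\<zero>\<^bsub>SR_ring \<Delta>\<^esub> \<in> T" using additive_subgroup.zero_closed[OF ideal.axioms(1)[OF ideal_T]] .
  ultimately show ?thesis using \<rho>_zero_iff[OF xm_carrier[OF N(1)]] by simp
qed

lemma \<rho>_theta: "k \<in> {1..d} \<Longrightarrow> \<rho> (theta \<Delta> \<kappa> k) = \<zero>\<^bsub>Q\<^esub>"
proof -
  assume "k \<in> {1..d}"
  then have "SR_class \<Delta> (theta \<Delta> \<kappa> k) \<in> theta_gens" by (auto simp: theta_gens_def)
  then have "SR_class \<Delta> (theta \<Delta> \<kappa> k) \<in> T"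
    using ring.genideal_self[OF ring_hom_ring.axioms(2)[OF hom_I] theta_gens_carrier]
    unfolding theta_ideal_def theta_gens_def[symmetric] by blast
  then show ?thesis using \<rho>_zero_iff[OF theta_carrier] by simp
qed

text \<open>An ideal containing the kernel of the reduction, from which the dimensions in degree
  \<open>\<ee>\<^sub>k\<close> are read off.\<close>

definition low_ideal :: "('v, 'l) mpoly set"
  where "low_ideal = {p \<in> carrier R. Poly_Mapping.lookup p 0 = 0 \<and>
    (\<forall>u\<in>V. \<forall>v\<in>V. \<kappa> u = \<kappa> v \<longrightarrow>
      Poly_Mapping.lookup p (Poly_Mapping.single u 1) = Poly_Mapping.lookup p (Poly_Mapping.single v 1))}"

lemma low_idealI:
  assumes "p \<in> carrier R" "Poly_Mapping.lookup p 0 = 0"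
    "\<And>u v. u \<in> V \<Longrightarrow> v \<in> V \<Longrightarrow> \<kappa> u = \<kappa> v \<Longrightarrow>
      Poly_Mapping.lookup p (Poly_Mapping.single u 1) = Poly_Mapping.lookup p (Poly_Mapping.single v 1)"
  shows "p \<in> low_ideal"
  using assms unfolding low_ideal_def by blast

lemma low_idealD:
  assumes "p \<in> low_ideal"
  shows "p \<in> carrier R" "Poly_Mapping.lookup p 0 = 0"
    "u \<in> V \<Longrightarrow> v \<in> V \<Longrightarrow> \<kappa> u = \<kappa> v \<Longrightarrow>
      Poly_Mapping.lookup p (Poly_Mapping.single u 1) = Poly_Mapping.lookup p (Poly_Mapping.single v 1)"
  using assms unfolding low_ideal_def by blast+

lemma ideal_low: "ideal low_ideal R"
proof (rule idealI)
  show "ring R" by (rule mpoly_ring_ring)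
  have mult: "x * p \<in> low_ideal" if p: "p \<in> low_ideal" and x: "x \<in> carrier R" for p x
  proof (rule low_idealI)
    show "x * p \<in> carrier R" by (rule mpoly_carrier_mult[OF x low_idealD(1)[OF p]])
    show "Poly_Mapping.lookup (x * p) 0 = 0" by (rule lookup_mult_low(1)[OF low_idealD(2)[OF p]])
    show "Poly_Mapping.lookup (x * p) (Poly_Mapping.single u 1) = Poly_Mapping.lookup (x * p) (Poly_Mapping.single v 1)"
      if "u \<in> V" "v \<in> V" "\<kappa> u = \<kappa> v" for u v
      unfolding lookup_mult_low(2)[OF low_idealD(2)[OF p]] low_idealD(3)[OF p that] ..
  qed
  show "x \<otimes>\<^bsub>R\<^esub> p \<in> low_ideal" "p \<otimes>\<^bsub>R\<^esub> x \<in> low_ideal" if "p \<in> low_ideal" "x \<in> carrier R" for p x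
    using mult[OF that] by (simp_all add: mult.commute)
  have add: "p + q \<in> low_ideal" if "p \<in> low_ideal" "q \<in> low_ideal" for p q
  proof (rule low_idealI)
    show "p + q \<in> carrier R" by (rule mpoly_carrier_add) (use that low_idealD(1) in blast)+
    show "Poly_Mapping.lookup (p + q) 0 = 0" using that low_idealD(2) by (simp add: lookup_add)
    show "Poly_Mapping.lookup (p + q) (Poly_Mapping.single u 1) = Poly_Mapping.lookup (p + q) (Poly_Mapping.single v 1)"
      if uv: "u \<in> V" "v \<in> V" "\<kappa> u = \<kappa> v" for u v
      unfolding lookup_add low_idealD(3)[OF \<open>p \<in> low_ideal\<close> uv] low_idealD(3)[OF \<open>q \<in> low_ideal\<close> uv] ..
  qed
  have zero: "0 \<in> low_ideal" by (simp add: low_ideal_def mpoly_carrier_iff)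
  have neg: "- p \<in> low_ideal" if "p \<in> low_ideal" for p
  proof -
    have "Poly_Mapping.single 0 (- 1 :: 'l) * p = - p" by (simp add: single_uminus single_one)
    then show ?thesis using mult[OF that scalar_in_carrier[of "- 1"]] by simp
  qed
  have inv: "\<ominus>\<^bsub>R\<^esub> p = - p" if "p \<in> carrier R" for p
    using that by (intro R.minus_equality) (auto simp: mpoly_carrier_iff)
  show "subgroup low_ideal (add_monoid R)"
  proof (rule R.add.subgroupI)
    show "low_ideal \<subseteq> carrier R" by (auto simp: low_ideal_def)
    show "low_ideal \<noteq> {}" using zero by blast
    show "\<ominus>\<^bsub>R\<^esub> p \<in> low_ideal" if "p \<in> low_ideal" for p
      using neg[OF that] inv[OF low_idealD(1)[OF that]] by simp
    show "p \<oplus>\<^bsub>R\<^esub> q \<in> low_ideal" if "p \<in> low_ideal" "q \<in> low_ideal" for p q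
      using add[OF that] by simp
  qed
qed

text \<open>The empty set and the single vertices are faces, so a nonface has at least two vertices
  and its monomial is neither constant nor linear.\<close>

lemma SR_ideal_low: "I \<subseteq> low_ideal"
  unfolding SR_ideal_def SR_gens_def[symmetric]
proof (rule R.genideal_minimal[OF ideal_low], rule subsetI)
  fix p assume "p \<in> SR_gens"
  then obtain F where F: "F \<subseteq> V" "F \<notin> \<Delta>" "p = (\<Prod>v\<in>F. mvar v)" by (auto simp: SR_gens_def)
  have fin: "finite F" using finite_subset[OF F(1) finite_V] .
  have p: "p = xm F" using F(3) prod_mvar[OF fin] by simp
  have "F \<noteq> {}" using F(2) cx by (auto simp: simplicial_complex_def)
  then have "sqf F \<noteq> 0" using keys_sqf[OF fin] by auto
  moreover have "sqf F \<noteq> Poly_Mapping.single v 1" if "v \<in> V" for v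
  proof
    assume "sqf F = Poly_Mapping.single v 1"
    then have "F = {v}" using keys_sqf[OF fin] by simp
    moreover have "{v} \<in> \<Delta>" using that cx by (auto simp: simplicial_complex_def)
    ultimately show False using F(2) by simp
  qed
  ultimately have "Poly_Mapping.lookup p 0 = 0" "\<And>v. v \<in> V \<Longrightarrow> Poly_Mapping.lookup p (Poly_Mapping.single v 1) = 0"
    unfolding p lookup_single when_def by (simp_all only: if_False)
  then show "p \<in> low_ideal" using xm_carrier[OF F(1)] by (intro low_idealI) (simp_all add: p)
qed

lemma theta_low: "theta \<Delta> \<kappa> k \<in> low_ideal"
proof -
  have s: "Poly_Mapping.single v (1::nat) \<noteq> 0" for v :: 'v
    by (metis insert_not_empty keys_single keys_zero zero_neq_one)
  have e: "Poly_Mapping.single v (1::nat) = Poly_Mapping.single u 1 \<longleftrightarrow> v = u" for u v :: 'v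
    by (metis keys_single singleton_inject zero_neq_one)
  have t0: "Poly_Mapping.lookup (theta \<Delta> \<kappa> k :: ('v, 'l) mpoly) 0 = 0"
    unfolding theta_def lookup_sum mvar_def using s by (intro sum.neutral) (simp add: lookup_single when_def)
  have t1: "Poly_Mapping.lookup (theta \<Delta> \<kappa> k :: ('v, 'l) mpoly) (Poly_Mapping.single u 1) = (if \<kappa> u = k then 1 else 0)"
    if u: "u \<in> V" for u
  proof -
    have "Poly_Mapping.lookup (theta \<Delta> \<kappa> k :: ('v, 'l) mpoly) (Poly_Mapping.single u 1)
        = (\<Sum>v\<in>{v \<in> V. \<kappa> v = k}. if v = u then 1 else 0)"
      unfolding theta_def lookup_sum mvar_def by (intro sum.cong refl) (simp add: lookup_single when_def e[simplified])
    also have "\<dots> = (if \<kappa> u = k then 1 else 0)" by (subst sum.delta[OF finite_colour]) (use u in auto)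
    finally show ?thesis .
  qed
  show ?thesis
  proof (rule low_idealI[OF theta_carrier t0])
    fix u v assume "u \<in> V" "v \<in> V" "\<kappa> u = \<kappa> v"
    then show "Poly_Mapping.lookup (theta \<Delta> \<kappa> k :: ('v, 'l) mpoly) (Poly_Mapping.single u 1)
        = Poly_Mapping.lookup (theta \<Delta> \<kappa> k) (Poly_Mapping.single v 1)"
      using t1[of u] t1[of v] by simp
  qed
qed

lemma kernel_low:
  assumes p: "p \<in> carrier R" and z: "\<rho> p = \<zero>\<^bsub>Q\<^esub>"
  shows "p \<in> low_ideal"
proof -
  have "ideal (SR_class \<Delta> ` low_ideal) (SR_ring \<Delta>)"
    using R.ring_ideal_imp_quot_ideal[OF ideal_I ideal_low] unfolding SR_class_def[abs_def] SR_ring_def .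
  moreover have "theta_gens \<subseteq> SR_class \<Delta> ` low_ideal" using theta_low by (auto simp: theta_gens_def)
  ultimately have "T \<subseteq> SR_class \<Delta> ` low_ideal"
    unfolding theta_ideal_def theta_gens_def[symmetric]
    by (rule ring.genideal_minimal[OF ring_hom_ring.axioms(2)[OF hom_I]])
  then obtain q where q: "q \<in> low_ideal" "SR_class \<Delta> p = SR_class \<Delta> q"
    using \<rho>_zero_iff[OF p] z by blast
  have qc: "q \<in> carrier R" using q(1) by (simp add: low_ideal_def)
  have "p \<ominus>\<^bsub>R\<^esub> q \<in> I" using R.quotient_eq_iff_same_a_r_cos[OF ideal_I p qc] q(2) by (simp add: SR_class_def)
  then have "p \<ominus>\<^bsub>R\<^esub> q \<in> low_ideal" using SR_ideal_low by blast
  then have "(p \<ominus>\<^bsub>R\<^esub> q) \<oplus>\<^bsub>R\<^esub> q \<in> low_ideal"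
    using q(1) additive_subgroup.a_closed[OF ideal.axioms(1)[OF ideal_low]] by blast
  moreover have "(p \<ominus>\<^bsub>R\<^esub> q) \<oplus>\<^bsub>R\<^esub> q = p" using p qc by (simp add: R.minus_eq R.a_assoc R.l_neg del: mpoly_ring_simps)
  ultimately show ?thesis by simp
qed

lemma one_not_zero: "\<one>\<^bsub>Q\<^esub> \<noteq> \<zero>\<^bsub>Q\<^esub>"
proof
  assume "\<one>\<^bsub>Q\<^esub> = \<zero>\<^bsub>Q\<^esub>"
  then have "\<rho> 1 = \<zero>\<^bsub>Q\<^esub>" using \<rho>.hom_one by simp
  moreover have "1 \<in> carrier R" using R.one_closed by simp
  ultimately have "1 \<in> low_ideal" by (intro kernel_low)
  then show False by (simp add: low_ideal_def lookup_one)
qed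

lemma scalars_Q: "subfield (\<rho> ` scalars) Q"
  by (rule \<rho>.img_is_subfield(2)[OF scalars_subfield one_not_zero])

definition spanned :: "('v set \<Rightarrow> ('v, 'l) mpoly) \<Rightarrow> 'v set set \<Rightarrow> ('v, 'l) mpoly set"
  where "spanned x B = {p \<in> carrier R. \<rho> p \<in> \<rho> ` span_set B x}"

lemma spanned_lin:
  assumes B: "x ` B \<subseteq> carrier R" and p: "p \<in> spanned x B" and q: "q \<in> spanned x B"
  shows "Poly_Mapping.single 0 a * p + q \<in> spanned x B"
proof -
  obtain v w where vw: "v \<in> span_set B x" "w \<in> span_set B x" "\<rho> p = \<rho> w" "\<rho> q = \<rho> v"
    using p q by (auto simp: spanned_def)
  have c: "p \<in> carrier R" "q \<in> carrier R" "v \<in> carrier R" "w \<in> carrier R"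
    using p q vw span_set_carrier[OF B] by (auto simp: spanned_def)
  have hom: "\<rho> (Poly_Mapping.single 0 a * s + t) = \<rho> (Poly_Mapping.single 0 a) \<otimes>\<^bsub>Q\<^esub> \<rho> s \<oplus>\<^bsub>Q\<^esub> \<rho> t"
    if "s \<in> carrier R" "t \<in> carrier R" for s t
    using \<rho>.hom_add[OF mpoly_carrier_mult[OF scalar_in_carrier that(1)] that(2)]
      \<rho>.hom_mult[OF scalar_in_carrier that(1)] by (simp only: mpoly_ring_simps)
  have "\<rho> (Poly_Mapping.single 0 a * p + q) = \<rho> (Poly_Mapping.single 0 a * w + v)"
    using hom c vw by simp
  moreover have "Poly_Mapping.single 0 a * w + v \<in> span_set B x" using span_set_closed vw by blast
  moreover have "Poly_Mapping.single 0 a * p + q \<in> carrier R"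
    using c by (intro mpoly_carrier_add mpoly_carrier_mult scalar_in_carrier)
  ultimately show ?thesis by (auto simp: spanned_def)
qed

lemma spanned_0: "0 \<in> spanned x B"
proof -
  have "(\<Sum>b\<in>B. Poly_Mapping.single 0 0 * x b) \<in> span_set B x" by (rule span_setI[where c = "\<lambda>_. 0"])
  then show ?thesis by (auto simp: spanned_def mpoly_carrier_iff)
qed

lemma spanned_sum:
  assumes B: "x ` B \<subseteq> carrier R" and p: "\<And>i. i \<in> J \<Longrightarrow> p i \<in> spanned x B"
  shows "(\<Sum>i\<in>J. Poly_Mapping.single 0 (a i) * p i) \<in> spanned x B"
  using p
proof (induction J rule: infinite_finite_induct)
  case (insert i J)
  have "Poly_Mapping.single 0 (a i) * p i + (\<Sum>i\<in>J. Poly_Mapping.single 0 (a i) * p i) \<in> spanned x B"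
    by (rule spanned_lin[OF B]) (use insert in auto)
  then show ?case using insert.hyps by simp
qed (auto simp: spanned_0)

lemma finite_rainbow_V: "W \<subseteq> V \<Longrightarrow> finite (rainbow W \<kappa> S)"
  by (rule finite_rainbow) (rule finite_subset[OF _ finite_V])

text \<open>The product of \<open>theta \<Delta> \<kappa> i\<close> with the monomial of
  \<open>A - {\<beta> i}\<close> vanishes in the reduction. It replaces the monomial of
  \<open>A\<close> by monomials with another vertex of colour \<open>i\<close>, hence with one
  eliminated vertex fewer. Nonfaces may remain among the spanning sets; \<open>rainbow_faces\<close>
  exploits this.\<close>

lemma rainbow_spanned:
  fixes \<beta> :: "nat \<Rightarrow> 'v"
  assumes S: "S \<subseteq> {1..d}" and \<beta>: "\<And>i. i \<in> S \<Longrightarrow> \<beta> i \<in> V \<and> \<kappa> (\<beta> i) = i" and A: "A \<in> rainbow V \<kappa> S"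
  shows "xm A \<in> spanned xm (rainbow (V - \<beta> ` S) \<kappa> S)"
  using A
proof (induction "card (A \<inter> \<beta> ` S)" arbitrary: A rule: less_induct)
  case less
  let ?B = "rainbow (V - \<beta> ` S) \<kappa> S"
  have Bc: "xm ` ?B \<subseteq> carrier R" using xm_carrier by (auto simp: rainbow_def)
  have AV: "A \<subseteq> V" "inj_on \<kappa> A" "\<kappa> ` A = S" using less.prems by (auto simp: rainbow_def)
  have finA: "finite A" using finite_subset[OF AV(1) finite_V] .
  show ?case
  proof (cases "A \<inter> \<beta> ` S = {}")
    case True
    then have A: "A \<in> ?B" using less.prems by (auto simp: rainbow_def)
    have "(\<Sum>B\<in>?B. Poly_Mapping.single 0 (if B = A then 1 else 0) * xm B) = (\<Sum>B\<in>?B. if B = A then xm A else 0)"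
      by (intro sum.cong refl) (auto simp: mult_single)
    also have "\<dots> = xm A" using A finite_rainbow_V[of "V - \<beta> ` S" S] by (simp add: sum.delta)
    finally have "xm A \<in> span_set ?B xm" using span_setI[of "\<lambda>B. if B = A then 1 else 0" xm ?B] by simp
    then show ?thesis using xm_carrier[OF AV(1)] by (auto simp: spanned_def)
  next
    case False
    then obtain i where i: "i \<in> S" "\<beta> i \<in> A" by auto
    define H where "H = A - {\<beta> i}"
    have finH: "finite H" using finA by (simp add: H_def)
    have HV: "H \<subseteq> V" using AV by (auto simp: H_def)
    let ?Vi = "{v \<in> V. \<kappa> v = i}"
    have notH: "v \<notin> H" if "v \<in> ?Vi" for v
    proof
      assume v: "v \<in> H"
      then have "v = \<beta> i" using inj_onD[OF AV(2), of v "\<beta> i"] i \<beta>[OF i(1)] that by (auto simp: H_def)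
      then show False using v by (simp add: H_def)
    qed
    have tr: "insert v H \<in> rainbow V \<kappa> S" if "v \<in> ?Vi" for v
    proof -
      have "\<kappa> ` insert v H = S" using AV(3) i \<beta>[OF i(1)] that by (auto simp: H_def)
      moreover have "inj_on \<kappa> (insert v H)"
      proof -
        have "inj_on \<kappa> H" using AV(2) by (auto simp: H_def intro: inj_on_subset)
        moreover have "\<kappa> v \<notin> \<kappa> ` H"
        proof
          assume "\<kappa> v \<in> \<kappa> ` H"
          then obtain u where u: "u \<in> H" "\<kappa> u = \<kappa> v" by auto
          then have "u \<in> ?Vi" using HV that by auto
          then show False using notH u(1) by blast
        qed
        ultimately show ?thesis by (simp add: inj_on_insert) auto
      qed
      ultimately show ?thesis using HV that by (auto simp: rainbow_def)
    qed
    have x_insert: "xm (insert v H) = xm H * mvar v" if "v \<in> ?Vi" for v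
      using notH[OF that] finH sqf_Un[of H "{v}"] by (simp add: mvar_sqf mult_single)
    have "xm H * theta \<Delta> \<kappa> i = (\<Sum>v\<in>?Vi. xm (insert v H))"
      unfolding theta_def sum_distrib_left using x_insert by (intro sum.cong) auto
    also have "\<dots> = xm (insert (\<beta> i) H) + (\<Sum>v\<in>?Vi - {\<beta> i}. xm (insert v H))"
      by (rule sum.remove[OF finite_colour]) (use \<beta>[OF i(1)] in auto)
    also have "insert (\<beta> i) H = A" using i by (auto simp: H_def)
    finally have rel: "xm H * theta \<Delta> \<kappa> i = xm A + (\<Sum>v\<in>?Vi - {\<beta> i}. xm (insert v H))" .
    let ?p = "\<Sum>v\<in>?Vi - {\<beta> i}. Poly_Mapping.single 0 (- 1) * xm (insert v H)"
    have p: "?p \<in> spanned xm ?B"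
    proof (rule spanned_sum[OF Bc])
      fix v assume v: "v \<in> ?Vi - {\<beta> i}"
      show "xm (insert v H) \<in> spanned xm ?B"
      proof (rule less.hyps)
        have "v \<notin> \<beta> ` S" using v \<beta> by auto
        then have "insert v H \<inter> \<beta> ` S = A \<inter> \<beta> ` S - {\<beta> i}" by (auto simp: H_def)
        moreover have "card (A \<inter> \<beta> ` S - {\<beta> i}) < card (A \<inter> \<beta> ` S)"
          using finA i by (intro card_Diff1_less) auto
        ultimately show "card (insert v H \<inter> \<beta> ` S) < card (A \<inter> \<beta> ` S)" by simp
        show "insert v H \<in> rainbow V \<kappa> S" using tr v by blast
      qed
    qed
    have "?p = - (\<Sum>v\<in>?Vi - {\<beta> i}. xm (insert v H))"
      by (simp add: mult_single single_uminus sum_negf)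
    then have e: "xm A = xm H * theta \<Delta> \<kappa> i + ?p" using rel by simp
    have pc: "?p \<in> carrier R" using p by (simp add: spanned_def)
    have th: "theta \<Delta> \<kappa> i \<in> carrier R" by (rule theta_carrier)
    have "\<rho> (xm A) = \<rho> (xm H) \<otimes>\<^bsub>Q\<^esub> \<rho> (theta \<Delta> \<kappa> i) \<oplus>\<^bsub>Q\<^esub> \<rho> ?p"
      using \<rho>.hom_add[OF mpoly_carrier_mult[OF xm_carrier[OF HV] th] pc] \<rho>.hom_mult[OF xm_carrier[OF HV] th]
      by (simp only: e mpoly_ring_simps)
    also have "\<dots> = \<rho> ?p"
      using \<rho>_theta[of i] i(1) S \<rho>.hom_closed[OF xm_carrier[OF HV]] \<rho>.hom_closed[OF pc] by auto
    finally have "\<rho> (xm A) = \<rho> ?p" .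
    then show ?thesis using p xm_carrier[OF AV(1)] by (auto simp: spanned_def)
  qed
qed

lemma image_graded:
  fixes \<beta> :: "nat \<Rightarrow> 'v"
  assumes S: "S \<subseteq> {1..d}" and \<beta>: "\<And>i. i \<in> S \<Longrightarrow> \<beta> i \<in> V \<and> \<kappa> (\<beta> i) = i"
  shows "\<rho> ` graded_component V \<kappa> (indicator S) = \<rho> ` span_set (rainbow (V - \<beta> ` S) \<kappa> S) xm"
proof (intro equalityI subsetI)
  let ?B = "rainbow (V - \<beta> ` S) \<kappa> S"
  have Bc: "xm ` ?B \<subseteq> carrier R" using xm_carrier by (auto simp: rainbow_def)
  fix y assume "y \<in> \<rho> ` graded_component V \<kappa> (indicator S)"
  then obtain c where y: "y = \<rho> (\<Sum>A\<in>rainbow V \<kappa> S. Poly_Mapping.single 0 (c A) * xm A)"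
    unfolding graded_component_squarefree[OF finite_V] by (auto simp: span_set_def)
  have "(\<Sum>A\<in>rainbow V \<kappa> S. Poly_Mapping.single 0 (c A) * xm A) \<in> spanned xm ?B"
    using rainbow_spanned[OF S \<beta>] by (intro spanned_sum[OF Bc])
  then show "y \<in> \<rho> ` span_set ?B xm" unfolding y by (simp add: spanned_def)
next
  let ?B = "rainbow (V - \<beta> ` S) \<kappa> S"
  fix y assume "y \<in> \<rho> ` span_set ?B xm"
  then obtain c where y: "y = \<rho> (\<Sum>A\<in>?B. Poly_Mapping.single 0 (c A) * xm A)" by (auto simp: span_set_def)
  have "(\<Sum>A\<in>?B. Poly_Mapping.single 0 (c A) * xm A)
      = (\<Sum>A\<in>rainbow V \<kappa> S. Poly_Mapping.single 0 (if A \<in> ?B then c A else 0) * xm A)"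
    by (rule sum.mono_neutral_cong_left) (use finite_rainbow_V[of V S] in \<open>auto simp: rainbow_def\<close>)
  then have "(\<Sum>A\<in>?B. Poly_Mapping.single 0 (c A) * xm A) \<in> span_set (rainbow V \<kappa> S) xm"
    by (simp only: span_setI)
  then show "y \<in> \<rho> ` graded_component V \<kappa> (indicator S)"
    unfolding graded_component_squarefree[OF finite_V] y by (rule imageI)
qed

lemma reduction_dim_eq:
  assumes "ring.dimension Q m (\<rho> ` scalars) (\<rho> ` graded_component V \<kappa> (indicator S))"
  shows "reduction_dim K d \<Delta> \<kappa> S = m"
  using \<rho>.S.dimI[OF scalars_Q assms] by (simp add: reduction_dim_def over_def)

lemma card_colour: "card {x \<in> V - \<beta> ` S. \<kappa> x = i} = card {x \<in> V. \<kappa> x = i} - 1"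
  if "i \<in> S" "\<And>i. i \<in> S \<Longrightarrow> \<beta> i \<in> V \<and> \<kappa> (\<beta> i) = i" for \<beta> :: "nat \<Rightarrow> 'v"
proof -
  have "{x \<in> V - \<beta> ` S. \<kappa> x = i} = {x \<in> V. \<kappa> x = i} - {\<beta> i}" using that by auto
  then show ?thesis using that finite_V by simp
qed

text \<open>The spanning monomials are independent: a relation lies in \<open>low_ideal\<close>, so
  its linear coefficients are constant on the colour class, and the one at the eliminated vertex
  \<open>v\<close> is 0.\<close>

lemma reduction_dim_singleton:
  assumes k: "k \<in> {1..d}" and v: "v \<in> V" "\<kappa> v = k"
  shows "reduction_dim K d \<Delta> \<kappa> {k} = card {x \<in> V. \<kappa> x = k} - 1"
proof -
  let ?B = "rainbow (V - {v}) \<kappa> {k}"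
  have B: "?B = (\<lambda>u. {u}) ` {u \<in> V - {v}. \<kappa> u = k}"
  proof (intro equalityI subsetI)
    fix A assume A: "A \<in> ?B"
    then obtain u where u: "u \<in> A" by (auto simp: rainbow_def)
    have "w = u" if w: "w \<in> A" for w
    proof -
      have "\<kappa> w \<in> \<kappa> ` A" "\<kappa> u \<in> \<kappa> ` A" using w u by blast+
      then have "\<kappa> w = \<kappa> u" using A by (simp add: rainbow_def)
      then show ?thesis using A w u by (auto simp: rainbow_def dest: inj_onD)
    qed
    then have "A = {u}" using u by blast
    then show "A \<in> (\<lambda>u. {u}) ` {u \<in> V - {v}. \<kappa> u = k}" using A by (auto simp: rainbow_def)
  qed (auto simp: rainbow_def)
  have finB: "finite ?B" by (rule finite_rainbow_V) auto
  have Bc: "xm ` ?B \<subseteq> carrier R" using xm_carrier by (auto simp: rainbow_def)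
  have ind: "\<forall>A\<in>?B. c A = 0" if z: "\<rho> (\<Sum>A\<in>?B. Poly_Mapping.single 0 (c A) * xm A) = \<zero>\<^bsub>Q\<^esub>" for c
  proof
    fix A assume A: "A \<in> ?B"
    then obtain u where u: "A = {u}" "u \<in> V" "u \<noteq> v" "\<kappa> u = k" unfolding B by auto
    let ?p = "\<Sum>A\<in>?B. Poly_Mapping.single (sqf A) (c A)"
    have p: "(\<Sum>A\<in>?B. Poly_Mapping.single 0 (c A) * xm A) = ?p" by (simp add: mult_single)
    have "?p \<in> carrier R"
      unfolding p[symmetric] using Bc by (intro mpoly_carrier_sum mpoly_carrier_mult scalar_in_carrier) auto
    then have "?p \<in> low_ideal" using z p kernel_low by simp
    then have "Poly_Mapping.lookup ?p (Poly_Mapping.single u 1) = Poly_Mapping.lookup ?p (Poly_Mapping.single v 1)"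
      by (rule low_idealD(3)) (use u v in auto)
    moreover have "Poly_Mapping.single w (1::nat) = sqf {w}" for w :: 'v by (simp add: sqf_def)
    moreover have "Poly_Mapping.lookup ?p (sqf {u}) = c A"
      using A u by (simp add: lookup_sqf_sum[OF finite_subset[OF Diff_subset finite_V]] keys_sqf)
    moreover have "sqf {v} \<notin> sqf ` ?B"
    proof
      assume "sqf {v} \<in> sqf ` ?B"
      then obtain w where "w \<noteq> v" "sqf {v} = sqf {w}" unfolding B by auto
      then show False by (simp add: sqf_eq_iff)
    qed
    then have "Poly_Mapping.lookup ?p (sqf {v}) = 0"
      by (simp add: lookup_sqf_sum[OF finite_subset[OF Diff_subset finite_V]])
    ultimately show "c A = 0" by simp
  qed
  have "\<rho> ` graded_component V \<kappa> (indicator {k}) = \<rho> ` span_set ?B xm"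
    using image_graded[of "{k}" "\<lambda>_. v"] k v by simp
  moreover have "ring.dimension Q (card ?B) (\<rho> ` scalars) (\<rho> ` span_set ?B xm)"
    using dimension_image_span_set[OF hom_\<rho> finB Bc] ind by blast
  ultimately have "reduction_dim K d \<Delta> \<kappa> {k} = card ?B" by (intro reduction_dim_eq) simp
  also have "card ?B = card {x \<in> V. \<kappa> x = k} - 1"
  proof -
    have "{u \<in> V - {v}. \<kappa> u = k} = {x \<in> V. \<kappa> x = k} - {v}" by auto
    then have "card {u \<in> V - {v}. \<kappa> u = k} = card {x \<in> V. \<kappa> x = k} - 1" using v finite_V by simp
    then show ?thesis unfolding B by (simp add: card_image)
  qed
  finally show ?thesis .
qed

text \<open>If a rainbow set \<open>N\<close> is not a face, choose the eliminated vertices outside \<open>N\<close>: then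
  \<open>x\<^sub>N\<close> is one of the spanning monomials, and it vanishes.\<close>

lemma rainbow_faces:
  assumes S: "S \<subseteq> {1..d}" and two: "\<And>i. i \<in> S \<Longrightarrow> card {x \<in> V. \<kappa> x = i} \<ge> 2"
    and dim: "reduction_dim K d \<Delta> \<kappa> S = (\<Prod>i\<in>S. card {x \<in> V. \<kappa> x = i} - 1)"
  shows "rainbow V \<kappa> S \<subseteq> \<Delta>"
proof (rule subsetI, rule ccontr)
  fix N assume N: "N \<in> rainbow V \<kappa> S" and nf: "N \<notin> \<Delta>"
  have finS: "finite S" using finite_subset[OF S] by simp
  \<comment> \<open>A rainbow set uses only one vertex of each colour, and each class has at least
    two.\<close>
  have "\<forall>i\<in>S. \<exists>v. v \<in> V \<and> \<kappa> v = i \<and> v \<notin> N"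
  proof (rule ballI, rule ccontr)
    fix i assume i: "i \<in> S" and "\<not> (\<exists>v. v \<in> V \<and> \<kappa> v = i \<and> v \<notin> N)"
    then have sub: "{x \<in> V. \<kappa> x = i} \<subseteq> {x \<in> N. \<kappa> x = i}" by blast
    obtain u where u: "u \<in> N" "\<kappa> u = i" using N i by (auto simp: rainbow_def)
    have "{x \<in> N. \<kappa> x = i} \<subseteq> {u}" using N u by (auto simp: rainbow_def inj_on_def)
    then have "card {x \<in> V. \<kappa> x = i} \<le> card {u}" using sub by (intro card_mono) auto
    then show False using two[OF i] by simp
  qed
  from bchoice[OF this] obtain \<beta> where "\<forall>i\<in>S. \<beta> i \<in> V \<and> \<kappa> (\<beta> i) = i \<and> \<beta> i \<notin> N" ..
  then have \<beta>: "\<And>i. i \<in> S \<Longrightarrow> \<beta> i \<notin> N" and \<beta>': "\<And>i. i \<in> S \<Longrightarrow> \<beta> i \<in> V \<and> \<kappa> (\<beta> i) = i"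
    by simp_all
  let ?B = "rainbow (V - \<beta> ` S) \<kappa> S"
  have "N \<inter> \<beta> ` S = {}" using \<beta> by blast
  moreover have "N \<subseteq> V" "inj_on \<kappa> N" "\<kappa> ` N = S" using N by (auto simp: rainbow_def)
  ultimately have NB: "N \<in> ?B" unfolding rainbow_def by blast
  have finB: "finite ?B" by (rule finite_rainbow_V) auto
  have Bc: "xm ` ?B \<subseteq> carrier R" using xm_carrier by (auto simp: rainbow_def)
  have NV: "N \<subseteq> V" using N by (auto simp: rainbow_def)
  have "\<rho> ` span_set ?B xm = \<rho> ` span_set (?B - {N}) xm"
  proof (intro equalityI subsetI)
    fix y assume "y \<in> \<rho> ` span_set ?B xm"
    then obtain c where y: "y = \<rho> (\<Sum>A\<in>?B. Poly_Mapping.single 0 (c A) * xm A)" by (auto simp: span_set_def)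
    let ?r = "\<Sum>A\<in>?B - {N}. Poly_Mapping.single 0 (c A) * xm A"
    have rc: "?r \<in> carrier R" using Bc by (intro mpoly_carrier_sum mpoly_carrier_mult scalar_in_carrier) auto
    have "(\<Sum>A\<in>?B. Poly_Mapping.single 0 (c A) * xm A) = Poly_Mapping.single 0 (c N) * xm N + ?r"
      using finB NB by (rule sum.remove)
    then have "y = \<rho> (Poly_Mapping.single 0 (c N)) \<otimes>\<^bsub>Q\<^esub> \<rho> (xm N) \<oplus>\<^bsub>Q\<^esub> \<rho> ?r"
      using y \<rho>.hom_add[OF mpoly_carrier_mult[OF scalar_in_carrier xm_carrier[OF NV]] rc]
        \<rho>.hom_mult[OF scalar_in_carrier xm_carrier[OF NV]] by (simp only: mpoly_ring_simps)
    also have "\<dots> = \<rho> ?r"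
      using \<rho>_nonface[OF NV nf] \<rho>.hom_closed[OF scalar_in_carrier] \<rho>.hom_closed[OF rc] by simp
    finally have "y = \<rho> ?r" .
    then show "y \<in> \<rho> ` span_set (?B - {N}) xm" by (simp only: span_setI imageI)
  next
    fix y assume "y \<in> \<rho> ` span_set (?B - {N}) xm"
    then obtain c where y: "y = \<rho> (\<Sum>A\<in>?B - {N}. Poly_Mapping.single 0 (c A) * xm A)" by (auto simp: span_set_def)
    have "(\<Sum>A\<in>?B - {N}. Poly_Mapping.single 0 (c A) * xm A)
        = (\<Sum>A\<in>?B. Poly_Mapping.single 0 (if A = N then 0 else c A) * xm A)"
      using finB by (intro sum.mono_neutral_cong_left) auto
    then have "(\<Sum>A\<in>?B - {N}. Poly_Mapping.single 0 (c A) * xm A) \<in> span_set ?B xm"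
      by (simp only: span_setI)
    then show "y \<in> \<rho> ` span_set ?B xm" unfolding y by (rule imageI)
  qed
  then have "\<rho> ` graded_component V \<kappa> (indicator S) = \<rho> ` span_set (?B - {N}) xm"
    using image_graded[OF S \<beta>'] by simp
  moreover obtain m where "m \<le> card (?B - {N})" "ring.dimension Q m (\<rho> ` scalars) (\<rho> ` span_set (?B - {N}) xm)"
    using dimension_image_span_set[OF hom_\<rho>, of "?B - {N}" xm] finB Bc by blast
  \<comment> \<open>Without the vanishing monomial there are fewer generators than the assumed
    dimension.\<close>
  ultimately have "reduction_dim K d \<Delta> \<kappa> S \<le> card (?B - {N})" using reduction_dim_eq by metis
  also have "\<dots> < card ?B" using finB NB by (intro card_Diff1_less)
  also have "card ?B = (\<Prod>i\<in>S. card {x \<in> V - \<beta> ` S. \<kappa> x = i})"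
    by (intro card_rainbow finS finite_subset[OF _ finite_V]) blast
  also have "\<dots> = (\<Prod>i\<in>S. card {x \<in> V. \<kappa> x = i} - 1)"
    using card_colour[where \<beta> = \<beta> and S = S] \<beta>' by (intro prod.cong refl) blast
  finally show False using dim by simp
qed

end

section \<open>From vertices to variables, and the conclusion\<close>

lemma bij_betw_rainbow:
  assumes bij: "bij_betw \<xi> X Y" and col: "\<And>x. x \<in> X \<Longrightarrow> \<kappa> (\<xi> x) = c x"
  shows "bij_betw ((`) \<xi>) (rainbow X c S) (rainbow Y \<kappa> S)"
proof (rule bij_betw_imageI)
  have inj: "inj_on \<xi> X" and img: "\<xi> ` X = Y" using bij by (auto simp: bij_betw_def)
  have eq: "\<kappa> ` \<xi> ` A = c ` A" if "A \<subseteq> X" for A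
    using col that by (force simp: image_image)
  have inj_eq: "inj_on \<kappa> (\<xi> ` A) \<longleftrightarrow> inj_on c A" if "A \<subseteq> X" for A
  proof -
    have "inj_on \<kappa> (\<xi> ` A) \<longleftrightarrow> inj_on (\<kappa> \<circ> \<xi>) A"
      using inj_on_subset[OF inj that] by (metis comp_inj_on inj_on_imageI)
    also have "\<dots> \<longleftrightarrow> inj_on c A" using col that by (intro inj_on_cong) auto
    finally show ?thesis .
  qed
  show "inj_on ((`) \<xi>) (rainbow X c S)"
    using inj_on_image_Pow[OF inj] by (rule inj_on_subset) (auto simp: rainbow_def)
  show "(`) \<xi> ` rainbow X c S = rainbow Y \<kappa> S"
  proof (intro equalityI subsetI)
    fix B assume "B \<in> (`) \<xi> ` rainbow X c S"
    then obtain A where "B = \<xi> ` A" "A \<subseteq> X" "inj_on c A" "c ` A = S" by (auto simp: rainbow_def)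
    then show "B \<in> rainbow Y \<kappa> S" using eq inj_eq img by (auto simp: rainbow_def)
  next
    fix B assume B: "B \<in> rainbow Y \<kappa> S"
    then obtain A where A: "A \<subseteq> X" "B = \<xi> ` A"
      using img by (auto simp: rainbow_def subset_image_iff)
    then have "A \<in> rainbow X c S" using B eq inj_eq by (auto simp: rainbow_def)
    then show "B \<in> (`) \<xi> ` rainbow X c S" using A(2) by blast
  qed
qed

lemma exists_bij_variables:
  assumes fin: "finite V" and col: "\<kappa> ` V \<subseteq> {1..d}"
    and \<beta>: "\<And>i. i \<in> {1..d} \<Longrightarrow> \<beta> i \<in> V \<and> \<kappa> (\<beta> i) = i"
    and card: "\<And>i. i \<in> {1..d} \<Longrightarrow> card {x \<in> V. \<kappa> x = i} = n i + 1"
  obtains \<xi> where "bij_betw \<xi> (variables d n) (V - \<beta> ` {1..d})"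
    "\<And>x. x \<in> variables d n \<Longrightarrow> \<kappa> (\<xi> x) = fst x"
proof -
  have "\<exists>h. bij_betw h {1..n i} ({x \<in> V. \<kappa> x = i} - {\<beta> i})" if i: "i \<in> {1..d}" for i
  proof -
    have "card ({x \<in> V. \<kappa> x = i} - {\<beta> i}) = n i" using card[OF i] \<beta>[OF i] fin by simp
    then show ?thesis
      using ex_bij_betw_nat_finite_1[of "{x \<in> V. \<kappa> x = i} - {\<beta> i}"] fin by simp
  qed
  then have "\<forall>i\<in>{1..d}. \<exists>h. bij_betw h {1..n i} ({x \<in> V. \<kappa> x = i} - {\<beta> i})" by simp
  from bchoice[OF this] obtain h where
    h: "\<forall>i\<in>{1..d}. bij_betw (h i) {1..n i} ({x \<in> V. \<kappa> x = i} - {\<beta> i})" ..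
  define \<xi> where "\<xi> x = h (fst x) (snd x)" for x
  have inj: "inj_on (h i) {1..n i}" and img: "h i ` {1..n i} = {x \<in> V. \<kappa> x = i} - {\<beta> i}"
    if "i \<in> {1..d}" for i using h that by (auto simp: bij_betw_def)
  have mem: "\<xi> x \<in> V \<and> \<kappa> (\<xi> x) = fst x \<and> \<xi> x \<noteq> \<beta> (fst x)" if "x \<in> variables d n" for x
  proof -
    have x: "fst x \<in> {1..d}" "snd x \<in> {1..n (fst x)}" using that by (auto simp: variables_def)
    then have "\<xi> x \<in> h (fst x) ` {1..n (fst x)}" by (simp only: \<xi>_def imageI)
    then show ?thesis unfolding img[OF x(1)] by simp
  qed
  have "bij_betw \<xi> (variables d n) (V - \<beta> ` {1..d})"
  proof (rule bij_betw_imageI)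
    show "inj_on \<xi> (variables d n)"
    proof (rule inj_onI)
      fix x y assume x: "x \<in> variables d n" and y: "y \<in> variables d n" and eq: "\<xi> x = \<xi> y"
      then have f: "fst x = fst y" using mem by metis
      then have "h (fst x) (snd x) = h (fst x) (snd y)" using eq by (simp add: \<xi>_def)
      then have "snd x = snd y" using inj[of "fst x"] x y f
        by (intro inj_onD[OF inj[of "fst x"]]) (auto simp: variables_def)
      with f show "x = y" by (simp add: prod_eq_iff)
    qed
    show "\<xi> ` variables d n = V - \<beta> ` {1..d}"
    proof (intro equalityI subsetI)
      fix y assume "y \<in> \<xi> ` variables d n"
      then obtain x where x: "x \<in> variables d n" "y = \<xi> x" by blast
      have "y \<notin> \<beta> ` {1..d}"
      proof
        assume "y \<in> \<beta> ` {1..d}"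
        then obtain i where i: "i \<in> {1..d}" "y = \<beta> i" by blast
        then have "fst x = i" using mem[OF x(1)] \<beta>[OF i(1)] x(2) by metis
        then show False using mem[OF x(1)] i(2) x(2) by simp
      qed
      then show "y \<in> V - \<beta> ` {1..d}" using mem[OF x(1)] x(2) by simp
    next
      fix y assume y: "y \<in> V - \<beta> ` {1..d}"
      then have i: "\<kappa> y \<in> {1..d}" using col by blast
      then have "y \<in> h (\<kappa> y) ` {1..n (\<kappa> y)}" using y img[OF i] by blast
      then obtain j where j: "j \<in> {1..n (\<kappa> y)}" "y = h (\<kappa> y) j" by blast
      then have "y = \<xi> (\<kappa> y, j)" "(\<kappa> y, j) \<in> variables d n" using i by (auto simp: \<xi>_def variables_def)
      then show "y \<in> \<xi> ` variables d n" by (rule image_eqI)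
    qed
  qed
  then show ?thesis using mem that by blast
qed

lemma rainbow_Diff_eq:
  "rainbow (V - W) \<kappa> S = {G \<in> rainbow V \<kappa> S. G \<inter> W = {}}"
  by (auto simp: rainbow_def)

text \<open>By the dimension there is a face with \<open>d\<close> vertices, and a proper coloring
  gives them \<open>d\<close> distinct colours.\<close>

lemma exists_vertex_of_colour:
  assumes cx: "simplicial_complex \<Delta>" and dim: "complex_dim \<Delta> = int d - 1"
    and col: "proper_coloring d \<Delta> \<kappa>" and i: "i \<in> {1..d}"
  shows "\<exists>v. v \<in> \<Union>\<Delta> \<and> \<kappa> v = i"
proof -
  have \<Delta>: "finite \<Delta>" "{} \<in> \<Delta>" using cx by (auto simp: simplicial_complex_def)
  then have "Max (card ` \<Delta>) \<in> card ` \<Delta>" by (intro Max_in) auto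
  then obtain F where F: "F \<in> \<Delta>" "card F = d" using dim by (auto simp: complex_dim_def)
  have pair: "{u, v} \<in> \<Delta>" if "u \<in> F" "v \<in> F" for u v
    using cx F(1) that by (simp add: simplicial_complex_def)
  have "inj_on \<kappa> F"
  proof (rule inj_onI, rule ccontr)
    fix u v assume "u \<in> F" "v \<in> F" "\<kappa> u = \<kappa> v" "u \<noteq> v"
    then show False using pair[of u v] col unfolding proper_coloring_def by blast
  qed
  then have "card (\<kappa> ` F) = d" using F(2) by (simp add: card_image)
  moreover have "\<kappa> ` F \<subseteq> {1..d}"
    using image_mono[OF Union_upper[OF F(1)]] col[unfolded proper_coloring_def, THEN conjunct1]
    by (rule subset_trans)
  ultimately have "\<kappa> ` F = {1..d}" by (intro card_subset_eq) auto
  then have "i \<in> \<kappa> ` F" using i by simp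
  then obtain v where "v \<in> F" "\<kappa> v = i" by (elim imageE) simp
  then show ?thesis using F(1) by (intro exI[of _ v] conjI UnionI)
qed

text \<open>For \<open>d = 1\<close> only \<open>S = {}\<close> is tested, so any nonzero linear
  form will do; this one is the sum of all variables.\<close>

lemma balanced_neighborly_polynomial_one:
  assumes "n 1 > 0"
  shows "balanced_neighborly_polynomial 1 n (form_poly 1 n (\<lambda>_. 1 :: 'k::field))"
proof (rule balanced_neighborly_form_poly)
  fix S and c :: "(nat \<times> nat) set \<Rightarrow> 'k" and A
  assume S: "S \<subseteq> {1..1}" "real (card S) \<le> real 1 / 2"
    and z: "\<And>A'. A' \<in> rainbow (variables 1 n) fst ({1..1} - S) \<Longrightarrow>
      (\<Sum>A\<in>rainbow (variables 1 n) fst S. c A * 1) = 0"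
    and A: "A \<in> rainbow (variables 1 n) fst S"
  have "finite S" using finite_subset[OF S(1)] by simp
  moreover have "real (card S) < 1" using S(2) by simp
  then have "card S = 0" by simp
  ultimately have S0: "S = {}" by simp
  have r: "rainbow (variables 1 n) fst S = {{}}" by (auto simp: S0 rainbow_def)
  have "{(1, 1)} \<in> rainbow (variables 1 n) fst ({1..1} - S)"
    using assms by (auto simp: S0 rainbow_def variables_def)
  from z[OF this] have "(\<Sum>A\<in>{{}}. c A * 1) = 0" by (simp only: r)
  then show "c A = 0" using A unfolding r by simp
qed

theorem proposition4p1:
  fixes d :: nat and n :: "nat \<Rightarrow> nat"
  assumes "d > 0" and "\<And>i. i \<in> {1..d} \<Longrightarrow> n i > 0"
    and "\<exists>(\<Delta> :: 'v set set) \<kappa>. balanced_neighborly_sphere TYPE('l::field) d n \<Delta> \<kappa>"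
  shows "\<exists>f :: (nat \<times> nat, 'k::field) mpoly. balanced_neighborly_polynomial d n f"
proof (cases "d = 1")
  case True
  \<comment> \<open>For \<open>d = 1\<close> singletons exceed \<open>d / 2\<close>, so
    neighborliness does not tie \<open>n 1\<close> to the number of vertices, and a polynomial is
    given directly.\<close>
  then show ?thesis using balanced_neighborly_polynomial_one[of n] assms(2)[of 1] by auto
next
  case False
  then have d2: "d \<ge> 2" using assms(1) by simp
  obtain \<Delta> :: "'v set set" and \<kappa> where \<Delta>: "balanced_neighborly_sphere TYPE('l) d n \<Delta> \<kappa>"
    using assms(3) by blast
  then have sph: "simplicial_sphere \<Delta>" and dim: "complex_dim \<Delta> = int d - 1"
    and col: "proper_coloring d \<Delta> \<kappa>"
    and red: "\<And>S. S \<subseteq> {1..d} \<Longrightarrow> real (card S) \<le> real d / 2 \<Longrightarrow>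
      reduction_dim TYPE('l) d \<Delta> \<kappa> S = (\<Prod>k\<in>S. n k)"
    by (simp_all add: balanced_neighborly_sphere_def)
  have cx: "simplicial_complex \<Delta>" using sph by (simp add: simplicial_sphere_def)
  interpret coloured_complex \<Delta> \<kappa> d "TYPE('l)" by unfold_locales (fact cx, fact col)
  let ?X = "variables d n"
  have "\<forall>i\<in>{1..d}. \<exists>v. v \<in> V \<and> \<kappa> v = i" using exists_vertex_of_colour[OF cx dim col] by simp
  from bchoice[OF this] obtain \<beta> where "\<forall>i\<in>{1..d}. \<beta> i \<in> V \<and> \<kappa> (\<beta> i) = i" ..
  then have \<beta>: "\<And>i. i \<in> {1..d} \<Longrightarrow> \<beta> i \<in> V \<and> \<kappa> (\<beta> i) = i" by simp
  have card: "card {x \<in> V. \<kappa> x = i} = n i + 1" if i: "i \<in> {1..d}" for i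
  proof -
    have "card {x \<in> V. \<kappa> x = i} - 1 = n i"
      using reduction_dim_singleton[OF i, of "\<beta> i"] \<beta>[OF i] red[of "{i}"] i d2 by simp
    \<comment> \<open>Positivity of \<open>n i\<close> excludes that the natural subtraction was
      truncated.\<close>
    then show ?thesis using assms(2)[OF i] by simp
  qed
  have faces: "rainbow V \<kappa> S \<subseteq> \<Delta>" if S: "S \<subseteq> {1..d}" "real (card S) \<le> real d / 2" for S
  proof (rule rainbow_faces[OF S(1)])
    show "card {x \<in> V. \<kappa> x = i} \<ge> 2" if "i \<in> S" for i
      using card[of i] assms(2)[of i] S(1) that by force
    have "(\<Prod>i\<in>S. n i) = (\<Prod>i\<in>S. card {x \<in> V. \<kappa> x = i} - 1)"
      using card S(1) by (intro prod.cong) auto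
    then show "reduction_dim TYPE('l) d \<Delta> \<kappa> S = (\<Prod>i\<in>S. card {x \<in> V. \<kappa> x = i} - 1)"
      using red[OF S] by simp
  qed
  have colV: "\<kappa> ` V \<subseteq> {1..d}" using col by (simp add: proper_coloring_def)
  obtain \<xi> where \<xi>: "bij_betw \<xi> ?X (V - \<beta> ` {1..d})" "\<And>x. x \<in> ?X \<Longrightarrow> \<kappa> (\<xi> x) = fst x"
    using exists_bij_variables[of V \<kappa> d \<beta> n, OF finite_V colV \<beta> card] by metis
  have bij: "bij_betw ((`) \<xi>) (rainbow ?X fst S) {G \<in> rainbow V \<kappa> S. G \<inter> \<beta> ` {1..d} = {}}" for S
    using bij_betw_rainbow[where \<kappa> = \<kappa> and c = fst and S = S, OF \<xi>] by (simp only: rainbow_Diff_eq)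
  obtain \<phi> :: "'v set \<Rightarrow> 'k" where \<phi>:
    "\<And>S c G. S \<subseteq> {1..d} \<Longrightarrow> rainbow V \<kappa> S \<subseteq> \<Delta> \<Longrightarrow>
      (\<And>G'. G' \<in> rainbow V \<kappa> ({1..d} - S) \<Longrightarrow> G' \<inter> \<beta> ` {1..d} = {} \<Longrightarrow>
        (\<Sum>G\<in>rainbow V \<kappa> S. c G * \<phi> (G \<union> G')) = 0) \<Longrightarrow>
      (\<And>G. G \<in> rainbow V \<kappa> S \<Longrightarrow> G \<inter> \<beta> ` S \<noteq> {} \<Longrightarrow> c G = 0) \<Longrightarrow>
      G \<in> rainbow V \<kappa> S \<Longrightarrow> c G = 0"
    by (rule sphere_nondegenerate_form[OF sph dim assms(1) col \<beta>]) blast+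
  have "balanced_neighborly_polynomial d n (form_poly d n (\<lambda>A. \<phi> (\<xi> ` A)))"
  proof (rule balanced_neighborly_form_poly)
    fix S and c :: "(nat \<times> nat) set \<Rightarrow> 'k" and A
    assume S: "S \<subseteq> {1..d}" "real (card S) \<le> real d / 2"
      and z: "\<And>A'. A' \<in> rainbow ?X fst ({1..d} - S) \<Longrightarrow>
        (\<Sum>A\<in>rainbow ?X fst S. c A * \<phi> (\<xi> ` (A \<union> A'))) = 0"
      and A: "A \<in> rainbow ?X fst S"
    let ?B = "{G \<in> rainbow V \<kappa> S. G \<inter> \<beta> ` {1..d} = {}}"
    \<comment> \<open>The coefficients are carried to vertex sets and extended by 0 to sets through
      an eliminated vertex, as the nondegeneracy of \<phi> demands.\<close>
    define c' where "c' G = (if G \<inter> \<beta> ` {1..d} = {} then c (the_inv_into (rainbow ?X fst S) ((`) \<xi>) G) else 0)" for G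
    have c': "c' (\<xi> ` B) = c B" if "B \<in> rainbow ?X fst S" for B
    proof -
      have "\<xi> ` B \<in> ?B" using bij_betwE[OF bij] that by blast
      moreover have "the_inv_into (rainbow ?X fst S) ((`) \<xi>) (\<xi> ` B) = B"
        using bij[of S] that by (intro the_inv_into_f_f) (auto simp: bij_betw_def)
      ultimately show ?thesis by (simp add: c'_def)
    qed
    have "c' (\<xi> ` A) = 0"
    proof (rule \<phi>[OF S(1) faces[OF S]])
      fix G' assume "G' \<in> rainbow V \<kappa> ({1..d} - S)" "G' \<inter> \<beta> ` {1..d} = {}"
      then have "G' \<in> (`) \<xi> ` rainbow ?X fst ({1..d} - S)"
        unfolding bij_betw_imp_surj_on[OF bij[of "{1..d} - S"]] by simp
      then obtain A' where A': "G' = \<xi> ` A'" "A' \<in> rainbow ?X fst ({1..d} - S)" by (rule imageE)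
      have "(\<Sum>G\<in>rainbow V \<kappa> S. c' G * \<phi> (G \<union> G')) = (\<Sum>G\<in>?B. c' G * \<phi> (G \<union> G'))"
        using finite_rainbow[OF finite_V] by (intro sum.mono_neutral_right) (auto simp: c'_def)
      also have "\<dots> = (\<Sum>B\<in>rainbow ?X fst S. c' (\<xi> ` B) * \<phi> (\<xi> ` B \<union> G'))"
        using sum.reindex_bij_betw[OF bij[of S], of "\<lambda>G. c' G * \<phi> (G \<union> G')"] by simp
      also have "\<dots> = (\<Sum>B\<in>rainbow ?X fst S. c B * \<phi> (\<xi> ` (B \<union> A')))"
        by (intro sum.cong refl) (simp add: c' A'(1) image_Un)
      also have "\<dots> = 0" by (rule z[OF A'(2)])
      finally show "(\<Sum>G\<in>rainbow V \<kappa> S. c' G * \<phi> (G \<union> G')) = 0" .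
    next
      fix G assume "G \<inter> \<beta> ` S \<noteq> {}"
      then have "G \<inter> \<beta> ` {1..d} \<noteq> {}" using S(1) by blast
      then show "c' G = 0" by (simp add: c'_def)
    next
      show "\<xi> ` A \<in> rainbow V \<kappa> S" using bij_betwE[OF bij] A by blast
    qed
    then show "c A = 0" using c'[OF A] by simp
  qed
  then show ?thesis by blast
qed

end
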